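(* Let $A_1$ be a $p$-periodic Herman ring of $f$, where either (a) $f$ is a rational map and $p\geq 2$; or (b) $f$ is a transcendental meromorphic function and $p\geq 1$. Then $A_1$ cannot contain any circle $C$ satisfying $f^{\circ p}(C)=C$.
   Context: Rational maps are of degree at least two. A transcendental meromorphic function is a map $f:\mathbb{C}\to\widehat{\mathbb{C}}$, meromorphic in $\mathbb{C}$, with exactly one essential singularity, located at $\infty$. A periodic Fatou component $U$ of $f$ is called a Herman ring if $U$ is conformally isomorphic to an annulus and the restriction of $f$, or of some iterate of $f$, to $U$ is conformally conjugate to an irrational rotation of this annulus. It is $p$-periodic if its exact period as a Fatou component is $p$. $f^{\circ p}$ denotes the $p$-th iterate of $f$. A circle means a round (Euclidean) circle. *)

theory Defs
  imports "HOL-Complex_Analysis.Complex_Analysis"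
    "HOL-Computational_Algebra.Computational_Algebra"
begin

text \<open>The Riemann sphere is the one-point compactification of the plane;
  \<^term>\<open>None\<close> is the point at infinity.\<close>

type_synonym riemann_sphere = "complex option"

abbreviation (input) infty :: riemann_sphere where
  "infty \<equiv> None"

definition sphere_top :: "riemann_sphere topology" where
  "sphere_top = Alexandroff_compactification (euclidean :: complex topology)"

text \<open>Distance in Euclidean 3-space of the stereographic images on the unit sphere.\<close>

fun chordal_dist :: "riemann_sphere \<Rightarrow> riemann_sphere \<Rightarrow> real" where
  "chordal_dist (Some z) (Some w) =
     2 * cmod (z - w) / (sqrt (1 + (cmod z)\<^sup>2) * sqrt (1 + (cmod w)\<^sup>2))"
| "chordal_dist (Some z) None = 2 / sqrt (1 + (cmod z)\<^sup>2)"
| "chordal_dist None (Some w) = 2 / sqrt (1 + (cmod w)\<^sup>2)"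
| "chordal_dist None None = 0"

definition rational_map :: "nat \<Rightarrow> (riemann_sphere \<Rightarrow> riemann_sphere) \<Rightarrow> bool" where
  "rational_map d f \<longleftrightarrow>
     (\<exists>P Q :: complex poly. Q \<noteq> 0 \<and> coprime P Q \<and> d = max (degree P) (degree Q) \<and>
        (\<forall>z. f (Some z) = (if poly Q z = 0 then infty else Some (poly P z / poly Q z))) \<and>
        f infty = (if degree P > degree Q then infty
                   else Some (coeff P (degree Q) / lead_coeff Q)))"

text \<open>The essential singularity at infinity is meant in the wide sense that the function does
  not extend meromorphically to infinity; poles may accumulate there. The value of
  the HOL function at infinity is junk, so that point is left out of the domain wherever
  such a function is iterated.\<close>

definition transcendental_meromorphic :: "(riemann_sphere \<Rightarrow> riemann_sphere) \<Rightarrow> bool" where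
  "transcendental_meromorphic f \<longleftrightarrow>
     (\<exists>g. g nicely_meromorphic_on UNIV \<and> \<not> (\<lambda>w. g (inverse w)) meromorphic_on {0} \<and>
        (\<forall>z. f (Some z) = (if is_pole g z then infty else Some (g z))))"

text \<open>Below, \<open>D\<close> is the domain of \<open>f\<close>: the sphere for a rational map, the plane for a
  transcendental meromorphic function.\<close>

definition iterate_domain :: "riemann_sphere set \<Rightarrow> (riemann_sphere \<Rightarrow> riemann_sphere) \<Rightarrow> nat \<Rightarrow> riemann_sphere set" where
  "iterate_domain D f n = {z. \<forall>k<n. (f ^^ k) z \<in> D}"

definition normal_family_on :: "riemann_sphere set \<Rightarrow> (riemann_sphere \<Rightarrow> riemann_sphere) set \<Rightarrow> bool" where
  "normal_family_on U F \<longleftrightarrow>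
     (\<forall>s :: nat \<Rightarrow> riemann_sphere \<Rightarrow> riemann_sphere. range s \<subseteq> F \<longrightarrow>
        (\<exists>r g. strict_mono (r :: nat \<Rightarrow> nat) \<and>
           (\<forall>K. compactin sphere_top K \<and> K \<subseteq> U \<longrightarrow>
              (\<forall>e>0. \<forall>\<^sub>F n in sequentially. \<forall>z\<in>K. chordal_dist (s (r n) z) (g z) < e))))"

definition fatou_set :: "riemann_sphere set \<Rightarrow> (riemann_sphere \<Rightarrow> riemann_sphere) \<Rightarrow> riemann_sphere set" where
  "fatou_set D f =
     {z. \<exists>U. openin sphere_top U \<and> z \<in> U \<and> (\<forall>n. U \<subseteq> iterate_domain D f n) \<and>
             normal_family_on U (range (\<lambda>n. f ^^ n))}"

definition fatou_component :: "riemann_sphere set \<Rightarrow> (riemann_sphere \<Rightarrow> riemann_sphere) \<Rightarrow> riemann_sphere set \<Rightarrow> bool" where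
  "fatou_component D f U \<longleftrightarrow>
     U \<in> connected_components_of (subtopology sphere_top (fatou_set D f))"

text \<open>Iterates map Fatou components into Fatou components, but for transcendental functions
  not necessarily onto; hence inclusion rather than equality.\<close>

definition exact_period :: "(riemann_sphere \<Rightarrow> riemann_sphere) \<Rightarrow> nat \<Rightarrow> riemann_sphere set \<Rightarrow> bool" where
  "exact_period f p U \<longleftrightarrow>
     p > 0 \<and> (f ^^ p) ` U \<subseteq> U \<and> (\<forall>q. 0 < q \<and> q < p \<longrightarrow> \<not> (f ^^ q) ` U \<subseteq> U)"

definition chart_infty :: "complex \<Rightarrow> riemann_sphere" where
  "chart_infty w = (if w = 0 then infty else Some (inverse w))"

text \<open>For open \<open>U\<close>, this is holomorphy in the two standard charts of the sphere.\<close>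

definition sphere_holomorphic_on :: "(riemann_sphere \<Rightarrow> complex) \<Rightarrow> riemann_sphere set \<Rightarrow> bool" where
  "sphere_holomorphic_on \<phi> U \<longleftrightarrow>
     (\<phi> \<circ> Some) holomorphic_on (Some -` U) \<and>
     (\<phi> \<circ> chart_infty) holomorphic_on (chart_infty -` U)"

definition conformal_iso :: "(riemann_sphere \<Rightarrow> complex) \<Rightarrow> riemann_sphere set \<Rightarrow> complex set \<Rightarrow> bool" where
  "conformal_iso \<phi> U V \<longleftrightarrow>
     openin sphere_top U \<and> sphere_holomorphic_on \<phi> U \<and> bij_betw \<phi> U V"

definition annulus :: "real \<Rightarrow> real \<Rightarrow> complex set" where
  "annulus r R = {z. r < cmod z \<and> cmod z < R}"

definition herman_ring :: "riemann_sphere set \<Rightarrow> (riemann_sphere \<Rightarrow> riemann_sphere) \<Rightarrow> nat \<Rightarrow> riemann_sphere set \<Rightarrow> bool" where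
  "herman_ring D f p U \<longleftrightarrow>
     fatou_component D f U \<and> exact_period f p U \<and>
     (\<exists>\<phi> r R k \<theta>. 0 < r \<and> r < R \<and> conformal_iso \<phi> U (annulus r R) \<and>
        k > 0 \<and> (f ^^ k) ` U \<subseteq> U \<and> \<theta> \<notin> \<rat> \<and>
        (\<forall>z\<in>U. \<phi> ((f ^^ k) z) = cis (2 * pi * \<theta>) * \<phi> z))"

definition euclidean_circle :: "riemann_sphere set \<Rightarrow> bool" where
  "euclidean_circle C \<longleftrightarrow> (\<exists>a r. r > 0 \<and> C = Some ` sphere a r)"

end

(*
Let F be the p-th iterate and C the circle. Since F maps C to itself, F commutes with the
reflection in C by the Schwarz reflection principle; only this, and C lying in the domain of F,
matters in the transcendental case. There the reflection of infinity, the centre of C, must be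
mapped to infinity by some iterate of f, and the symmetry relates the preimages of a discrete set
under a function with an essential singularity at infinity to those under a function of polynomial
growth. Schottky's theorem shows that the former are too numerous.

For rational f and p >= 2, f(C) is disjoint from C and f is injective on both. By the argument
principle the numbers of preimages, under f and F, in the side X of C containing f(C) are constant
up to one unit on the complements of f(C) and C. Comparing the two ways of composing f with F, and
using the symmetry and parity, one finds that F maps the region between C and f(C) into itself up
to closure. By Montel's theorem this region lies in the Fatou set, so C and f(C) lie in the same
Fatou component, contradicting the exact period p >= 2.
*)
theory Submission
  imports Defs
begin

section \<open>Growth of preimages near an essential singularity\<close>

text \<open>Symmetry alone is never contradictory: suitable Blaschke products c z^2 (z - a) / (1 -
  conj(a) z) have a fixed Herman ring containing the unit circle. The rational argument must
  therefore exploit that f(C) is a second curve off C, and the transcendental one the essential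
  singularity. The obstacle in the transcendental case is that F need not be holomorphic near
  infinity: its domain omits a countable set that may accumulate there and elsewhere. Hence the two
  symmetric orbits are compared only up to the time j at which the centre reaches infinity. At that
  time one side is a function with a pole. The other side is shown to be holomorphic near infinity
  by passing repeatedly to limit points of the set where the remaining iterate is undefined or has a
  prescribed value. In the rational case injectivity of f and F on C, inherited from the conjugacy
  to a rotation, makes both image curves Jordan curves, so that their winding numbers are only 0 or
  a fixed sign. Generic values are used throughout, so that fibres are counted without
  multiplicity.\<close>

lemma maximum_modulus_annulus:
  fixes \<rho> t :: real
  assumes hol: "f holomorphic_on U" and U: "{z. \<rho> \<le> cmod z \<and> cmod z \<le> t} \<subseteq> U" and "open U"
    and inner: "\<And>z. cmod z = \<rho> \<Longrightarrow> cmod (f z) \<le> B"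
    and outer: "\<And>z. cmod z = t \<Longrightarrow> cmod (f z) \<le> B"
    and z: "\<rho> \<le> cmod z" "cmod z \<le> t"
  shows "cmod (f z) \<le> B"
proof -
  define S where "S = {z. \<rho> < cmod z \<and> cmod z < t}"
  define T where "T = {z. \<rho> \<le> cmod z \<and> cmod z \<le> t}"
  have opS: "open S"
    unfolding S_def by (intro open_Collect_conj open_Collect_less continuous_intros)
  have clT: "closed T"
    unfolding T_def by (intro closed_Collect_conj closed_Collect_le continuous_intros)
  have "S \<subseteq> T" by (auto simp: S_def T_def)
  then have clS: "closure S \<subseteq> T" using clT by (simp add: closure_minimal)
  show ?thesis
  proof (cases "z \<in> S")
    case False
    then have "cmod z = \<rho> \<or> cmod z = t" using z by (auto simp: S_def)
    then show ?thesis using inner outer by blast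
  next
    case True
    show ?thesis
    proof (rule maximum_modulus_frontier[of f S])
      show "f holomorphic_on interior S"
        using hol U \<open>S \<subseteq> T\<close> interior_subset[of S] unfolding T_def
        by (meson holomorphic_on_subset order_trans)
      show "continuous_on (closure S) f"
        using hol U clS unfolding T_def
        by (meson holomorphic_on_imp_continuous_on holomorphic_on_subset order_trans)
      show "bounded S"
        by (rule bounded_subset[of "cball 0 t"]) (auto simp: S_def)
      show "cmod (f x) \<le> B" if "x \<in> frontier S" for x
      proof -
        have "x \<in> T - S" using that clS opS by (auto simp: frontier_def interior_open)
        then have "cmod x = \<rho> \<or> cmod x = t" by (auto simp: S_def T_def)
        then show ?thesis using inner outer by blast
      qed
    qed (use True in auto)
  qed
qed

lemma open_outside_disc: "open {z::complex. R < cmod z}"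
  by (intro open_Collect_less continuous_intros)

lemma compact_annulus: "compact {z::complex. a \<le> cmod z \<and> cmod z \<le> b}"
proof -
  have "closed {z::complex. a \<le> cmod z \<and> cmod z \<le> b}"
    by (intro closed_Collect_conj closed_Collect_le continuous_intros)
  moreover have "bounded {z::complex. a \<le> cmod z \<and> cmod z \<le> b}"
    by (rule bounded_subset[of "cball 0 b"]) auto
  ultimately show ?thesis by (simp add: compact_eq_bounded_closed)
qed

lemma holomorphic_bounded_on_annulus:
  assumes "f holomorphic_on {z. R < cmod z}" "R < a"
  obtains M where "M > 0" "\<And>z. a \<le> cmod z \<Longrightarrow> cmod z \<le> b \<Longrightarrow> cmod (f z) \<le> M"
proof -
  have "continuous_on {z. a \<le> cmod z \<and> cmod z \<le> b} f"
    by (rule continuous_on_subset[OF holomorphic_on_imp_continuous_on[OF assms(1)]]) (use assms in auto)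
  then have "bounded (f ` {z. a \<le> cmod z \<and> cmod z \<le> b})"
    by (intro compact_imp_bounded compact_continuous_image compact_annulus)
  then obtain M where "M > 0" "\<forall>x\<in>f ` {z. a \<le> cmod z \<and> cmod z \<le> b}. cmod x \<le> M"
    unfolding bounded_pos by blast
  then show ?thesis by (intro that[of M]) auto
qed

text \<open>Growth is wanted on every large circle, not only at some points. If it failed on circles
  of arbitrarily large radius, the maximum principle for \<open>g z / z ^ B\<close> on annuli ending
  at these circles would bound g by a multiple of \<open>cmod z ^ B\<close>, against the hypothesis
  with exponent \<open>Suc B\<close>.\<close>

lemma superpolynomial_growth:
  assumes hol: "g holomorphic_on {z. R < cmod z}"
    and ess: "\<And>B L. \<exists>z. L < cmod z \<and> cmod z ^ B < cmod (g z)"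
  obtains t0 where "\<And>t. t0 \<le> t \<Longrightarrow> \<exists>z. cmod z = t \<and> t ^ B \<le> cmod (g z)"
proof -
  define \<rho> where "\<rho> = max R 0 + 1"
  have \<rho>: "\<rho> > R" "\<rho> \<ge> 1" by (auto simp: \<rho>_def)
  obtain M where M: "M > 0" "\<And>z. \<rho> \<le> cmod z \<Longrightarrow> cmod z \<le> \<rho> \<Longrightarrow> cmod (g z) \<le> M"
    using holomorphic_bounded_on_annulus[OF hol \<rho>(1)] by blast
  have "\<exists>t0. \<forall>t\<ge>t0. \<exists>z. cmod z = t \<and> t ^ B \<le> cmod (g z)"
  proof (rule ccontr)
    assume "\<not> ?thesis"
    then have small: "\<exists>t\<ge>t0. \<forall>z. cmod z = t \<longrightarrow> cmod (g z) < t ^ B" for t0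
      by (meson not_le)
    have bd: "cmod (g z) \<le> max 1 M * cmod z ^ B" if z: "\<rho> \<le> cmod z" for z
    proof -
      obtain t where t: "cmod z \<le> t" "\<And>x. cmod x = t \<Longrightarrow> cmod (g x) < t ^ B"
        using small by blast
      have "t > 0" using t(1) z \<rho> by linarith
      have "cmod (g z / z ^ B) \<le> max 1 M"
      proof (rule maximum_modulus_annulus[where f = "\<lambda>z. g z / z ^ B" and U = "{z. R < cmod z} - {0}" and \<rho> = \<rho> and t = t])
        show "(\<lambda>z. g z / z ^ B) holomorphic_on {z. R < cmod z} - {0}"
          by (auto intro!: holomorphic_intros holomorphic_on_subset[OF hol])
        show "open ({z. R < cmod z} - {0})" using open_outside_disc by auto
        show "cmod (g x / x ^ B) \<le> max 1 M" if "cmod x = \<rho>" for x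
        proof -
          have "cmod (g x) \<le> M" using M(2) that by auto
          moreover have "cmod x ^ B \<ge> 1" using that \<rho> by simp
          ultimately have "cmod (g x) / cmod x ^ B \<le> M / 1"
            using M(1) by (intro frac_le) auto
          then show ?thesis by (simp add: norm_divide norm_power)
        qed
        show "cmod (g x / x ^ B) \<le> max 1 M" if "cmod x = t" for x
        proof -
          have "cmod (g x) / t ^ B \<le> 1"
            using t(2)[OF that] \<open>t > 0\<close> by (simp add: divide_le_eq_1)
          then show ?thesis using that by (simp add: norm_divide norm_power)
        qed
      qed (use t z \<rho> in auto)
      moreover have "cmod z ^ B > 0" using z \<rho> by (intro zero_less_power) linarith
      ultimately show ?thesis by (simp add: norm_divide norm_power pos_divide_le_eq)
    qed
    obtain z where z: "max \<rho> (max 1 M) < cmod z" "cmod z ^ Suc B < cmod (g z)"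
      using ess by blast
    have "cmod z ^ Suc B < max 1 M * cmod z ^ B"
      using bd[of z] z by simp
    moreover have "max 1 M * cmod z ^ B \<le> cmod z * cmod z ^ B"
      using z by (intro mult_right_mono) auto
    ultimately show False by simp
  qed
  then show ?thesis using that by blast
qed

text \<open>Schottky's bound exp(pi exp(pi (2 + 2 r + 12 t / (1 - t)))) for initial value r = 2 and
  radius t = 1/2, hence 18 = 2 + 4 + 12.\<close>

definition schottky_const :: real where
  "schottky_const = exp (pi * exp (pi * 18))"

lemma schottky_const_ge_1: "schottky_const \<ge> 1"
  by (simp add: schottky_const_def)

text \<open>Applying Schottky's theorem to a \<open>k\<close>-th root turns its doubly exponential bound into
  a polynomial one.\<close>

lemma Schottky_power:
  assumes hol: "f holomorphic_on cball 0 1"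
    and omit: "\<And>z. z \<in> cball 0 1 \<Longrightarrow> f z \<noteq> 0 \<and> f z \<noteq> 1"
    and k: "k > 0" "cmod (f 0) \<le> 2 ^ k" and z: "cmod z \<le> 1/2"
  shows "cmod (f z) \<le> schottky_const ^ k"
proof -
  obtain h where h: "h holomorphic_on cball 0 1" "\<And>z. z \<in> cball 0 1 \<Longrightarrow> f z = exp (h z)"
    by (rule contractible_imp_holomorphic_log[OF hol]) (use omit in \<open>auto intro: convex_imp_contractible\<close>)
  \<comment> \<open>The root omits 0 by construction and 1 because f does. The hypothesis on
    \<open>f 0\<close> is what makes its initial value at most 2.\<close>
  define H where "H = (\<lambda>z. exp (h z / of_nat k))"
  have Hk: "H z ^ k = f z" if "z \<in> cball 0 1" for z
    using h(2)[OF that] k by (simp add: H_def flip: exp_of_nat_mult)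
  have "cmod (H z) \<le> exp (pi * exp (pi * (2 + 2 * 2 + 12 * (1/2) / (1 - 1/2))))"
  proof (rule Schottky[where f = H])
    show "H holomorphic_on cball 0 1"
      unfolding H_def using k by (auto intro!: holomorphic_intros h)
    have "cmod (H 0) ^ k \<le> 2 ^ k"
      using k Hk[of 0] by (simp flip: norm_power)
    then show "cmod (H 0) \<le> 2"
      using k by (subst (asm) power_mono_iff) auto
    show "\<not> (H z = 0 \<or> H z = 1)" if "z \<in> cball 0 1" for z
      using omit[OF that] Hk[OF that] k by (auto simp: H_def)
  qed (use z in auto)
  then have "cmod (H z) \<le> schottky_const"
    by (simp add: schottky_const_def)
  then have "cmod (H z) ^ k \<le> schottky_const ^ k"
    by (intro power_mono) auto
  then show ?thesis using Hk[of z] z by (simp flip: norm_power)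
qed

text \<open>The map u to z1 exp(8 u) carries the unit disc into the annulus with radii exp(-8) and
  exp 8 times \<open>cmod z1\<close>. A point z2 of comparable modulus and any argument satisfies
  |Ln (z2 / z1)| <= ln 2 + pi < 4, so it is hit at some |u| <= 1/2; this is the origin of the
  8.\<close>

lemma Schottky_annulus:
  assumes hol: "G holomorphic_on U"
    and U: "\<And>z. exp (-8) * cmod z1 \<le> cmod z \<Longrightarrow> cmod z \<le> exp 8 * cmod z1 \<Longrightarrow> z \<in> U \<and> G z \<noteq> 0 \<and> G z \<noteq> 1"
    and z1: "z1 \<noteq> 0" and k: "k > 0" "cmod (G z1) \<le> 2 ^ k"
    and z2: "cmod z1 / 2 \<le> cmod z2" "cmod z2 \<le> 2 * cmod z1"
  shows "cmod (G z2) \<le> schottky_const ^ k"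
proof -
  define f where "f = (\<lambda>u. G (z1 * exp (8 * u)))"
  define u where "u = Ln (z2 / z1) / 8"
  have z20: "z2 \<noteq> 0" using z1 z2 by auto
  have in_U: "z1 * exp (8 * u) \<in> U \<and> f u \<noteq> 0 \<and> f u \<noteq> 1" if "u \<in> cball 0 1" for u
  proof -
    have "\<bar>Re u\<bar> \<le> 1" using that abs_Re_le_cmod[of u] by simp
    then have "exp (-8) \<le> exp (8 * Re u)" "exp (8 * Re u) \<le> exp (8::real)" by auto
    then have "exp (-8) * cmod z1 \<le> cmod (z1 * exp (8 * u))" "cmod (z1 * exp (8 * u)) \<le> exp 8 * cmod z1"
      using z1 by (auto simp: norm_mult)
    then show ?thesis using U unfolding f_def by blast
  qed
  have "cmod (f u) \<le> schottky_const ^ k"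
  proof (rule Schottky_power[where f = f, OF _ _ k(1)])
    have "(G \<circ> (\<lambda>u. z1 * exp (8 * u))) holomorphic_on cball 0 1"
      using in_U by (auto intro!: holomorphic_on_compose_gen[OF _ hol] holomorphic_intros)
    then show "f holomorphic_on cball 0 1" by (simp add: f_def o_def)
    have L: "cmod (Ln (z2 / z1)) \<le> \<bar>Re (Ln (z2 / z1))\<bar> + \<bar>Im (Ln (z2 / z1))\<bar>"
      by (rule cmod_le)
    have "Re (Ln (z2 / z1)) = ln (cmod z2 / cmod z1)"
      using z1 z20 by (simp add: norm_divide)
    moreover have "ln (cmod z2 / cmod z1) \<le> ln 2"
      using z1 z20 z2 by (subst ln_le_cancel_iff) (auto simp: field_simps)
    moreover have "ln (1/2) \<le> ln (cmod z2 / cmod z1)"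
      using z1 z20 z2 by (subst ln_le_cancel_iff) (auto simp: field_simps)
    moreover have "ln (1/2) = - ln (2::real)" by (simp add: ln_div)
    ultimately have "\<bar>Re (Ln (z2 / z1))\<bar> \<le> ln 2" by linarith
    moreover have "ln 2 \<le> (0.7::real)"
      using ln2_le_25_over_36 by simp
    moreover have "\<bar>Im (Ln (z2 / z1))\<bar> \<le> pi"
      using Im_Ln_le_pi[of "z2/z1"] mpi_less_Im_Ln[of "z2/z1"] z1 z20 by auto
    moreover have "pi \<le> 3.3" using pi_approx by simp
    ultimately have "cmod (Ln (z2 / z1)) \<le> 4" using L by linarith
    then show "cmod u \<le> 1/2" by (simp add: u_def norm_divide)
  qed (use in_U k in \<open>auto simp: f_def\<close>)
  moreover have "f u = G z2" using z1 z20 by (simp add: f_def u_def)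
  ultimately show ?thesis by simp
qed

text \<open>Writing f = (z - z0)^n g with g nonvanishing turns the expression into n + (z - z0) g' /
  g. One linear factor thus cancels the pole of f' / f even at a multiple zero.\<close>

lemma log_deriv_simple_pole:
  assumes hol: "f holomorphic_on S" "open S" "z0 \<in> S" "f z0 = 0"
    and nz: "\<exists>\<^sub>F z in at z0. f z \<noteq> 0"
  shows "\<exists>l. (\<lambda>z. (z - z0) * (deriv f z / f z)) \<midarrow>z0\<rightarrow> l"
proof -
  obtain e where e: "e > 0" "ball z0 e \<subseteq> S" using hol openE by blast
  have nc: "\<not> f constant_on ball z0 e"
  proof
    assume "f constant_on ball z0 e"
    then have "\<forall>z\<in>ball z0 e. f z = 0" using \<open>f z0 = 0\<close> e by (metis centre_in_ball constant_on_def)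
    then have "\<forall>\<^sub>F z in at z0. f z = 0"
      unfolding eventually_at using e by (auto simp: dist_commute)
    with nz show False by (simp add: frequently_def)
  qed
  obtain g r n where g: "0 < n" "0 < r" "ball z0 r \<subseteq> ball z0 e" "g holomorphic_on ball z0 r"
    "\<And>w. w \<in> ball z0 r \<Longrightarrow> f w = (w - z0) ^ n * g w" "\<And>w. w \<in> ball z0 r \<Longrightarrow> g w \<noteq> 0"
    by (rule holomorphic_factor_zero_nonconstant[OF holomorphic_on_subset[OF hol(1) e(2)] open_ball connected_ball _ hol(4) nc])
       (use e in auto)
  have gd: "deriv g holomorphic_on ball z0 r" using g by (intro holomorphic_deriv) auto
  have "((\<lambda>z. of_nat n + (z - z0) * deriv g z / g z) \<longlongrightarrow> of_nat n + (z0 - z0) * deriv g z0 / g z0) (at z0)"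
  proof (intro tendsto_intros)
    show "deriv g \<midarrow>z0\<rightarrow> deriv g z0"
      using g gd by (metis centre_in_ball continuous_on_eq_continuous_at holomorphic_on_imp_continuous_on isCont_def open_ball)
    show "g \<midarrow>z0\<rightarrow> g z0"
      using g by (metis centre_in_ball continuous_on_eq_continuous_at holomorphic_on_imp_continuous_on isCont_def open_ball)
    show "g z0 \<noteq> 0" using g by simp
  qed
  moreover have "\<forall>\<^sub>F z in at z0. of_nat n + (z - z0) * deriv g z / g z = (z - z0) * (deriv f z / f z)"
  proof -
    have "of_nat n + (z - z0) * deriv g z / g z = (z - z0) * (deriv f z / f z)" if z: "z \<noteq> z0" "dist z z0 < r" for z
    proof -
      have zr: "z \<in> ball z0 r" using z by (auto simp: dist_commute)
      have "(f has_field_derivative deriv g z * (z - z0) ^ n + of_nat n * (z - z0) ^ (n - 1) * g z) (at z)"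
      proof (rule has_field_derivative_transform_within_open[OF _ open_ball zr])
        show "((\<lambda>w. (w - z0) ^ n * g w) has_field_derivative deriv g z * (z - z0) ^ n + of_nat n * (z - z0) ^ (n - 1) * g z) (at z)"
          by (rule derivative_eq_intros refl holomorphic_derivI[OF g(4) open_ball zr] | simp)+
      qed (use g in auto)
      then have "deriv f z = deriv g z * (z - z0) ^ n + of_nat n * (z - z0) ^ (n - 1) * g z"
        by (rule DERIV_imp_deriv)
      moreover have "(z - z0) ^ n = (z - z0) * (z - z0) ^ (n - 1)"
        using g(1) by (simp add: power_eq_if)
      ultimately have "(z - z0) * deriv f z = (of_nat n + (z - z0) * deriv g z / g z) * ((z - z0) ^ n * g z)"
      proof -
        have "(z - z0) * deriv f z = deriv g z * (z - z0) * (z - z0) ^ n + of_nat n * ((z - z0) * (z - z0) ^ (n - 1)) * g z"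
          using \<open>deriv f z = _\<close> by (simp add: algebra_simps)
        also have "\<dots> = deriv g z * (z - z0) * (z - z0) ^ n + of_nat n * (z - z0) ^ n * g z"
          using \<open>(z - z0) ^ n = _\<close> by simp
        also have "\<dots> = (of_nat n + (z - z0) * deriv g z / g z) * ((z - z0) ^ n * g z)"
          using g(6)[OF zr] by (simp add: distrib_right)
        finally show ?thesis .
      qed
      then show ?thesis using g(5)[OF zr] g(6)[OF zr] z(1) by simp
    qed
    then show ?thesis unfolding eventually_at using g by blast
  qed
  ultimately show ?thesis by (auto dest: Lim_transform_eventually)
qed

section \<open>Rarely taken values of a function with an essential singularity\<close>

lemma connected_outside_disc: "connected {z::complex. R < cmod z}"
proof -
  have "{z::complex. R < cmod z} = - cball 0 R" by auto
  then show ?thesis by (simp add: connected_complement_bounded_convex)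
qed

text \<open>For functions holomorphic near infinity the failure of every polynomial bound excludes
  both a pole and a removable singularity. Growth is the form in which the singularity is
  used.\<close>

definition essential_at_infinity :: "(complex \<Rightarrow> complex) \<Rightarrow> bool" where
  "essential_at_infinity g \<longleftrightarrow> (\<forall>B L. \<exists>z. L < cmod z \<and> cmod z ^ B < cmod (g z))"

lemma essential_not_constant:
  assumes "essential_at_infinity g"
  shows "\<not> g constant_on {z. R < cmod z}"
proof
  assume "g constant_on {z. R < cmod z}"
  then obtain c where c: "\<And>z. R < cmod z \<Longrightarrow> g z = c" by (auto simp: constant_on_def)
  obtain z where "max R (cmod c) < cmod z" "cmod z ^ 1 < cmod (g z)"
    using assms unfolding essential_at_infinity_def by blast
  then show False using c[of z] by simp
qed

lemma finite_fibre_annulus: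
  assumes hol: "g holomorphic_on {z. R < cmod z}" and ess: "essential_at_infinity g" and "R < a"
  shows "finite {z. a \<le> cmod z \<and> cmod z \<le> b \<and> g z = w}"
proof -
  have "finite {z \<in> {z. a \<le> cmod z \<and> cmod z \<le> b}. g z - w = 0}"
  proof (rule holomorphic_compact_finite_zeros[OF _ open_outside_disc connected_outside_disc compact_annulus])
    show "(\<lambda>z. g z - w) holomorphic_on {z. R < cmod z}" by (intro holomorphic_intros hol)
    show "\<not> (\<lambda>z. g z - w) constant_on {z. R < cmod z}"
    proof
      assume "(\<lambda>z. g z - w) constant_on {z. R < cmod z}"
      then obtain c where "\<forall>z\<in>{z. R < cmod z}. g z - w = c" unfolding constant_on_def by blast
      then have "\<forall>z\<in>{z. R < cmod z}. g z = c + w" by (auto simp: algebra_simps)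
      then have "g constant_on {z. R < cmod z}" unfolding constant_on_def by blast
      then show False using essential_not_constant[OF ess] by blast
    qed
  qed (use \<open>R < a\<close> in auto)
  then show ?thesis by (auto simp: conj_assoc)
qed

text \<open>The circle may depend on the two values, but c may not. For one pair, some radius misses
  the finitely many preimages; if the lower bounds tended to 0 along pairs from a compact disc, a
  limit pair would contradict its own bound. Values far beyond the range of g on the annulus are
  avoided by every circle.\<close>

lemma avoiding_circle:
  assumes hol: "g holomorphic_on {z. R < cmod z}" and ess: "essential_at_infinity g"
    and ab: "R < a" "a < b" "0 < a"
  obtains c where "c > 0"
    "\<And>w w'. \<exists>\<rho>. a \<le> \<rho> \<and> \<rho> \<le> b \<and> (\<forall>z. cmod z = \<rho> \<longrightarrow>
       c * (1 + cmod w) \<le> cmod (g z - w) \<and> c * (1 + cmod w') \<le> cmod (g z - w'))"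
proof -
  define P where "P = (\<lambda>c w w'. \<exists>\<rho>. a \<le> \<rho> \<and> \<rho> \<le> b \<and> (\<forall>z. cmod z = \<rho> \<longrightarrow>
       c \<le> cmod (g z - w) \<and> c \<le> cmod (g z - w')))"
  obtain M where M: "M > 0" "\<And>z. a \<le> cmod z \<Longrightarrow> cmod z \<le> b \<Longrightarrow> cmod (g z) \<le> M"
    using holomorphic_bounded_on_annulus[OF hol ab(1)] by blast
  define K0 where "K0 = cball (0::complex) (2 * M + 1)"
  have pos: "\<exists>c>0. P c w w'" for w w'
  proof -
    define F where "F = cmod ` ({z. a \<le> cmod z \<and> cmod z \<le> b \<and> g z = w} \<union> {z. a \<le> cmod z \<and> cmod z \<le> b \<and> g z = w'})"
    have "finite F" unfolding F_def using finite_fibre_annulus[OF hol ess ab(1)] by blast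
    moreover have "infinite {a..b}" using ab by simp
    ultimately obtain \<rho> where \<rho>: "\<rho> \<in> {a..b}" "\<rho> \<notin> F" by (meson finite_subset subsetI)
    define h where "h = (\<lambda>z. min (cmod (g z - w)) (cmod (g z - w')))"
    have "continuous_on (sphere 0 \<rho>) g"
      by (rule continuous_on_subset[OF holomorphic_on_imp_continuous_on[OF hol]]) (use \<rho> ab in auto)
    then have "continuous_on (sphere 0 \<rho>) h" unfolding h_def by (intro continuous_intros)
    moreover have "sphere (0::complex) \<rho> \<noteq> {}" using \<rho> ab by simp
    ultimately obtain x where x: "x \<in> sphere 0 \<rho>" "\<forall>y\<in>sphere 0 \<rho>. h x \<le> h y"
      using continuous_attains_inf[OF compact_sphere] by blast
    have "h x > 0" using x(1) \<rho> unfolding h_def F_def by auto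
    moreover have "P (h x) w w'"
      unfolding P_def using \<rho> x(2) by (intro exI[of _ \<rho>]) (auto simp: h_def)
    ultimately show ?thesis by blast
  qed
  have "\<exists>c>0. \<forall>w\<in>K0. \<forall>w'\<in>K0. P c w w'"
  proof (rule ccontr)
    assume "\<not> ?thesis"
    then have *: "\<exists>w\<in>K0. \<exists>w'\<in>K0. \<not> P c w w'" if "c > 0" for c using that by blast
    have "\<exists>x\<in>K0 \<times> K0. \<not> P (1 / Suc n) (fst x) (snd x)" for n
      using *[of "1 / Suc n"] by auto
    then obtain x where x: "\<And>n. x n \<in> K0 \<times> K0" "\<And>n. \<not> P (1 / Suc n) (fst (x n)) (snd (x n))"
      by metis
    have "compact (K0 \<times> K0)" unfolding K0_def by (intro compact_Times) auto
    then obtain l r where l: "l \<in> K0 \<times> K0" "strict_mono (r :: nat \<Rightarrow> nat)" "(x \<circ> r) \<longlonglongrightarrow> l"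
      using x(1) unfolding compact_def by blast
    obtain c where c: "c > 0" "P c (fst l) (snd l)" using pos by blast
    have "\<forall>\<^sub>F n in sequentially. dist ((x \<circ> r) n) l < c / 2"
      using tendstoD[OF l(3), of "c / 2"] c(1) by simp
    moreover have "\<forall>\<^sub>F n in sequentially. 1 / real (Suc n) < c / 2"
      using c(1) by (intro order_tendstoD(2)[OF LIMSEQ_Suc[OF lim_1_over_n]]) auto
    ultimately have "\<forall>\<^sub>F n in sequentially. dist ((x \<circ> r) n) l < c / 2 \<and> 1 / real (Suc n) < c / 2"
      by eventually_elim auto
    then obtain n where n: "dist ((x \<circ> r) n) l < c / 2" "1 / real (Suc n) < c / 2"
      by (metis (no_types, lifting) eventually_at_top_linorder order_refl)
    have "n \<le> r n" using l(2) by (simp add: seq_suble)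
    then have "1 / real (Suc (r n)) \<le> 1 / real (Suc n)" by (intro divide_left_mono) auto
    then have small: "1 / real (Suc (r n)) < c / 2" using n by linarith
    have d: "cmod (fst (x (r n)) - fst l) < c / 2" "cmod (snd (x (r n)) - snd l) < c / 2"
      using n(1) dist_fst_le[of "x (r n)" l] dist_snd_le[of "x (r n)" l] by (auto simp: dist_norm)
    obtain \<rho> where \<rho>: "a \<le> \<rho>" "\<rho> \<le> b" "\<And>z. cmod z = \<rho> \<Longrightarrow> c \<le> cmod (g z - fst l) \<and> c \<le> cmod (g z - snd l)"
      using c(2) unfolding P_def by blast
    have "1 / real (Suc (r n)) \<le> cmod (g z - fst (x (r n))) \<and> 1 / real (Suc (r n)) \<le> cmod (g z - snd (x (r n)))"
      if "cmod z = \<rho>" for z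
      using \<rho>(3)[OF that] d small norm_triangle_ineq[of "g z - fst (x (r n))" "fst (x (r n)) - fst l"]
        norm_triangle_ineq[of "g z - snd (x (r n))" "snd (x (r n)) - snd l"] by auto
    then have "P (1 / Suc (r n)) (fst (x (r n))) (snd (x (r n)))"
      unfolding P_def using \<rho> by blast
    then show False using x(2) by blast
  qed
  then obtain c where c: "c > 0" "\<And>w w'. w \<in> K0 \<Longrightarrow> w' \<in> K0 \<Longrightarrow> P c w w'" by blast
  define c' where "c' = min (1/2) (c / (2 * M + 2))"
  have c': "c' > 0" "c' \<le> 1/2"
    using c(1) M(1) unfolding c'_def by (simp, intro min.cobounded1)
  have "c' \<le> c / (2 * M + 2)" by (simp add: c'_def)
  then have c'': "c' * (2 * M + 2) \<le> c" using M(1) by (simp add: pos_le_divide_eq)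
  have "\<exists>\<rho>. a \<le> \<rho> \<and> \<rho> \<le> b \<and> (\<forall>z. cmod z = \<rho> \<longrightarrow>
       c' * (1 + cmod w) \<le> cmod (g z - w) \<and> c' * (1 + cmod w') \<le> cmod (g z - w'))" for w w'
  proof -
    \<comment> \<open>A value u outside \<open>K0\<close> may be replaced by 0 when the circle is
      chosen: from |g| <= M and |u| > 2 M + 1 its distance to g exceeds (1 + |u|) / 2 on every
      circle of the annulus.\<close>
    define v where "v = (\<lambda>w. if w \<in> K0 then w else 0)"
    have "v w \<in> K0" "v w' \<in> K0" using M by (auto simp: v_def K0_def)
    then obtain \<rho> where \<rho>: "a \<le> \<rho>" "\<rho> \<le> b" "\<And>z. cmod z = \<rho> \<Longrightarrow> c \<le> cmod (g z - v w) \<and> c \<le> cmod (g z - v w')"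
      using c(2)[of "v w" "v w'"] unfolding P_def by blast
    have *: "c' * (1 + cmod u) \<le> cmod (g z - u)" if "cmod z = \<rho>" "c \<le> cmod (g z - v u)" for z u
    proof (cases "u \<in> K0")
      case True
      then have "c' * (1 + cmod u) \<le> c' * (2 * M + 2)" using c' by (auto simp: K0_def)
      then show ?thesis using True that c'' by (simp add: v_def)
    next
      case False
      then have "cmod u > 2 * M + 1" by (simp add: K0_def)
      moreover have "cmod (g z) \<le> M" using M(2) \<rho> that by auto
      moreover have "cmod u \<le> cmod (g z - u) + cmod (g z)"
        by (metis norm_minus_commute norm_triangle_sub add.commute)
      ultimately have "1 + cmod u \<le> 2 * cmod (g z - u)" by argo
      then have "1/2 * (1 + cmod u) \<le> cmod (g z - u)" by simp
      moreover have "c' * (1 + cmod u) \<le> 1/2 * (1 + cmod u)" using c' by (intro mult_right_mono) auto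
      ultimately show ?thesis by linarith
    qed
    then show ?thesis using \<rho> by blast
  qed
  with c'(1) show ?thesis using that by blast
qed

text \<open>N + 1 disjoint closed annuli cannot all meet a set of at most N points; the step 20 > 18
  keeps them apart. The ratio exp 18 leaves a factor exp 9 on either side of the middle circle: exp
  8 for Schottky's theorem and exp 1 >= 2 for moving its base point.\<close>

lemma free_annulus:
  fixes X :: "complex set"
  assumes "finite X" "card X \<le> N" "s > 0"
  obtains j where "j \<le> N" "\<And>z. z \<in> X \<Longrightarrow> \<not> (s * exp (20 * real j) \<le> cmod z \<and> cmod z \<le> s * exp (20 * real j + 18))"
proof -
  have "\<exists>j\<le>N. \<forall>z\<in>X. \<not> (s * exp (20 * real j) \<le> cmod z \<and> cmod z \<le> s * exp (20 * real j + 18))"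
  proof (rule ccontr)
    assume "\<not> ?thesis"
    then have "\<forall>j. \<exists>z. j \<le> N \<longrightarrow> z \<in> X \<and> s * exp (20 * real j) \<le> cmod z \<and> cmod z \<le> s * exp (20 * real j + 18)"
      by blast
    then obtain z where z: "\<And>j. j \<le> N \<Longrightarrow> z j \<in> X \<and> s * exp (20 * real j) \<le> cmod (z j) \<and> cmod (z j) \<le> s * exp (20 * real j + 18)"
      by metis
    have lt: "cmod (z i) < cmod (z j)" if "i < j" "j \<le> N" for i j
    proof -
      have "20 * real i + 18 < 20 * real j" using that by linarith
      then have "s * exp (20 * real i + 18) < s * exp (20 * real j)" using assms by simp
      then show ?thesis using z[of i] z[of j] that by linarith
    qed
    have "inj_on z {..N}"
      by (rule linorder_inj_onI) (use lt in \<open>force simp: atMost_def\<close>)+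
    then have "card {..N} \<le> card X"
      using z by (intro card_inj_on_le[OF _ _ assms(1)]) auto
    then show False using assms by simp
  qed
  then show ?thesis using that by blast
qed

lemma dyadic_between:
  fixes x :: real
  assumes "1 \<le> x"
  obtains k :: nat where "k > 0" "x < 2 ^ k" "2 ^ k \<le> 2 * x"
proof -
  define k where "k = (LEAST k. x < 2 ^ k)"
  have "\<exists>k. x < 2 ^ k" by (rule real_arch_pow) simp
  then have k: "x < 2 ^ k" unfolding k_def by (rule LeastI_ex)
  have "k > 0" using k assms by (intro gr0I) auto
  then have "\<not> x < 2 ^ (k - 1)" unfolding k_def by (intro not_less_Least) auto
  moreover have "(2::real) ^ k = 2 * 2 ^ (k - 1)" using \<open>k > 0\<close> by (simp add: power_eq_if)
  ultimately show ?thesis using k \<open>k > 0\<close> by (intro that) auto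
qed

text \<open>If few points are sent to w or w', some thick annulus between sqrt r and r contains none
  of them, and there G = (g - w) / (w' - w) omits 0 and 1. By superpolynomial growth G is enormous
  somewhere on the middle circle, so Schottky's theorem makes it larger than r ^ E on a
  neighbourhood of this circle. Cauchy's estimate for 1 / G bounds the derivative.\<close>

lemma two_value_outer:
  assumes hol: "g holomorphic_on {z. R < cmod z}" and ess: "essential_at_infinity g"
    and R: "R \<ge> 1" and K: "K \<ge> 1"
  obtains r0 where "r0 \<ge> 1" "\<And>r w w'. \<lbrakk>r0 \<le> r; cmod w \<le> K * r ^ l; cmod w' \<le> K * r ^ l; 1 / r \<le> cmod (w - w');
      finite {z. R + 1 \<le> cmod z \<and> cmod z \<le> r \<and> g z \<in> {w, w'}};
      card {z. R + 1 \<le> cmod z \<and> cmod z \<le> r \<and> g z \<in> {w, w'}} \<le> N\<rbrakk> \<Longrightarrow>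
      \<exists>t. R + 4 \<le> t \<and> t \<le> r \<and> (\<forall>z. cmod z = t \<longrightarrow> g z \<noteq> w \<and> g z \<noteq> w' \<and>
        cmod (deriv g z / ((g z - w) * (g z - w'))) \<le> 2 * r / r ^ E)"
proof -
  obtain q where q: "schottky_const \<le> 2 ^ q"
    using real_arch_pow[of 2 schottky_const] by (auto intro: less_imp_le)
  \<comment> \<open>The growth has to beat l for the size of w and w', \<open>E * q\<close> for
    Schottky's bound at the level r ^ E, and one more power absorbs the constant
    \<open>3 * K * 2 ^ q\<close>.\<close>
  define B where "B = l + E * q + 1"
  \<comment> \<open>The exponent is doubled because the circle found below only has radius t >= sqrt
    r.\<close>
  obtain t0 where t0: "\<And>t. t0 \<le> t \<Longrightarrow> \<exists>z. cmod z = t \<and> t ^ (2 * B) \<le> cmod (g z)"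
    using superpolynomial_growth[OF hol, of "2 * B"] ess unfolding essential_at_infinity_def by metis
  define s0 where "s0 = max (max t0 (R + 4)) (max (exp (20 * real N + 18)) (3 * K * 2 ^ q + 1))"
  have s0: "t0 \<le> s0" "R + 4 \<le> s0" "exp (20 * real N + 18) \<le> s0" "3 * K * 2 ^ q + 1 \<le> s0"
    by (auto simp: s0_def)
  have s01: "s0 \<ge> 1" using s0 R by linarith
  show ?thesis
  proof (rule that[of "s0 ^ 2"])
    show "s0 ^ 2 \<ge> 1" using s01 by simp
    fix r w w'
    assume r: "s0 ^ 2 \<le> r" and w: "cmod w \<le> K * r ^ l" "cmod w' \<le> K * r ^ l" "1 / r \<le> cmod (w - w')"
      and X: "finite {z. R + 1 \<le> cmod z \<and> cmod z \<le> r \<and> g z \<in> {w, w'}}"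
        "card {z. R + 1 \<le> cmod z \<and> cmod z \<le> r \<and> g z \<in> {w, w'}} \<le> N"
    \<comment> \<open>Starting at the square root leaves room for all N + 1 candidate annuli below
      r.\<close>
    define s where "s = sqrt r"
    have "r \<ge> 1" using r s01 by (meson one_le_power order_trans)
    have s: "s0 \<le> s" "s * s = r" "s \<ge> 1"
      using r s01 \<open>r \<ge> 1\<close> unfolding s_def by (auto simp: real_le_rsqrt)
    have "w \<noteq> w'" using w(3) \<open>r \<ge> 1\<close> by auto
    have "s > 0" using s by simp
    obtain j where j: "j \<le> N" "\<And>z. z \<in> {z. R + 1 \<le> cmod z \<and> cmod z \<le> r \<and> g z \<in> {w, w'}} \<Longrightarrow>
        \<not> (s * exp (20 * real j) \<le> cmod z \<and> cmod z \<le> s * exp (20 * real j + 18))"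
      by (rule free_annulus[OF X \<open>s > 0\<close>]) (rule that)
    have top: "s * exp (20 * real j + 18) \<le> r"
    proof -
      have "exp (20 * real j + 18) \<le> exp (20 * real N + 18)" using j by simp
      also have "\<dots> \<le> s" using s0 s by linarith
      finally have "s * exp (20 * real j + 18) \<le> s * s" using s by (intro mult_left_mono) auto
      then show ?thesis using s by simp
    qed
    \<comment> \<open>The middle circle of the free annulus on the logarithmic scale.\<close>
    define t where "t = s * exp (20 * real j + 9)"
    have st: "s \<le> t" using s(3) by (simp add: t_def)
    have te: "s * exp (20 * real j) = exp (-9) * t" "s * exp (20 * real j + 18) = exp 9 * t"
    proof -
      have "exp (-9) * t = s * exp ((-9) + (20 * real j + 9))" unfolding t_def exp_add by (simp only: mult_ac)
      then show "s * exp (20 * real j) = exp (-9) * t" by simp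
      have "exp 9 * t = s * exp (9 + (20 * real j + 9))" unfolding t_def exp_add by (simp only: mult_ac)
      then show "s * exp (20 * real j + 18) = exp 9 * t" by (simp add: add.commute)
    qed
    have tr: "t \<le> r"
    proof -
      have "t \<le> exp 9 * t" using st s by simp
      then show ?thesis using top te by simp
    qed
    have t: "R + 4 \<le> t" "t0 \<le> t" "t \<ge> 5" using st s s0 R by auto
    define G where "G = (\<lambda>z. (g z - w) / (w' - w))"
    have free: "R < cmod z \<and> G z \<noteq> 0 \<and> G z \<noteq> 1" if "exp (-9) * t \<le> cmod z" "cmod z \<le> exp 9 * t" for z
    proof -
      have "s \<le> s * exp (20 * real j)" using s by simp
      then have "R + 1 \<le> cmod z" using that te s s0 by linarith
      then have "g z \<notin> {w, w'}" using j(2)[of z] that te top by auto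
      then show ?thesis using \<open>R + 1 \<le> cmod z\<close> \<open>w \<noteq> w'\<close> by (auto simp: G_def)
    qed
    have holG: "G holomorphic_on {z. R < cmod z}" unfolding G_def using \<open>w \<noteq> w'\<close> by (auto intro!: holomorphic_intros hol)
    have "(1::real) \<le> r ^ E" using \<open>r \<ge> 1\<close> by simp
    then obtain k where k: "k > 0" "r ^ E < 2 ^ k" "2 ^ k \<le> 2 * r ^ E" using dyadic_between by blast
    obtain z2 where z2: "cmod z2 = t" "t ^ (2 * B) \<le> cmod (g z2)" using t0 t by blast
    have big: "schottky_const ^ k < cmod (G z2)"
    proof -
      have "schottky_const ^ k \<le> (2 ^ q) ^ k" using q schottky_const_ge_1 by (intro power_mono) auto
      also have "\<dots> = (2 ^ k) ^ q" by (simp add: mult.commute flip: power_mult)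
      also have "\<dots> \<le> (2 * r ^ E) ^ q" using k by (intro power_mono) auto
      also have "\<dots> = 2 ^ q * r ^ (E * q)" by (simp add: power_mult_distrib power_mult)
      finally have 1: "schottky_const ^ k \<le> 2 ^ q * r ^ (E * q)" .
      have "r ^ B = (s * s) ^ B" using s by simp
      also have "\<dots> = s ^ (2 * B)" by (simp add: power_mult power2_eq_square)
      also have "\<dots> \<le> t ^ (2 * B)" using st s by (intro power_mono) auto
      finally have 2: "r ^ B \<le> cmod (g z2)" using z2 by linarith
      have "cmod (g z2 - w) \<ge> r ^ B - K * r ^ l"
        using 2 w norm_triangle_ineq2[of "g z2" w] by linarith
      moreover have wle: "cmod (w' - w) \<le> 2 * K * r ^ l" using w norm_triangle_ineq4[of w' w] by linarith
      moreover have "r ^ B - K * r ^ l > 2 ^ q * r ^ (E * q) * (2 * K * r ^ l)"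
      proof -
        have "s \<le> s * s" using s(3) by simp
        then have "3 * K * 2 ^ q < r" using s0(4) s by linarith
        then have "3 * K * 2 ^ q * (r ^ l * r ^ (E * q)) < r * (r ^ l * r ^ (E * q))"
          using \<open>r \<ge> 1\<close> by (intro mult_strict_right_mono) auto
        also have "\<dots> = r ^ B" by (simp add: B_def power_add)
        finally have "3 * K * 2 ^ q * (r ^ l * r ^ (E * q)) < r ^ B" .
        moreover have "K * r ^ l * 1 \<le> K * r ^ l * (2 ^ q * r ^ (E * q))"
        proof (rule mult_left_mono)
          have "1 * 1 \<le> (2::real) ^ q * r ^ (E * q)"
            using \<open>r \<ge> 1\<close> by (intro mult_mono one_le_power) auto
          then show "1 \<le> 2 ^ q * r ^ (E * q)" by simp
        qed (use K \<open>r \<ge> 1\<close> in auto)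
        ultimately show ?thesis by (simp add: algebra_simps)
      qed
      ultimately have "2 ^ q * r ^ (E * q) * cmod (w' - w) < cmod (g z2 - w)"
      proof -
        have "2 ^ q * r ^ (E * q) * cmod (w' - w) \<le> 2 ^ q * r ^ (E * q) * (2 * K * r ^ l)"
          using wle \<open>r \<ge> 1\<close> by (intro mult_left_mono) auto
        then show ?thesis
          using \<open>cmod (g z2 - w) \<ge> _\<close> \<open>r ^ B - K * r ^ l > _\<close> by linarith
      qed
      then have "2 ^ q * r ^ (E * q) < cmod (G z2)"
        using \<open>w \<noteq> w'\<close> by (simp add: G_def norm_divide pos_less_divide_eq)
      then show ?thesis using 1 by linarith
    qed
    have e2: "(2::real) \<le> exp 1" using exp_ge_add_one_self[of 1] by simp
    \<comment> \<open>If G were at most 2 ^ k at z1, Schottky's theorem would bound it by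
      \<open>schottky_const ^ k\<close> at z2, which \<open>big\<close> excludes.\<close>
    have lower: "2 ^ k < cmod (G z1)" if z1: "t / 2 \<le> cmod z1" "cmod z1 \<le> 2 * t" for z1
    proof (rule ccontr)
      assume "\<not> 2 ^ k < cmod (G z1)"
      then have "cmod (G z1) \<le> 2 ^ k" by simp
      moreover have "z \<in> {z. R < cmod z} \<and> G z \<noteq> 0 \<and> G z \<noteq> 1"
        if z: "exp (-8) * cmod z1 \<le> cmod z" "cmod z \<le> exp 8 * cmod z1" for z
      proof -
        have "exp (-9) * t = exp (-8) * (exp (-1) * t)" by (simp flip: exp_add mult.assoc)
        also have "exp (-1) \<le> (1 / 2 :: real)" using e2 by (simp add: exp_minus field_simps)
        then have "exp (-8) * (exp (-1) * t) \<le> exp (-8) * (t / 2)"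
          using t by (intro mult_left_mono) auto
        also have "\<dots> \<le> exp (-8) * cmod z1" using z1 by simp
        finally have "exp (-9) * t \<le> cmod z" using z by linarith
        moreover have "exp 8 * cmod z1 \<le> exp 8 * (exp 1 * t)"
        proof (rule mult_left_mono)
          have "2 * t \<le> exp 1 * t" using e2 t by (intro mult_right_mono) auto
          then show "cmod z1 \<le> exp 1 * t" using z1 by linarith
        qed auto
        moreover have "exp 8 * (exp 1 * t) = exp 9 * t" by (simp flip: exp_add mult.assoc)
        ultimately show ?thesis using free[of z] z by auto
      qed
      ultimately have "cmod (G z2) \<le> schottky_const ^ k"
        using z1 z2 t k by (intro Schottky_annulus[OF holG, of z1]) auto
      then show False using big by simp
    qed
    have "g z \<noteq> w \<and> g z \<noteq> w' \<and> cmod (deriv g z / ((g z - w) * (g z - w'))) \<le> 2 * r / r ^ E" if z: "cmod z = t" for z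
    proof -
      have near: "t / 2 \<le> cmod x \<and> cmod x \<le> 2 * t" if "x \<in> cball z 1" for x
      proof -
        have "cmod (z - x) \<le> 1" using that by (simp add: dist_norm)
        then have "t - 1 \<le> cmod x" "cmod x \<le> t + 1"
          using z norm_triangle_ineq2[of z x] norm_triangle_ineq2[of x z] by (auto simp: norm_minus_commute)
        then show ?thesis using t by auto
      qed
      define k' where "k' = (\<lambda>z. 1 / G z)"
      have nz: "G x \<noteq> 0" if "x \<in> cball z 1" for x using lower[of x] near[OF that] by auto
      have sub: "cball z 1 \<subseteq> {z. R < cmod z}"
      proof
        fix x assume "x \<in> cball z 1"
        then have "cmod (z - x) \<le> 1" by (simp add: dist_norm)
        then have "t - 1 \<le> cmod x" using z norm_triangle_ineq2[of z x] by auto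
        then show "x \<in> {z. R < cmod z}" using t by auto
      qed
      have holk: "k' holomorphic_on cball z 1"
        unfolding k'_def using nz by (intro holomorphic_intros holomorphic_on_subset[OF holG sub]) auto
      have "cmod ((deriv ^^ 1) k' z) \<le> fact 1 * (1 / 2 ^ k) / 1 ^ 1"
      proof (rule Cauchy_inequality)
        show "k' holomorphic_on ball z 1" using holk by (rule holomorphic_on_subset) auto
        show "continuous_on (cball z 1) k'" using holk by (rule holomorphic_on_imp_continuous_on)
        fix x assume "cmod (z - x) = 1"
        then have "x \<in> cball z 1" by (simp add: dist_norm)
        then have "2 ^ k < cmod (G x)" using lower near by blast
        then show "cmod (k' x) \<le> 1 / 2 ^ k"
          unfolding k'_def norm_divide by (simp add: frac_le)
      qed auto
      then have dk: "cmod (deriv k' z) \<le> 1 / 2 ^ k" by simp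
      have zU: "z \<in> {z. R < cmod z}" using z t by simp
      have Gz: "2 ^ k < cmod (G z)" using lower[of z] near[of z] by auto
      then have Gz2: "2 < cmod (G z)"
        using power_increasing[of 1 k "2::real"] k(1) by simp
      then have gw: "g z \<noteq> w" "g z \<noteq> w'" using \<open>w \<noteq> w'\<close> by (auto simp: G_def)
      have dg: "(g has_field_derivative deriv g z) (at z)"
        using hol zU open_outside_disc holomorphic_derivI by blast
      have "(k' has_field_derivative (- ((w' - w) * deriv g z / ((g z - w) * (g z - w))))) (at z)"
      proof -
        have "((\<lambda>z. (w' - w) / (g z - w)) has_field_derivative (- ((w' - w) * deriv g z / ((g z - w) * (g z - w))))) (at z)"
          using gw by (auto intro!: derivative_eq_intros dg simp: power2_eq_square)
        moreover have "k' = (\<lambda>z. (w' - w) / (g z - w))" by (auto simp: k'_def G_def)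
        ultimately show ?thesis by simp
      qed
      then have dkz: "deriv k' z = - ((w' - w) * deriv g z / ((g z - w) * (g z - w)))" by (rule DERIV_imp_deriv)
      \<comment> \<open>The middle quotient equals G / (G - 1) and is at most 2 in modulus because
        |G| > 2; the separation 1 / r of the values controls the last divisor.\<close>
      have "deriv g z / ((g z - w) * (g z - w')) = - deriv k' z * ((g z - w) / (g z - w')) / (w' - w)"
        unfolding dkz using gw \<open>w \<noteq> w'\<close> by (simp add: divide_simps power2_eq_square)
      then have "cmod (deriv g z / ((g z - w) * (g z - w'))) = cmod (deriv k' z) * cmod ((g z - w) / (g z - w')) / cmod (w' - w)"
        by (simp add: norm_mult norm_divide)
      also have "\<dots> \<le> (1 / 2 ^ k) * 2 / (1 / r)"
      proof (rule frac_le; (rule mult_mono)?)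
        show "cmod (deriv k' z) \<le> 1 / 2 ^ k" by (rule dk)
        have "g z - w' = (w' - w) * (G z - 1)" "g z - w = (w' - w) * G z" using \<open>w \<noteq> w'\<close> by (auto simp: G_def field_simps)
        then have "(g z - w) / (g z - w') = G z / (G z - 1)" using \<open>w \<noteq> w'\<close> by simp
        moreover have "cmod (G z) \<le> 2 * cmod (G z - 1)" using Gz2 norm_triangle_ineq2[of "G z" 1] by simp
        moreover have "cmod (G z - 1) > 0" using gw \<open>w \<noteq> w'\<close> by (auto simp: G_def)
        ultimately show "cmod ((g z - w) / (g z - w')) \<le> 2" by (simp add: norm_divide divide_le_eq)
        show "1 / r \<le> cmod (w' - w)" using w by (simp add: norm_minus_commute)
      qed (use \<open>r \<ge> 1\<close> in auto)
      also have "\<dots> = 2 * r / 2 ^ k" by simp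
      also have "\<dots> \<le> 2 * r / r ^ E" using k \<open>r \<ge> 1\<close> by (intro divide_left_mono) auto
      finally show ?thesis using gw by blast
    qed
    then show "\<exists>t. R + 4 \<le> t \<and> t \<le> r \<and> (\<forall>z. cmod z = t \<longrightarrow> g z \<noteq> w \<and> g z \<noteq> w' \<and>
        cmod (deriv g z / ((g z - w) * (g z - w'))) \<le> 2 * r / r ^ E)"
      using t tr by blast
  qed
qed

text \<open>Since w and w' differ, only one factor of the denominator vanishes at a point of Y. By
  the logarithmic derivative the pole there is at most simple whatever the multiplicity, so one
  linear factor per point removes it. Dividing by \<open>cmod y\<close> makes each factor at most 2
  on the inner circle.\<close>

lemma two_value_extension:
  assumes hol: "g holomorphic_on {z. R < cmod z}" and ess: "essential_at_infinity g"
    and \<rho>: "R < \<rho>" "0 < \<rho>" "\<rho> < t" and w: "w \<noteq> w'"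
    and bdry: "\<And>z. cmod z = \<rho> \<or> cmod z = t \<Longrightarrow> g z \<notin> {w, w'}"
  defines "Y \<equiv> {z. \<rho> < cmod z \<and> cmod z < t \<and> g z \<in> {w, w'}}"
  obtains U H where "open U" "{z. \<rho> \<le> cmod z \<and> cmod z \<le> t} \<subseteq> U" "H holomorphic_on U"
    "\<And>z. z \<in> U - Y \<Longrightarrow> H z = (\<Prod>y\<in>Y. (z - y) / of_real (cmod y)) * (deriv g z / ((g z - w) * (g z - w')))"
proof -
  define F where "F = (\<lambda>z. (\<Prod>y\<in>Y. (z - y) / of_real (cmod y)) * (deriv g z / ((g z - w) * (g z - w'))))"
  define O0 where "O0 = {z. R < cmod z}"
  have O0: "open O0" unfolding O0_def by (rule open_outside_disc)
  have hol: "g holomorphic_on O0" using hol by (simp add: O0_def)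
  have cont: "continuous_on O0 g" by (rule holomorphic_on_imp_continuous_on[OF hol])
  define V where "V = O0 \<inter> g -` (- {w, w'})"
  have "open V" unfolding V_def
    by (rule continuous_open_preimage[OF cont O0]) (simp add: open_Compl)
  define A where "A = {z. \<rho> < cmod z} \<inter> {z. cmod z < t}"
  have "open A" unfolding A_def by (intro open_Int open_Collect_less continuous_intros)
  have AO: "A \<subseteq> O0" using \<rho> by (auto simp: A_def O0_def)
  \<comment> \<open>The open annulus lacks its boundary circles; there g avoids both values by
    \<open>bdry\<close>, so adding the open set V gives a neighbourhood of the closed
    annulus.\<close>
  define U where "U = V \<union> A"
  have "open U" using \<open>open V\<close> \<open>open A\<close> by (auto simp: U_def)
  have UO: "U \<subseteq> O0" using AO by (auto simp: U_def V_def)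
  have finY: "finite Y"
  proof -
    have fin: "finite {z. \<rho> \<le> cmod z \<and> cmod z \<le> t \<and> g z = v}" for v
      using finite_fibre_annulus[of g R \<rho>] assms by auto
    show ?thesis
      by (rule finite_subset[OF _ finite_UnI[OF fin[of w] fin[of w']]]) (auto simp: Y_def)
  qed
  have YU: "Y \<subseteq> A" by (auto simp: Y_def A_def)
  have gnot: "g z \<noteq> w \<and> g z \<noteq> w'" if "z \<in> U - Y" for z
    using that by (auto simp: U_def V_def A_def Y_def)
  have holdg: "deriv g holomorphic_on O0" using hol O0 by (rule holomorphic_deriv)
  have holF: "F holomorphic_on U - Y"
  proof -
    have "g holomorphic_on U - Y" "deriv g holomorphic_on U - Y"
      using hol holdg UO by (auto intro: holomorphic_on_subset)
    moreover have "y \<noteq> 0" if "y \<in> Y" for y using that \<rho> by (auto simp: Y_def)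
    ultimately show ?thesis unfolding F_def using gnot by (auto intro!: holomorphic_intros)
  qed
  have contdg: "isCont (deriv g) y" and contg: "isCont g y" if "y \<in> O0" for y
    using holomorphic_on_imp_continuous_on[OF holdg] cont O0 that by (auto simp: continuous_on_eq_continuous_at)
  have key: "\<exists>l. (\<lambda>z. (z - y) * (deriv g z / ((g z - v) * (g z - v')))) \<midarrow>y\<rightarrow> l"
    if y: "y \<in> O0" "g y = v" "v \<noteq> v'" for y v v'
  proof -
    have nz: "\<exists>\<^sub>F z in at y. g z - v \<noteq> 0"
    proof (rule ccontr)
      assume "\<not> ?thesis"
      then have ev: "\<forall>\<^sub>F z in at y. g z - v = 0" by (simp add: frequently_def)
      have "(\<lambda>z. g z - v) constant_on O0"
      proof -
        obtain e where e: "e > 0" "\<And>x. x \<noteq> y \<Longrightarrow> dist x y < e \<Longrightarrow> g x - v = 0"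
          using ev unfolding eventually_at by auto
        have h: "(\<lambda>z. g z - v) holomorphic_on O0" by (intro holomorphic_intros hol)
        have "g z - v = 0" if "z \<in> O0" for z
        proof (rule analytic_continuation[OF h O0 _ _ y(1), where U = "O0 \<inter> ball y e"])
          show "connected O0" unfolding O0_def by (rule connected_outside_disc)
          have "open (O0 \<inter> ball y e)" using O0 by auto
          then show "y islimpt O0 \<inter> ball y e" using y e O0 by (intro interior_limit_point) (auto simp: interior_open)
          show "g x - v = 0" if "x \<in> O0 \<inter> ball y e" for x
            using e(2)[of x] that y by (cases "x = y") (auto simp: dist_commute)
        qed (use that in auto)
        then show ?thesis by (auto simp: constant_on_def)
      qed
      then obtain c where "\<forall>z\<in>O0. g z - v = c" unfolding constant_on_def by blast
      then have "\<forall>z\<in>O0. g z = c + v" by (auto simp: algebra_simps)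
      then have "g constant_on {z. R < cmod z}" unfolding constant_on_def O0_def by blast
      then show False using essential_not_constant[OF ess] by blast
    qed
    have h: "(\<lambda>z. g z - v) holomorphic_on O0" by (intro holomorphic_intros hol)
    obtain l where l: "(\<lambda>z. (z - y) * (deriv (\<lambda>z. g z - v) z / (g z - v))) \<midarrow>y\<rightarrow> l"
      using log_deriv_simple_pole[OF h O0 y(1) _ nz] y by auto
    have "(\<lambda>z. (z - y) * (deriv (\<lambda>z. g z - v) z / (g z - v)) * (1 / (g z - v'))) \<midarrow>y\<rightarrow> l * (1 / (g y - v'))"
      using contg[OF y(1)] y by (intro tendsto_intros l) (auto simp: isCont_def)
    moreover have "\<forall>\<^sub>F z in at y. (z - y) * (deriv (\<lambda>z. g z - v) z / (g z - v)) * (1 / (g z - v'))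
        = (z - y) * (deriv g z / ((g z - v) * (g z - v')))"
    proof -
      have "\<forall>\<^sub>F z in at y. z \<in> O0" by (rule eventually_at_in_open'[OF O0 y(1)])
      then show ?thesis
      proof eventually_elim
        case (elim z)
        have "g field_differentiable at z" using hol O0 elim holomorphic_on_imp_differentiable_at by blast
        then have "deriv (\<lambda>z. g z - v) z = deriv g z" by simp
        then show ?case by simp
      qed
    qed
    ultimately have "(\<lambda>z. (z - y) * (deriv g z / ((g z - v) * (g z - v')))) \<midarrow>y\<rightarrow> l * (1 / (g y - v'))" by (rule Lim_transform_eventually)
    then show ?thesis by (rule exI)
  qed
  have "\<exists>H. H holomorphic_on U \<and> (\<forall>z\<in>U - Y. H z = F z)"
  proof (rule removable_singularities[OF finY _ holF])
    show "Y \<subseteq> interior U" using YU \<open>open U\<close> by (auto simp: interior_open U_def)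
    fix y assume y: "y \<in> Y"
    have yO: "y \<in> O0" using y YU AO by blast
    have "\<exists>l. (\<lambda>z. (z - y) * (deriv g z / ((g z - w) * (g z - w')))) \<midarrow>y\<rightarrow> l"
    proof (cases "g y = w")
      case True
      then show ?thesis using key[OF yO] w by blast
    next
      case False
      then have "g y = w'" using y by (auto simp: Y_def)
      then show ?thesis using key[OF yO, of w' w] w by (simp add: mult.commute)
    qed
    then obtain l where l: "(\<lambda>z. (z - y) * (deriv g z / ((g z - w) * (g z - w')))) \<midarrow>y\<rightarrow> l" by blast
    have y0: "y \<noteq> 0" using y \<rho> by (auto simp: Y_def)
    have "(\<lambda>z. (\<Prod>y\<in>Y - {y}. (z - y) / of_real (cmod y)) * (1 / of_real (cmod y)) * ((z - y) * (deriv g z / ((g z - w) * (g z - w')))))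
       \<midarrow>y\<rightarrow> (\<Prod>y'\<in>Y - {y}. (y - y') / of_real (cmod y')) * (1 / of_real (cmod y)) * l"
    proof (intro tendsto_mult l tendsto_prod tendsto_divide tendsto_diff tendsto_const tendsto_ident_at)
      show "complex_of_real (cmod i) \<noteq> 0" if "i \<in> Y - {y}" for i using that \<rho> by (auto simp: Y_def)
    qed (use y0 in auto)
    moreover have "(\<Prod>y\<in>Y - {y}. (z - y) / of_real (cmod y)) * (1 / of_real (cmod y)) * ((z - y) * (deriv g z / ((g z - w) * (g z - w')))) = F z" for z
      unfolding F_def using prod.remove[OF finY y, of "\<lambda>y. (z - y) / of_real (cmod y)"] by simp
    ultimately have "F \<midarrow>y\<rightarrow> (\<Prod>y'\<in>Y - {y}. (y - y') / of_real (cmod y')) * (1 / of_real (cmod y)) * l" by simp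
    then show "F \<in> O[at y](\<lambda>_. 1)" by (intro bigoI_tendsto) auto
  qed
  then obtain H where H: "H holomorphic_on U" "\<And>z. z \<in> U - Y \<Longrightarrow> H z = F z" by blast
  have "{z. \<rho> \<le> cmod z \<and> cmod z \<le> t} \<subseteq> U"
  proof
    fix z assume z: "z \<in> {z. \<rho> \<le> cmod z \<and> cmod z \<le> t}"
    show "z \<in> U"
    proof (cases "cmod z = \<rho> \<or> cmod z = t")
      case True
      then show ?thesis using bdry[of z] z \<rho> by (auto simp: U_def V_def O0_def)
    next
      case False
      then show ?thesis using z by (auto simp: U_def A_def)
    qed
  qed
  then show ?thesis using that[OF \<open>open U\<close> _ H(1)] H(2) by (simp add: F_def)
qed

text \<open>Each point of Y lies within \<delta> of at most one point of T, so fewer points than T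
  has cannot spoil all of them.\<close>

lemma point_far_from_few:
  assumes "finite T" "finite Y" "card Y < card T"
    and sep: "\<And>x y. x \<in> T \<Longrightarrow> y \<in> T \<Longrightarrow> x \<noteq> y \<Longrightarrow> 2 * \<delta> \<le> dist x y"
  obtains x where "x \<in> T" "\<And>y. y \<in> Y \<Longrightarrow> \<delta> \<le> dist x y"
proof -
  have "\<exists>x\<in>T. \<forall>y\<in>Y. \<delta> \<le> dist x y"
  proof (rule ccontr)
    assume "\<not> ?thesis"
    then have "\<forall>x\<in>T. \<exists>y\<in>Y. dist x y < \<delta>" by (auto simp: not_le)
    then obtain f where f: "\<And>x. x \<in> T \<Longrightarrow> f x \<in> Y \<and> dist x (f x) < \<delta>" by metis
    have "inj_on f T"
    proof (rule inj_onI, rule ccontr)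
      fix x y assume "x \<in> T" "y \<in> T" "f x = f y" "x \<noteq> y"
      then show False using f[of x] f[of y] sep[of x y] dist_triangle2[of x y "f x"] by simp
    qed
    then have "card T \<le> card Y" using f assms by (intro card_inj_on_le[of f]) auto
    then show False using assms by simp
  qed
  then show ?thesis using that by blast
qed

lemma finite_separation:
  fixes T :: "'a::metric_space set"
  assumes "finite T"
  obtains \<delta> where "0 < \<delta>" "\<delta> \<le> 1" "\<And>x y. x \<in> T \<Longrightarrow> y \<in> T \<Longrightarrow> x \<noteq> y \<Longrightarrow> 2 * \<delta> \<le> dist x y"
proof -
  define D where "D = insert 2 ((\<lambda>(x, y). dist x y) ` {(x, y) \<in> T \<times> T. x \<noteq> y})"
  have "finite {(x, y) \<in> T \<times> T. x \<noteq> y}"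
    using assms by (intro finite_subset[OF _ finite_cartesian_product[OF assms assms]]) auto
  then have fin: "finite D" by (simp add: D_def)
  show ?thesis
  proof (rule that[of "Min D / 2"])
    have "Min D \<in> D" using fin by (intro Min_in) (auto simp: D_def)
    then show "0 < Min D / 2" by (auto simp: D_def)
    show "Min D / 2 \<le> 1" using Min_le[OF fin, of 2] by (simp add: D_def)
    show "2 * (Min D / 2) \<le> dist x y" if "x \<in> T" "y \<in> T" "x \<noteq> y" for x y
      using Min_le[OF fin, of "dist x y"] that by (force simp: D_def)
  qed
qed

text \<open>Supplies candidates for a test point: if n exceeds the number of cancelled poles, one
  candidate is far from all of these. The derivative has finitely many zeros on the circle unless it
  is constant, and then it is a nonzero constant because g is not constant.\<close>

lemma essential_deriv_points:
  assumes hol: "g holomorphic_on {z. R < cmod z}" and ess: "essential_at_infinity g" and a: "R < a" "0 < a"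
  obtains T where "finite T" "card T = n" "\<And>x. x \<in> T \<Longrightarrow> cmod x = a \<and> deriv g x \<noteq> 0"
proof -
  define O0 where "O0 = {z. R < cmod z}"
  have O0: "open O0" "connected O0" "g holomorphic_on O0"
    unfolding O0_def using open_outside_disc connected_outside_disc hol by auto
  have hd: "deriv g holomorphic_on O0" using O0 by (intro holomorphic_deriv)
  have fin: "finite {z. cmod z = a \<and> deriv g z = 0}"
  proof (cases "deriv g constant_on O0")
    case False
    have "finite {z \<in> sphere 0 a. deriv g z = 0}"
      by (rule holomorphic_compact_finite_zeros[OF hd O0(1,2) _ _ False]) (use a in \<open>auto simp: O0_def\<close>)
    then show ?thesis by (simp add: conj_commute)
  next
    case True
    then obtain c where c: "\<And>z. z \<in> O0 \<Longrightarrow> deriv g z = c" by (auto simp: constant_on_def)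
    have "c \<noteq> 0"
    proof
      assume "c = 0"
      have "\<exists>k. \<forall>z\<in>O0. g z = k"
      proof (rule DERIV_zero_connected_constant[OF O0(2,1) finite.emptyI])
        show "continuous_on O0 g" using O0 holomorphic_on_imp_continuous_on by blast
        show "\<forall>x\<in>O0 - {}. (g has_field_derivative 0) (at x)"
          using c \<open>c = 0\<close> O0 holomorphic_derivI by (metis Diff_empty)
      qed blast
      then have "g constant_on {z. R < cmod z}" unfolding constant_on_def O0_def by blast
      then show False using essential_not_constant[OF ess] by blast
    qed
    have "{z. cmod z = a \<and> deriv g z = 0} = {}" using c \<open>c \<noteq> 0\<close> a by (auto simp: O0_def)
    then show ?thesis by (metis finite.emptyI)
  qed
  have "infinite (sphere (0::complex) a)"
  proof -
    have "inj_on (\<lambda>t. of_real a * cis t) {0..1::real}"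
    proof (rule inj_onI)
      fix s t :: real assume st: "s \<in> {0..1}" "t \<in> {0..1}" "of_real a * cis s = of_real a * cis t"
      then have "cos s = cos t" using a by (simp add: complex_eq_iff)
      then show "s = t" using st cos_inj_pi[of s t] pi_gt3 by auto
    qed
    then have "infinite ((\<lambda>t. of_real a * cis t) ` {0..1::real})" by (simp add: finite_image_iff)
    moreover have "(\<lambda>t. of_real a * cis t) ` {0..1::real} \<subseteq> sphere 0 a" using a by (auto simp: norm_mult)
    ultimately show ?thesis using finite_subset by blast
  qed
  then have "infinite (sphere 0 a - {z. cmod z = a \<and> deriv g z = 0})" using fin by simp
  then obtain T where "T \<subseteq> sphere 0 a - {z. cmod z = a \<and> deriv g z = 0}" "finite T" "card T = n"
    using infinite_arbitrarily_large by blast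
  then show ?thesis by (intro that[of T]) auto
qed

text \<open>The function
  \<open>z ^ A * g' * \<Prod>(z - y) / ((g - w) * (g - w'))\<close>, whose simple poles \<open>y\<close> have been cancelled, is tiny
  on an outer circle by Schottky's theorem, so that for large \<open>A\<close> its size near the inner circle
  contradicts the maximum principle.\<close>

lemma rarely_taken_values_close:
  assumes hol: "g holomorphic_on {z. R < cmod z}" and ess: "essential_at_infinity g"
    and R: "R \<ge> 1" and K: "K \<ge> 1"
  obtains r0 where "r0 \<ge> 1" "\<And>r w w'. \<lbrakk>r0 \<le> r; cmod w \<le> K * r ^ l; cmod w' \<le> K * r ^ l; 1 / r \<le> cmod (w - w');
      finite {z. R + 1 \<le> cmod z \<and> cmod z \<le> r \<and> g z \<in> {w, w'}}\<rbrakk> \<Longrightarrow>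
      N < card {z. R + 1 \<le> cmod z \<and> cmod z \<le> r \<and> g z \<in> {w, w'}}"
proof -
  obtain c where c: "c > 0"
    "\<And>w w'. \<exists>\<rho>. R + 1 \<le> \<rho> \<and> \<rho> \<le> R + 2 \<and> (\<forall>z. cmod z = \<rho> \<longrightarrow>
       c * (1 + cmod w) \<le> cmod (g z - w) \<and> c * (1 + cmod w') \<le> cmod (g z - w'))"
    by (rule avoiding_circle[OF hol ess, of "R + 1" "R + 2"]) (use R in auto)
  have hd: "deriv g holomorphic_on {z. R < cmod z}" using hol open_outside_disc by (rule holomorphic_deriv)
  obtain C1 where C1: "C1 > 0" "\<And>z. R + 1 \<le> cmod z \<Longrightarrow> cmod z \<le> R + 2 \<Longrightarrow> cmod (deriv g z) \<le> C1"
    by (rule holomorphic_bounded_on_annulus[OF hd, of "R + 1" "R + 2"]) auto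
  obtain C2 where C2: "C2 > 0" "\<And>z. R + 1 \<le> cmod z \<Longrightarrow> cmod z \<le> R + 3 \<Longrightarrow> cmod (g z) \<le> C2"
    by (rule holomorphic_bounded_on_annulus[OF hol, of "R + 1" "R + 3"]) auto
  define C3 where "C3 = 1 + C2"
  have C3: "C3 > 0" using C2 by (simp add: C3_def)
  obtain T where T: "finite T" "card T = Suc N" "\<And>x. x \<in> T \<Longrightarrow> cmod x = R + 3 \<and> deriv g x \<noteq> 0"
    by (rule essential_deriv_points[OF hol ess, of "R + 3" "Suc N"]) (use R in auto)
  define c1 where "c1 = Min ((\<lambda>x. cmod (deriv g x)) ` T)"
  have "T \<noteq> {}" using T by auto
  then have c1: "c1 > 0" "\<And>x. x \<in> T \<Longrightarrow> c1 \<le> cmod (deriv g x)"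
    using T by (auto simp: c1_def)
  obtain \<delta> where \<delta>: "0 < \<delta>" "\<delta> \<le> 1" "\<And>x y. x \<in> T \<Longrightarrow> y \<in> T \<Longrightarrow> x \<noteq> y \<Longrightarrow> 2 * \<delta> \<le> dist x y"
    using finite_separation[OF T(1)] by blast
  \<comment> \<open>Lower bound for one factor |x - y| / |y|: if |y| <= 2 (R + 3) the separation
    \<delta> is used, and for larger y the quotient is at least 1/2.\<close>
  define \<delta>' where "\<delta>' = \<delta> / (2 * (R + 3))"
  have \<delta>': "0 < \<delta>'" "\<delta>' \<le> 1 / 2" using \<delta> R by (auto simp: \<delta>'_def field_simps)
  define LB where "LB = c1 * \<delta>' ^ N / C3\<^sup>2"
  have LB: "LB > 0" using c1 \<delta>' C3 by (simp add: LB_def)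
  define UB where "UB = C1 * 2 ^ N / c\<^sup>2"
  have UB: "UB > 0" using C1 c by (simp add: UB_def)
  \<comment> \<open>The test point has modulus R + 3 and the inner circle radius at most R + 2, so a
    high power of z lets the lower bound at the former beat the upper bound on the latter.\<close>
  have "(R + 3) / (R + 2) > 1" using R by simp
  then obtain A where A: "UB / LB < ((R + 3) / (R + 2)) ^ A" using real_arch_pow by blast
  have A': "UB * (R + 2) ^ A < LB * (R + 3) ^ A"
    using A LB UB R by (simp add: power_divide field_simps)
  \<comment> \<open>On the outer circle the other factors contribute r ^ A, r ^ N, r ^ (2 * l) and
    r; one further power leaves a bound of order 1 / r.\<close>
  define E where "E = A + N + 2 * l + 2"
  obtain r1 where r1: "r1 \<ge> 1" "\<And>r w w'. \<lbrakk>r1 \<le> r; cmod w \<le> K * r ^ l; cmod w' \<le> K * r ^ l; 1 / r \<le> cmod (w - w');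
      finite {z. R + 1 \<le> cmod z \<and> cmod z \<le> r \<and> g z \<in> {w, w'}};
      card {z. R + 1 \<le> cmod z \<and> cmod z \<le> r \<and> g z \<in> {w, w'}} \<le> N\<rbrakk> \<Longrightarrow>
      \<exists>t. R + 4 \<le> t \<and> t \<le> r \<and> (\<forall>z. cmod z = t \<longrightarrow> g z \<noteq> w \<and> g z \<noteq> w' \<and>
        cmod (deriv g z / ((g z - w) * (g z - w'))) \<le> 2 * r / r ^ E)"
    using two_value_outer[OF hol ess R K] by blast
  define r0 where "r0 = max r1 (2 ^ (N + 3) * K\<^sup>2 / (LB * (R + 3) ^ A) + 1)"
  show ?thesis
  proof (rule that[of r0])
    show "r0 \<ge> 1" using r1 by (simp add: r0_def)
    fix r w w'
    assume r: "r0 \<le> r" and w: "cmod w \<le> K * r ^ l" "cmod w' \<le> K * r ^ l" "1 / r \<le> cmod (w - w')"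
      and finX: "finite {z. R + 1 \<le> cmod z \<and> cmod z \<le> r \<and> g z \<in> {w, w'}}"
    show "N < card {z. R + 1 \<le> cmod z \<and> cmod z \<le> r \<and> g z \<in> {w, w'}}"
    proof (rule ccontr)
      assume "\<not> ?thesis"
      then have cardX: "card {z. R + 1 \<le> cmod z \<and> cmod z \<le> r \<and> g z \<in> {w, w'}} \<le> N" by simp
      have "r \<ge> r1" "r \<ge> 1" using r r1 by (auto simp: r0_def)
      have "w \<noteq> w'" using w \<open>r \<ge> 1\<close> by auto
      obtain t where t: "R + 4 \<le> t" "t \<le> r" "\<And>z. cmod z = t \<Longrightarrow> g z \<noteq> w \<and> g z \<noteq> w' \<and>
        cmod (deriv g z / ((g z - w) * (g z - w'))) \<le> 2 * r / r ^ E"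
        using r1(2)[OF \<open>r1 \<le> r\<close> w finX cardX] by blast
      obtain \<rho> where \<rho>: "R + 1 \<le> \<rho>" "\<rho> \<le> R + 2" "\<And>z. cmod z = \<rho> \<Longrightarrow>
         c * (1 + cmod w) \<le> cmod (g z - w) \<and> c * (1 + cmod w') \<le> cmod (g z - w')"
        using c(2)[of w w'] by blast
      have \<rho>ne: "g z \<notin> {w, w'}" if "cmod z = \<rho>" for z
      proof -
        have "c * (1 + cmod w) > 0" "c * (1 + cmod w') > 0" using c by (auto intro!: mult_pos_pos add_pos_nonneg)
        then have "cmod (g z - w) > 0" "cmod (g z - w') > 0" using \<rho>(3)[OF that] by linarith+
        then show ?thesis by auto
      qed
      define Y where "Y = {z. \<rho> < cmod z \<and> cmod z < t \<and> g z \<in> {w, w'}}"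
      have YX: "Y \<subseteq> {z. R + 1 \<le> cmod z \<and> cmod z \<le> r \<and> g z \<in> {w, w'}}"
        using \<rho> t by (auto simp: Y_def)
      have finY: "finite Y" using finite_subset[OF YX finX] .
      have cardY: "card Y \<le> N" using card_mono[OF finX YX] cardX by linarith
      have bd: "g z \<notin> {w, w'}" if "cmod z = \<rho> \<or> cmod z = t" for z using that \<rho>ne t(3) by blast
      have \<rho>t: "R < \<rho>" "0 < \<rho>" "\<rho> < t" using \<rho> t R by auto
      obtain U H where UH: "open U" "{z. \<rho> \<le> cmod z \<and> cmod z \<le> t} \<subseteq> U" "H holomorphic_on U"
        "\<And>z. z \<in> U - Y \<Longrightarrow> H z = (\<Prod>y\<in>Y. (z - y) / of_real (cmod y)) * (deriv g z / ((g z - w) * (g z - w')))"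
        by (rule two_value_extension[OF hol ess \<rho>t \<open>w \<noteq> w'\<close> bd, folded Y_def]) (assumption, rule that)
      \<comment> \<open>The distance \<open>cmod (g z - w)\<close> is at most a multiple of
        \<open>1 + cmod w\<close> at the test point and at least a multiple of it on the inner
        circle. Multiplying by s makes both estimates independent of w and w'.\<close>
      define s where "s = (1 + cmod w) * (1 + cmod w')"
      have s: "s \<ge> 1" unfolding s_def using mult_mono[of 1 "1 + cmod w" 1 "1 + cmod w'"] by simp
      define \<Phi> where "\<Phi> = (\<lambda>z. z ^ A * of_real s * H z)"
      have nY: "cmod y \<ge> 1" if "y \<in> Y" for y using that \<rho> R by (auto simp: Y_def)
      have \<Phi>norm: "cmod (\<Phi> z) = cmod z ^ A * s * ((\<Prod>y\<in>Y. cmod (z - y) / cmod y) * (cmod (deriv g z) / (cmod (g z - w) * cmod (g z - w'))))"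
        if "z \<in> U - Y" for z
        using UH(4)[OF that] s by (simp add: \<Phi>_def norm_mult norm_power norm_divide prod_norm[symmetric])
      obtain x where x: "x \<in> T" "\<And>y. y \<in> Y \<Longrightarrow> \<delta> \<le> dist x y"
        by (rule point_far_from_few[OF T(1) finY _ \<delta>(3)]) (use cardY T in auto)
      have cx: "cmod x = R + 3" using T x by auto
      have xU: "x \<in> U - Y"
      proof -
        have "x \<notin> Y" using x(2)[of x] \<delta> by auto
        moreover have "x \<in> U" using UH(2) cx \<rho> t by auto
        ultimately show ?thesis by blast
      qed
      have gx: "cmod (g x) \<le> C2" using C2(2)[of x] cx by simp
      have lower: "LB * (R + 3) ^ A \<le> cmod (\<Phi> x)"
      proof -
        have p: "\<delta>' ^ N \<le> (\<Prod>y\<in>Y. cmod (x - y) / cmod y)"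
        proof -
          have "\<delta>' ^ N \<le> \<delta>' ^ card Y" using \<delta>' cardY by (intro power_decreasing) auto
          also have "\<dots> = (\<Prod>y\<in>Y. \<delta>')" by simp
          also have "\<dots> \<le> (\<Prod>y\<in>Y. cmod (x - y) / cmod y)"
          proof (rule prod_mono)
            fix y assume y: "y \<in> Y"
            have "\<delta>' \<le> cmod (x - y) / cmod y"
            proof (cases "cmod y \<le> 2 * (R + 3)")
              case True
              have "\<delta> / (2 * (R + 3)) \<le> cmod (x - y) / cmod y"
                using x(2)[OF y] \<delta> True nY[OF y] by (intro frac_le) (auto simp: dist_norm)
              then show ?thesis by (simp add: \<delta>'_def)
            next
              case False
              have "cmod y - cmod x \<le> cmod (x - y)" by (metis norm_minus_commute norm_triangle_ineq2)
              then have "1 / 2 * cmod y \<le> cmod (x - y)" using False cx by simp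
              then have "1 / 2 \<le> cmod (x - y) / cmod y" using nY[OF y] by (subst pos_le_divide_eq) auto
              then show ?thesis using \<delta>' by linarith
            qed
            then show "0 \<le> \<delta>' \<and> \<delta>' \<le> cmod (x - y) / cmod y" using \<delta>' by simp
          qed
          finally show ?thesis .
        qed
        have u: "cmod (g x - v) \<le> C3 * (1 + cmod v)" for v
        proof -
          have "cmod (g x - v) \<le> C2 + cmod v" using norm_triangle_ineq4[of "g x" v] gx by linarith
          also have "\<dots> \<le> C3 * (1 + cmod v)" using C2 by (simp add: C3_def algebra_simps)
          finally show ?thesis .
        qed
        have gxw: "g x \<noteq> w" "g x \<noteq> w'" using xU cx \<rho> t by (auto simp: Y_def)
        have "c1 / (C3\<^sup>2 * s) \<le> cmod (deriv g x) / (cmod (g x - w) * cmod (g x - w'))"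
        proof (rule frac_le)
          show "cmod (g x - w) * cmod (g x - w') \<le> C3\<^sup>2 * s"
            using mult_mono[OF u[of w] u[of w']] C3 by (simp add: s_def power2_eq_square mult_ac)
          show "0 < cmod (g x - w) * cmod (g x - w')" using gxw by simp
        qed (use c1 x in auto)
        then have "\<delta>' ^ N * (c1 / (C3\<^sup>2 * s)) \<le> (\<Prod>y\<in>Y. cmod (x - y) / cmod y) * (cmod (deriv g x) / (cmod (g x - w) * cmod (g x - w')))"
          using p c1 C3 s \<delta>' by (intro mult_mono) (auto intro!: prod_nonneg)
        then have "(R + 3) ^ A * s * (\<delta>' ^ N * (c1 / (C3\<^sup>2 * s))) \<le> cmod (\<Phi> x)"
          unfolding \<Phi>norm[OF xU] cx using s R by (intro mult_left_mono) auto
        moreover have "(R + 3) ^ A * s * (\<delta>' ^ N * (c1 / (C3\<^sup>2 * s))) = LB * (R + 3) ^ A"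
          using s by (simp add: LB_def)
        ultimately show ?thesis by simp
      qed
      define M where "M = max (UB * (R + 2) ^ A) (2 ^ (N + 3) * K\<^sup>2 / r)"
      have "cmod (\<Phi> x) \<le> M"
      proof (rule maximum_modulus_annulus[where f = \<Phi> and U = U and \<rho> = \<rho> and t = t])
        show "\<Phi> holomorphic_on U" unfolding \<Phi>_def by (intro holomorphic_intros UH)
        show "cmod (\<Phi> z) \<le> M" if z: "cmod z = \<rho>" for z
        proof -
          have zU: "z \<in> U - Y" using UH(2) z \<rho> t by (auto simp: Y_def)
          have p: "(\<Prod>y\<in>Y. cmod (z - y) / cmod y) \<le> 2 ^ N"
          proof -
            have "(\<Prod>y\<in>Y. cmod (z - y) / cmod y) \<le> (\<Prod>y\<in>Y. 2)"
            proof (rule prod_mono)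
              fix y assume y: "y \<in> Y"
              have "cmod (z - y) \<le> cmod z + cmod y" by (rule norm_triangle_ineq4)
              also have "\<dots> \<le> 2 * cmod y" using y z by (auto simp: Y_def)
              finally show "0 \<le> cmod (z - y) / cmod y \<and> cmod (z - y) / cmod y \<le> 2"
                using nY[OF y] by (auto simp: divide_le_eq)
            qed
            also have "\<dots> = 2 ^ card Y" by simp
            also have "\<dots> \<le> 2 ^ N" using cardY by (intro power_increasing) auto
            finally show ?thesis .
          qed
          have "cmod (deriv g z) / (cmod (g z - w) * cmod (g z - w')) \<le> C1 / (c\<^sup>2 * s)"
          proof (rule frac_le)
            show "c\<^sup>2 * s \<le> cmod (g z - w) * cmod (g z - w')"
              using mult_mono[OF conjunct1[OF \<rho>(3)[OF z]] conjunct2[OF \<rho>(3)[OF z]]] c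
              by (simp add: s_def power2_eq_square mult_ac)
            show "0 < c\<^sup>2 * s" using c s by simp
          qed (use C1 \<rho> z in auto)
          then have PP: "(\<Prod>y\<in>Y. cmod (z - y) / cmod y) * (cmod (deriv g z) / (cmod (g z - w) * cmod (g z - w'))) \<le> 2 ^ N * (C1 / (c\<^sup>2 * s))"
            using p by (intro mult_mono) (auto intro!: prod_nonneg)
          have QQ: "cmod z ^ A * s \<le> (R + 2) ^ A * s" using z \<rho> R s by (intro mult_right_mono power_mono) auto
          have "cmod (\<Phi> z) \<le> ((R + 2) ^ A * s) * (2 ^ N * (C1 / (c\<^sup>2 * s)))"
            unfolding \<Phi>norm[OF zU]
            by (rule mult_mono[OF QQ PP]) (use s R in \<open>auto intro!: prod_nonneg mult_nonneg_nonneg divide_nonneg_nonneg\<close>)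
          also have "\<dots> = UB * (R + 2) ^ A" using s by (simp add: UB_def)
          finally show ?thesis by (simp add: M_def)
        qed
        show "cmod (\<Phi> z) \<le> M" if z: "cmod z = t" for z
        proof -
          have zU: "z \<in> U - Y" using UH(2) z \<rho> t by (auto simp: Y_def)
          have p: "(\<Prod>y\<in>Y. cmod (z - y) / cmod y) \<le> (2 * r) ^ N"
          proof -
            have "(\<Prod>y\<in>Y. cmod (z - y) / cmod y) \<le> (\<Prod>y\<in>Y. 2 * r)"
            proof (rule prod_mono)
              fix y assume y: "y \<in> Y"
              have "cmod (z - y) \<le> cmod z + cmod y" by (rule norm_triangle_ineq4)
              also have "\<dots> \<le> 2 * r" using y z t by (auto simp: Y_def)
              also have "\<dots> \<le> 2 * r * cmod y" using nY[OF y] \<open>r \<ge> 1\<close> by simp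
              finally show "0 \<le> cmod (z - y) / cmod y \<and> cmod (z - y) / cmod y \<le> 2 * r"
                using nY[OF y] by (auto simp: divide_le_eq)
            qed
            also have "\<dots> = (2 * r) ^ card Y" by simp
            also have "\<dots> \<le> (2 * r) ^ N" using cardY \<open>r \<ge> 1\<close> by (intro power_increasing) auto
            finally show ?thesis .
          qed
          have sb: "s \<le> 4 * K\<^sup>2 * r ^ (2 * l)"
          proof -
            have "1 * 1 \<le> K * r ^ l" using K \<open>r \<ge> 1\<close> by (intro mult_mono one_le_power) auto
            then have "1 + cmod w \<le> 2 * (K * r ^ l)" "1 + cmod w' \<le> 2 * (K * r ^ l)" using w by auto
            then have "s \<le> (2 * (K * r ^ l)) * (2 * (K * r ^ l))" unfolding s_def using K \<open>r \<ge> 1\<close> by (intro mult_mono) auto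
            moreover have "r ^ (2 * l) = r ^ l * r ^ l" by (simp add: mult_2 power_add)
            ultimately show ?thesis by (simp add: power2_eq_square mult_ac)
          qed
          have PP: "(\<Prod>y\<in>Y. cmod (z - y) / cmod y) * (cmod (deriv g z) / (cmod (g z - w) * cmod (g z - w'))) \<le> (2 * r) ^ N * (2 * r / r ^ E)"
            using p t(3)[OF z] \<open>r \<ge> 1\<close> by (intro mult_mono) (auto intro!: prod_nonneg simp: norm_divide norm_mult)
          have QQ: "cmod z ^ A * s \<le> r ^ A * (4 * K\<^sup>2 * r ^ (2 * l))"
            using z t R s sb \<open>r \<ge> 1\<close> by (intro mult_mono power_mono) auto
          have "cmod (\<Phi> z) \<le> (r ^ A * (4 * K\<^sup>2 * r ^ (2 * l))) * ((2 * r) ^ N * (2 * r / r ^ E))"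
            unfolding \<Phi>norm[OF zU]
            by (rule mult_mono[OF QQ PP]) (use s R \<open>r \<ge> 1\<close> in \<open>auto intro!: prod_nonneg mult_nonneg_nonneg divide_nonneg_nonneg\<close>)
          also have "\<dots> = 2 ^ (N + 3) * K\<^sup>2 / r"
          proof -
            define a b c where "a = r ^ A" and "b = r ^ N" and "c = r ^ (2 * l)"
            have "r ^ E = a * b * c * r * r" by (simp add: E_def power_add a_def b_def c_def power2_eq_square)
            moreover have "a \<noteq> 0" "b \<noteq> 0" "c \<noteq> 0" using \<open>r \<ge> 1\<close> by (auto simp: a_def b_def c_def)
            ultimately show ?thesis using \<open>r \<ge> 1\<close>
              unfolding a_def[symmetric] c_def[symmetric] power_mult_distrib b_def[symmetric]
              by (simp add: power_add divide_simps)
          qed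
          finally show ?thesis by (simp add: M_def)
        qed
      qed (use UH cx \<rho> t in auto)
      then have "LB * (R + 3) ^ A \<le> M" using lower by linarith
      moreover have "UB * (R + 2) ^ A < LB * (R + 3) ^ A" by (rule A')
      moreover have "2 ^ (N + 3) * K\<^sup>2 / r < LB * (R + 3) ^ A"
      proof -
        have "2 ^ (N + 3) * K\<^sup>2 / (LB * (R + 3) ^ A) < r" using r by (simp add: r0_def)
        moreover have "LB * (R + 3) ^ A > 0" using LB R by simp
        ultimately have "2 ^ (N + 3) * K\<^sup>2 < r * (LB * (R + 3) ^ A)" by (simp add: pos_divide_less_eq)
        then show ?thesis using \<open>r \<ge> 1\<close> by (simp add: pos_divide_less_eq mult.commute)
      qed
      ultimately show False by (simp add: M_def)
    qed
  qed
qed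

text \<open>Double counting: h maps the union of the sets \<open>X w\<close> into \<open>Zr\<close>
  with fibres of at most l points, so the average of \<open>card (X w)\<close> is at most l. Hence
  at least half of the w stay below twice this average.\<close>

lemma many_rarely_taken_values:
  fixes g h :: "complex \<Rightarrow> complex"
  assumes fin: "finite Zr" "\<And>w. w \<in> Zr \<Longrightarrow> finite (X w)"
    and disj: "\<And>w w'. w \<noteq> w' \<Longrightarrow> X w \<inter> X w' = {}"
    and h: "\<And>w z. w \<in> Zr \<Longrightarrow> z \<in> X w \<Longrightarrow> h z \<in> Zr \<and> z \<in> D"
    and fib: "\<And>v. finite {z \<in> D. h z = v} \<and> card {z \<in> D. h z = v} \<le> l"
  shows "card Zr \<le> 2 * card {w \<in> Zr. card (X w) \<le> 2 * l}"
proof -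
  define E where "E = {w \<in> Zr. card (X w) \<le> 2 * l}"
  have E: "E \<subseteq> Zr" "finite E" using fin by (auto simp: E_def)
  have "card (\<Union>w\<in>Zr. X w) = (\<Sum>w\<in>Zr. card (X w))"
    using fin disj by (intro card_UN_disjoint) auto
  moreover have "card (\<Union>w\<in>Zr. X w) \<le> card (\<Union>v\<in>Zr. {z \<in> D. h z = v})"
    using fin fib h by (intro card_mono) auto
  moreover have "card (\<Union>v\<in>Zr. {z \<in> D. h z = v}) \<le> (\<Sum>v\<in>Zr. card {z \<in> D. h z = v})"
    using fin by (intro card_UN_le)
  moreover have "(\<Sum>v\<in>Zr. card {z \<in> D. h z = v}) \<le> (\<Sum>v\<in>Zr. l)"
    using fib by (intro sum_mono) auto
  moreover have "(\<Sum>w\<in>Zr - E. 2 * l + 1) \<le> (\<Sum>w\<in>Zr - E. card (X w))"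
    by (intro sum_mono) (auto simp: E_def)
  moreover have "(\<Sum>w\<in>Zr - E. card (X w)) \<le> (\<Sum>w\<in>Zr. card (X w))"
    using fin by (intro sum_mono2) auto
  ultimately have "card (Zr - E) * (2 * l + 1) \<le> card Zr * l" by simp
  moreover have "card (Zr - E) = card Zr - card E" "card E \<le> card Zr"
    using E fin by (auto simp: card_Diff_subset card_mono)
  ultimately have "(card Zr - card E) * (2 * l + 1) \<le> (card Zr - card E) * l + card E * l"
    by (simp flip: add_mult_distrib)
  then have 1: "(card Zr - card E) * (l + 1) \<le> card E * l" by (simp add: algebra_simps)
  have "card Zr - card E \<le> card E"
  proof (rule ccontr)
    assume "\<not> ?thesis"
    then have lt: "card E < card Zr - card E" by simp
    then have "card E * (l + 1) < (card Zr - card E) * (l + 1)" by (intro mult_strict_right_mono) auto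
    then show False using 1 by simp
  qed
  then show ?thesis by (simp add: E_def)
qed

text \<open>By \<open>pre\<close> and \<open>fib\<close>, most points of \<open>Z\<close> up to modulus \<open>K * r ^ l\<close> are taken by \<open>g\<close> only boundedly
  often up to modulus \<open>r\<close>, hence lie in a disc of radius \<open>1 / r\<close>, and these discs stay bounded along
  \<open>r = 2 ^ k\<close>.\<close>

lemma essential_preimage_growth:
  assumes hol: "g holomorphic_on {z. R < cmod z}" and ess: "essential_at_infinity g"
    and R: "R \<ge> 1" and K: "K \<ge> 1" and l: "l \<ge> 1"
    and h: "\<And>z. R < cmod z \<Longrightarrow> cmod (h z) \<le> K * cmod z ^ l"
    and fib: "\<And>v. finite {z. R < cmod z \<and> h z = v} \<and> card {z. R < cmod z \<and> h z = v} \<le> l"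
    and Z: "infinite Z" "\<And>\<rho>. finite (Z \<inter> cball 0 \<rho>)"
    and pre: "\<And>z. R < cmod z \<Longrightarrow> g z \<in> Z \<Longrightarrow> h z \<in> Z"
  shows False
proof -
  \<comment> \<open>Room for one doubling of r, since
    \<open>K * (2 * r) ^ l = K2 * r ^ l\<close>.\<close>
  define K2 where "K2 = K * 2 ^ l"
  have "K2 \<ge> 1" unfolding K2_def using mult_mono[of 1 K 1 "2 ^ l"] K by simp
  \<comment> \<open>The number 4 * l arises from two values with at most 2 * l preimages each; such
    values must be closer than 1 / r.\<close>
  then obtain r0 where r0: "r0 \<ge> 1" "\<And>r w w'. \<lbrakk>r0 \<le> r; cmod w \<le> K2 * r ^ l; cmod w' \<le> K2 * r ^ l; 1 / r \<le> cmod (w - w');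
      finite {z. R + 1 \<le> cmod z \<and> cmod z \<le> r \<and> g z \<in> {w, w'}}\<rbrakk> \<Longrightarrow>
      4 * l < card {z. R + 1 \<le> cmod z \<and> cmod z \<le> r \<and> g z \<in> {w, w'}}"
    using rarely_taken_values_close[OF hol ess R, of K2 l "4 * l"] by blast
  define X where "X = (\<lambda>r w. {z. R + 1 \<le> cmod z \<and> cmod z \<le> r \<and> g z = w})"
  have finX: "finite (X r w)" for r w
    unfolding X_def by (rule finite_fibre_annulus[OF hol ess]) simp
  define Zr where "Zr = (\<lambda>r. Z \<inter> cball 0 (K * r ^ l))"
  have finZ: "finite (Zr r)" for r using Z by (simp add: Zr_def)
  define E where "E = (\<lambda>r. {w \<in> Zr r. card (X r w) \<le> 2 * l})"
  have cardE: "card (Zr r) \<le> 2 * card (E r)" if "r \<ge> 1" for r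
    unfolding E_def
  proof (rule many_rarely_taken_values[OF finZ finX, where D = "{z. R < cmod z}" and h = h])
    show "X r w \<inter> X r w' = {}" if "w \<noteq> w'" for w w' using that by (auto simp: X_def)
    show "finite {z \<in> {z. R < cmod z}. h z = v} \<and> card {z \<in> {z. R < cmod z}. h z = v} \<le> l" for v
      using fib[of v] by simp
    fix w z assume w: "w \<in> Zr r" and z: "z \<in> X r w"
    have Rz: "R < cmod z" using z by (simp add: X_def)
    have "cmod (h z) \<le> K * cmod z ^ l" by (rule h[OF Rz])
    also have "\<dots> \<le> K * r ^ l" using z K by (intro mult_left_mono power_mono) (auto simp: X_def)
    finally show "h z \<in> Zr r \<and> z \<in> {z. R < cmod z}"
      using pre[OF Rz] z w Rz by (auto simp: X_def Zr_def)
  qed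
  \<comment> \<open>Contains the exceptional points of scale r and also those of scale 2 r, which
    links the clusters of consecutive scales.\<close>
  define S where "S = (\<lambda>r. {w. cmod w \<le> K2 * r ^ l \<and> card (X r w) \<le> 2 * l})"
  have close: "dist w w' < 1 / r" if r: "r0 \<le> r" and w: "w \<in> S r" "w' \<in> S r" for r w w'
  proof (rule ccontr)
    assume "\<not> dist w w' < 1 / r"
    then have d: "1 / r \<le> cmod (w - w')" by (simp add: dist_norm)
    have un: "{z. R + 1 \<le> cmod z \<and> cmod z \<le> r \<and> g z \<in> {w, w'}} = X r w \<union> X r w'" by (auto simp: X_def)
    have "4 * l < card (X r w \<union> X r w')"
      using r0(2)[OF r _ _ d] w finX unfolding un S_def by blast
    also have "\<dots> \<le> card (X r w) + card (X r w')" by (rule card_Un_le)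
    finally show False using w by (simp add: S_def)
  qed
  define r where "r = (\<lambda>k::nat. 2 ^ k * r0)"
  have r: "r0 \<le> r k" "1 \<le> r k" "2 ^ k \<le> r k" "r (Suc k) = 2 * r k" for k
  proof -
    have "1 * r0 \<le> 2 ^ k * r0" "2 ^ k * 1 \<le> 2 ^ k * r0" using r0(1) by (intro mult_right_mono mult_left_mono; simp)+
    then show "r0 \<le> r k" "2 ^ k \<le> r k" "r (Suc k) = 2 * r k" using r0(1) by (simp_all add: r_def)
    then show "1 \<le> r k" using r0(1) by linarith
  qed
  have ES: "E (r k) \<subseteq> S (r k)" for k
  proof -
    have "1 * (K * r k ^ l) \<le> 2 ^ l * (K * r k ^ l)" using K r[of k] by (intro mult_right_mono) auto
    then have "K * r k ^ l \<le> K2 * r k ^ l" by (simp add: K2_def mult_ac)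
    then show ?thesis by (auto simp: E_def S_def Zr_def)
  qed
  have ES': "E (r (Suc k)) \<subseteq> S (r k)" for k
  proof
    fix w assume w: "w \<in> E (r (Suc k))"
    have "K * r (Suc k) ^ l = K2 * r k ^ l" by (simp add: K2_def r(4) power_mult_distrib)
    then have "cmod w \<le> K2 * r k ^ l" using w by (simp add: E_def Zr_def)
    moreover have "card (X (r k) w) \<le> card (X (r (Suc k)) w)"
      using r(2)[of k] by (intro card_mono finX) (auto simp: X_def r(4))
    ultimately show "w \<in> S (r k)" using w by (auto simp: E_def S_def)
  qed
  have big: "\<exists>k0. \<forall>k\<ge>k0. \<rho> \<le> K * r k ^ l" for \<rho>
  proof -
    obtain k0 where k0: "\<rho> < 2 ^ k0" using real_arch_pow[of 2 \<rho>] by auto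
    have "\<rho> \<le> K * r k ^ l" if "k0 \<le> k" for k
    proof -
      have "\<rho> \<le> 2 ^ k0" using k0 by simp
      also have "\<dots> \<le> 2 ^ k" using that by (intro power_increasing) auto
      also have "\<dots> \<le> r k" by (rule r)
      also have "\<dots> \<le> r k ^ l" using r(2) l self_le_power[of "r k" l] by auto
      also have "\<dots> \<le> K * r k ^ l" using K r(2)[of k] mult_right_mono[of 1 K "r k ^ l"] by auto
      finally show ?thesis .
    qed
    then show ?thesis by blast
  qed
  have "Z \<noteq> {}" using Z(1) by auto
  then obtain z0 where "z0 \<in> Z" by blast
  obtain k0 where k0: "\<And>k. k0 \<le> k \<Longrightarrow> cmod z0 \<le> K * r k ^ l" using big by blast
  have "\<exists>e. e \<in> E (r k)" if "k0 \<le> k" for k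
  proof -
    have "z0 \<in> Zr (r k)" using k0[OF that] \<open>z0 \<in> Z\<close> by (simp add: Zr_def)
    then have "card (Zr (r k)) > 0" using finZ by (auto simp: card_gt_0_iff)
    then have "card (E (r k)) > 0" using cardE[OF r(2)[of k]] by simp
    then show ?thesis by (auto simp: card_gt_0_iff)
  qed
  then obtain e where e: "\<And>k. k0 \<le> k \<Longrightarrow> e k \<in> E (r k)" by metis
  \<comment> \<open>The n-th jump is at most 1 / 2 ^ n, and 2 - 2 / 2 ^ n is the partial sum of
    these bounds.\<close>
  have step: "dist (e (k0 + n)) (e k0) \<le> 2 - 2 / 2 ^ n" for n
  proof (induction n)
    case (Suc n)
    have "dist (e (k0 + n)) (e (k0 + Suc n)) < 1 / r (k0 + n)"
      using subsetD[OF ES e, of "k0 + n"] subsetD[OF ES', of "e (k0 + Suc n)" "k0 + n"] e[of "k0 + Suc n"]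
      by (intro close[OF r(1)]) auto
    also have "\<dots> \<le> 1 / 2 ^ n"
    proof (rule divide_left_mono)
      have "(2::real) ^ n \<le> 2 ^ (k0 + n)" by (intro power_increasing) auto
      then show "2 ^ n \<le> r (k0 + n)" using r(3)[of "k0 + n"] by linarith
    qed (use r(2)[of "k0 + n"] in auto)
    finally have "dist (e (k0 + Suc n)) (e k0) \<le> 1 / 2 ^ n + (2 - 2 / 2 ^ n)"
      using Suc dist_triangle[of "e (k0 + Suc n)" "e k0" "e (k0 + n)"] by (simp add: dist_commute)
    then show ?case by (simp add: field_simps)
  qed auto
  \<comment> \<open>The radius 3 covers a total drift of at most 2 and a distance of at most 1
    within one cluster.\<close>
  define F where "F = Z \<inter> cball 0 (cmod (e k0) + 3)"
  have finF: "finite F" using Z by (simp add: F_def)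
  have EF: "E (r k) \<subseteq> F" if "k0 \<le> k" for k
  proof
    fix w assume w: "w \<in> E (r k)"
    have "dist w (e k) < 1 / r k" using close[OF r(1)] ES[of k] w e[OF that] by auto
    also have "\<dots> \<le> 1" using r(2)[of k] by simp
    finally have "dist w (e k) < 1" .
    moreover have "dist (e k) (e k0) \<le> 2"
    proof -
      have "dist (e k) (e k0) \<le> 2 - 2 / 2 ^ (k - k0)" using step[of "k - k0"] that by simp
      moreover have "2 / 2 ^ (k - k0) \<ge> (0::real)" by simp
      ultimately show ?thesis by linarith
    qed
    ultimately have "dist w (e k0) < 3" using dist_triangle[of w "e k0" "e k"] by linarith
    then have "cmod w \<le> cmod (e k0) + 3" using norm_triangle_ineq2[of w "e k0"] by (simp add: dist_norm)
    then show "w \<in> F" using w by (auto simp: F_def E_def Zr_def)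
  qed
  \<comment> \<open>More than twice as many points of Z as F contains, although at every large scale
    at least half of the points of Z are exceptional and hence in F.\<close>
  obtain G where G: "G \<subseteq> Z" "finite G" "card G = 2 * card F + 1"
    using infinite_arbitrarily_large[OF Z(1)] by blast
  obtain \<rho> where \<rho>: "G \<subseteq> cball 0 \<rho>"
    using finite_imp_bounded[OF G(2)] by (auto simp: bounded_iff subset_iff)
  obtain k1 where k1: "\<And>k. k1 \<le> k \<Longrightarrow> \<rho> \<le> K * r k ^ l" using big by blast
  define k where "k = max k0 k1"
  have "G \<subseteq> Zr (r k)" using G \<rho> k1[of k] by (fastforce simp: Zr_def k_def)
  then have "2 * card F + 1 \<le> card (Zr (r k))" using G finZ by (metis card_mono)
  also have "\<dots> \<le> 2 * card (E (r k))" using cardE r by blast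
  also have "card (E (r k)) \<le> card F" using EF[of k] finF by (intro card_mono) (auto simp: k_def)
  finally show False by simp
qed

section \<open>Holomorphic germs with values in the sphere\<close>

text \<open>The inversion z to 1 / z of the whole sphere. It exchanges the two charts, so arguments
  at the value infinity reduce to the value 0.\<close>

definition sphere_inv :: "riemann_sphere \<Rightarrow> riemann_sphere" where
  "sphere_inv x = (case x of None \<Rightarrow> Some 0 | Some z \<Rightarrow> chart_infty z)"

lemma sphere_inv_simps [simp]:
  "sphere_inv None = Some 0" "sphere_inv (Some z) = chart_infty z"
  "sphere_inv (chart_infty z) = Some z" "sphere_inv (sphere_inv x) = x"
  by (auto simp: sphere_inv_def chart_infty_def split: option.splits)

lemma chart_infty_0 [simp]: "chart_infty 0 = None"
  by (simp add: chart_infty_def)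

lemma chart_infty_eq_None [simp]: "chart_infty z = None \<longleftrightarrow> z = 0"
  by (simp add: chart_infty_def)

lemma chart_infty_eq_Some: "chart_infty z = Some w \<longleftrightarrow> z \<noteq> 0 \<and> w = inverse z"
  by (auto simp: chart_infty_def)

lemma chart_infty_inj [simp]: "chart_infty z = chart_infty w \<longleftrightarrow> z = w"
  by (auto simp: chart_infty_def)

text \<open>Either target chart may be used, but the same one on a whole disc. Besides meromorphic
  germs this admits the constant infinity, with \<open>h\<close> zero.\<close>

definition hol_germ :: "(complex \<Rightarrow> riemann_sphere) \<Rightarrow> complex \<Rightarrow> bool" where
  "hol_germ F z \<longleftrightarrow> (\<exists>e>0. \<exists>h. h holomorphic_on ball z e \<and>
     ((\<forall>w\<in>ball z e. F w = Some (h w)) \<or> (\<forall>w\<in>ball z e. F w = chart_infty (h w))))"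

definition hol_at :: "(riemann_sphere \<Rightarrow> riemann_sphere) \<Rightarrow> riemann_sphere \<Rightarrow> bool" where
  "hol_at f x = (case x of Some z \<Rightarrow> hol_germ (\<lambda>w. f (Some w)) z | None \<Rightarrow> hol_germ (\<lambda>w. f (chart_infty w)) 0)"

lemma hol_at_simps [simp]:
  "hol_at f (Some z) = hol_germ (\<lambda>w. f (Some w)) z"
  "hol_at f None = hol_germ (\<lambda>w. f (chart_infty w)) 0"
  by (simp_all add: hol_at_def)

lemma holomorphic_nonzero_ball:
  assumes "h holomorphic_on ball z e" "e > 0" "h z \<noteq> 0"
  obtains d where "0 < d" "d \<le> e" "\<And>w. w \<in> ball z d \<Longrightarrow> h w \<noteq> 0"
proof -
  have "continuous_on (ball z e) h" using assms holomorphic_on_imp_continuous_on by blast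
  then have "isCont h z" using assms by (simp add: continuous_on_eq_continuous_at)
  then obtain d where "d > 0" "\<And>w. dist z w < d \<Longrightarrow> h w \<noteq> 0"
    using continuous_at_avoid[of z h 0] assms by auto
  then show ?thesis by (intro that[of "min d e"]) (use assms in auto)
qed

text \<open>If the germ is given in the chart at infinity, h does not vanish at z, and on a smaller
  disc its reciprocal serves in the finite chart.\<close>

lemma hol_germ_finiteE:
  assumes "hol_germ F z" "F z = Some v"
  obtains e h where "e > 0" "h holomorphic_on ball z e" "\<And>w. w \<in> ball z e \<Longrightarrow> F w = Some (h w)" "h z = v"
proof -
  obtain e h where eh: "e > 0" "h holomorphic_on ball z e"
    and "(\<forall>w\<in>ball z e. F w = Some (h w)) \<or> (\<forall>w\<in>ball z e. F w = chart_infty (h w))"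
    using assms unfolding hol_germ_def by blast
  then consider "\<forall>w\<in>ball z e. F w = Some (h w)" | "\<forall>w\<in>ball z e. F w = chart_infty (h w)" by blast
  then show ?thesis
  proof cases
    case 1
    then have "h z = v" using assms eh by auto
    then show ?thesis using that eh 1 by blast
  next
    case 2
    then have "h z \<noteq> 0" using assms(2) eh by auto
    then obtain d where d: "0 < d" "d \<le> e" "\<And>w. w \<in> ball z d \<Longrightarrow> h w \<noteq> 0"
      using holomorphic_nonzero_ball[OF eh(2,1)] by metis
    have sub: "ball z d \<subseteq> ball z e" using d by auto
    have F: "F w = Some (inverse (h w))" if "w \<in> ball z d" for w
      using 2 that sub d(3)[OF that] by (auto simp: chart_infty_def)
    show ?thesis
    proof (rule that[of d "\<lambda>w. inverse (h w)"])
      show "(\<lambda>w. inverse (h w)) holomorphic_on ball z d"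
        by (intro holomorphic_intros holomorphic_on_subset[OF eh(2) sub] d(3))
      show "inverse (h z) = v" using F[of z] assms d by simp
    qed (use F d in auto)
  qed
qed

lemma hol_germ_sphere_inv: "hol_germ (\<lambda>w. sphere_inv (F w)) z \<longleftrightarrow> hol_germ F z"
proof -
  have *: "hol_germ (\<lambda>w. sphere_inv (F w)) z" if H: "hol_germ F z" for F
  proof -
    obtain e h where eh: "e > 0" "h holomorphic_on ball z e"
      and "(\<forall>w\<in>ball z e. F w = Some (h w)) \<or> (\<forall>w\<in>ball z e. F w = chart_infty (h w))"
      using H unfolding hol_germ_def by blast
    then have "(\<forall>w\<in>ball z e. sphere_inv (F w) = chart_infty (h w)) \<or> (\<forall>w\<in>ball z e. sphere_inv (F w) = Some (h w))"
      by auto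
    then show ?thesis using eh unfolding hol_germ_def by blast
  qed
  show ?thesis using *[of F] *[of "\<lambda>w. sphere_inv (F w)"] by auto
qed

lemma hol_germ_infE:
  assumes "hol_germ F z" "F z = None"
  obtains e h where "e > 0" "h holomorphic_on ball z e" "\<And>w. w \<in> ball z e \<Longrightarrow> F w = chart_infty (h w)" "h z = 0"
proof -
  obtain e h where "e > 0" "h holomorphic_on ball z e" "\<And>w. w \<in> ball z e \<Longrightarrow> sphere_inv (F w) = Some (h w)" "h z = 0"
    by (rule hol_germ_finiteE[of "\<lambda>w. sphere_inv (F w)" z 0]) (use assms in \<open>auto simp: hol_germ_sphere_inv\<close>)
  then show ?thesis using that by (metis sphere_inv_simps(2,4))
qed

lemma hol_germ_SomeI:
  "open S \<Longrightarrow> h holomorphic_on S \<Longrightarrow> z \<in> S \<Longrightarrow> (\<And>w. w \<in> S \<Longrightarrow> F w = Some (h w)) \<Longrightarrow> hol_germ F z"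
  unfolding hol_germ_def by (erule (1) openE) (intro exI conjI, assumption, erule (1) holomorphic_on_subset, blast)

lemma hol_germ_chartI:
  "open S \<Longrightarrow> h holomorphic_on S \<Longrightarrow> z \<in> S \<Longrightarrow> (\<And>w. w \<in> S \<Longrightarrow> F w = chart_infty (h w)) \<Longrightarrow> hol_germ F z"
  unfolding hol_germ_def by (erule (1) openE) (intro exI conjI, assumption, erule (1) holomorphic_on_subset, blast)

lemma hol_germ_compose:
  assumes G: "hol_germ G (h z)" and h: "h holomorphic_on S" "open S" "z \<in> S"
    and eq: "\<And>w. w \<in> S \<Longrightarrow> F w = G (h w)"
  shows "hol_germ F z"
proof -
  obtain e k where k: "e > 0" "k holomorphic_on ball (h z) e"
    and k': "(\<forall>w\<in>ball (h z) e. G w = Some (k w)) \<or> (\<forall>w\<in>ball (h z) e. G w = chart_infty (k w))"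
    using G unfolding hol_germ_def by blast
  define T where "T = S \<inter> h -` ball (h z) e"
  have "open T" unfolding T_def using h holomorphic_on_imp_continuous_on
    by (intro continuous_open_preimage) auto
  have "z \<in> T" using h k by (simp add: T_def)
  have "(k \<circ> h) holomorphic_on T"
    by (rule holomorphic_on_compose_gen[OF _ k(2)]) (use h in \<open>auto simp: T_def intro: holomorphic_on_subset\<close>)
  moreover have "(\<forall>w\<in>T. F w = Some ((k \<circ> h) w)) \<or> (\<forall>w\<in>T. F w = chart_infty ((k \<circ> h) w))"
    using k' eq by (auto simp: T_def)
  ultimately show ?thesis
    using \<open>open T\<close> \<open>z \<in> T\<close> hol_germ_SomeI[of T "k \<circ> h" z F] hol_germ_chartI[of T "k \<circ> h" z F] by blast
qed

lemma hol_germ_hol_at: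
  assumes F: "hol_germ F z" and f: "hol_at f (F z)"
  shows "hol_germ (\<lambda>w. f (F w)) z"
proof (cases "F z")
  case None
  then obtain e h where h: "e > 0" "h holomorphic_on ball z e" "\<And>w. w \<in> ball z e \<Longrightarrow> F w = chart_infty (h w)" "h z = 0"
    using hol_germ_infE[OF F] by blast
  show ?thesis
    by (rule hol_germ_compose[where G = "\<lambda>w. f (chart_infty w)", OF _ h(2)]) (use f None h in auto)
next
  case (Some v)
  then obtain e h where h: "e > 0" "h holomorphic_on ball z e" "\<And>w. w \<in> ball z e \<Longrightarrow> F w = Some (h w)" "h z = v"
    using hol_germ_finiteE[OF F] by blast
  show ?thesis
    by (rule hol_germ_compose[where G = "\<lambda>w. f (Some w)", OF _ h(2)]) (use f Some h in auto)
qed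

lemma hol_at_compose: "hol_at f x \<Longrightarrow> hol_at g (f x) \<Longrightarrow> hol_at (\<lambda>y. g (f y)) x"
  by (cases x) (auto intro: hol_germ_hol_at)

lemma hol_germ_ne_None:
  assumes "hol_germ F z" "F z \<noteq> None"
  obtains e where "e > 0" "\<And>w. w \<in> ball z e \<Longrightarrow> F w \<noteq> None"
  using assms by (metis hol_germ_finiteE option.distinct(1) option.exhaust)

text \<open>For two finite values this is the identity theorem. If F z is finite and G z infinite,
  coincidences near z would give h1 w * h2 w = 1, whereas this product vanishes at z. An infinite F
  z becomes finite by inversion.\<close>

lemma hol_germ_local_identity:
  assumes F: "hol_germ F z" and G: "hol_germ G z" and lim: "z islimpt {w. F w = G w}"
  obtains e where "e > 0" "\<And>w. w \<in> ball z e \<Longrightarrow> F w = G w"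
proof -
  have main: "\<exists>e>0. \<forall>w\<in>ball z e. F w = G w"
    if F: "hol_germ F z" and G: "hol_germ G z" and lim: "z islimpt {w. F w = G w}" and v: "F z = Some v" for F G v
  proof -
    obtain e1 h1 where h1: "e1 > 0" "h1 holomorphic_on ball z e1" "\<And>w. w \<in> ball z e1 \<Longrightarrow> F w = Some (h1 w)"
      using hol_germ_finiteE[OF F v] by blast
    show ?thesis
    proof (cases "G z")
      case None
      then obtain e2 h2 where h2: "e2 > 0" "h2 holomorphic_on ball z e2" "\<And>w. w \<in> ball z e2 \<Longrightarrow> G w = chart_infty (h2 w)" "h2 z = 0"
        using hol_germ_infE[OF G] by blast
      define e where "e = min e1 e2"
      have "e > 0" using h1 h2 by (simp add: e_def)
      have "(\<lambda>w. h1 w * h2 w - 1) holomorphic_on ball z e"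
        using h1 h2 by (auto intro!: holomorphic_intros simp: e_def intro: holomorphic_on_subset)
      then obtain d where d: "0 < d" "d \<le> e" "\<And>w. w \<in> ball z d \<Longrightarrow> h1 w * h2 w - 1 \<noteq> 0"
        by (rule holomorphic_nonzero_ball) (use \<open>e > 0\<close> h2 in auto)
      obtain w where w: "w \<in> {w. F w = G w}" "w \<noteq> z" "dist w z < d"
        using lim d(1) unfolding islimpt_approachable by blast
      then have "chart_infty (h2 w) = Some (h1 w)" using h1 h2 d(2) by (auto simp: e_def dist_commute)
      then have "h1 w * h2 w = 1" by (auto simp: chart_infty_eq_Some)
      then show ?thesis using d(3)[of w] w by (auto simp: dist_commute)
    next
      case (Some u)
      then obtain e2 h2 where h2: "e2 > 0" "h2 holomorphic_on ball z e2" "\<And>w. w \<in> ball z e2 \<Longrightarrow> G w = Some (h2 w)"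
        using hol_germ_finiteE[OF G] by blast
      define e where "e = min e1 e2"
      have "e > 0" using h1 h2 by (simp add: e_def)
      have hol: "(\<lambda>w. h1 w - h2 w) holomorphic_on ball z e"
        using h1 h2 by (auto intro!: holomorphic_intros simp: e_def intro: holomorphic_on_subset)
      have "h1 w - h2 w = 0" if "w \<in> ball z e" for w
      proof (rule analytic_continuation[OF hol open_ball connected_ball, where \<xi> = z and U = "{w \<in> ball z e. F w = G w}"])
        have "z islimpt ({w. F w = G w} \<inter> ball z e)"
          using lim \<open>e > 0\<close> by (intro islimpt_Int_eventually eventually_at_in_open') auto
        then show "z islimpt {w \<in> ball z e. F w = G w}" by (simp add: Int_def conj_commute)
        show "h1 w - h2 w = 0" if "w \<in> {w \<in> ball z e. F w = G w}" for w
          using that h1(3)[of w] h2(3)[of w] by (auto simp: e_def)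
      qed (use that \<open>e > 0\<close> in auto)
      then have "F w = G w" if "w \<in> ball z e" for w
        using that h1(3)[of w] h2(3)[of w] by (auto simp: e_def)
      then show ?thesis using \<open>e > 0\<close> by blast
    qed
  qed
  show ?thesis
  proof (cases "F z")
    case (Some v)
    then show ?thesis using main[OF F G lim] that by blast
  next
    case None
    have "{w. sphere_inv (F w) = sphere_inv (G w)} = {w. F w = G w}"
      by (metis sphere_inv_simps(4))
    then have "\<exists>e>0. \<forall>w\<in>ball z e. sphere_inv (F w) = sphere_inv (G w)"
      using main[of "\<lambda>w. sphere_inv (F w)" "\<lambda>w. sphere_inv (G w)"] F G lim None by (simp add: hol_germ_sphere_inv)
    then show ?thesis using that by (metis sphere_inv_simps(4))
  qed
qed

lemma hol_germ_identity:
  assumes U: "open U" "connected U" and F: "\<And>z. z \<in> U \<Longrightarrow> hol_germ F z" and G: "\<And>z. z \<in> U \<Longrightarrow> hol_germ G z"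
    and \<xi>: "\<xi> \<in> U" "\<xi> islimpt {w \<in> U. F w = G w}" and z: "z \<in> U"
  shows "F z = G z"
proof -
  define E where "E = {z \<in> U. \<exists>e>0. \<forall>w\<in>ball z e. F w = G w}"
  have lim: "z \<in> E" if zU: "z \<in> U" and zl: "z islimpt {w \<in> U. F w = G w}" for z
  proof -
    have "z islimpt {w. F w = G w}" by (rule islimpt_subset[OF zl]) auto
    then obtain e where "e > 0" "\<And>w. w \<in> ball z e \<Longrightarrow> F w = G w"
      by (rule hol_germ_local_identity[OF F[OF zU] G[OF zU]]) (rule that)
    then show ?thesis using zU unfolding E_def by blast
  qed
  have "openin (top_of_set U) E"
  proof -
    have "open E"
      unfolding open_contains_ball
    proof
      fix x assume x: "x \<in> E"
      then obtain e where e: "e > 0" "\<And>w. w \<in> ball x e \<Longrightarrow> F w = G w" by (auto simp: E_def)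
      obtain d where d: "d > 0" "ball x d \<subseteq> U" using x U openE unfolding E_def by blast
      have "ball x (min e d) \<subseteq> E"
      proof
        fix y assume y: "y \<in> ball x (min e d)"
        obtain c where "c > 0" "ball y c \<subseteq> ball x (min e d)" using y open_ball openE by blast
        then show "y \<in> E" using y e d unfolding E_def by (auto simp: subset_iff)
      qed
      then show "\<exists>e>0. ball x e \<subseteq> E" using e d by (intro exI[of _ "min e d"]) auto
    qed
    then show ?thesis by (rule open_subset[rotated]) (auto simp: E_def)
  qed
  moreover have "closedin (top_of_set U) E"
  proof -
    have "E = U \<inter> closure E"
    proof
      have "E \<subseteq> U" by (auto simp: E_def)
      then show "E \<subseteq> U \<inter> closure E" using closure_subset[of E] by blast
      show "U \<inter> closure E \<subseteq> E"
      proof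
        fix x assume x: "x \<in> U \<inter> closure E"
        show "x \<in> E"
        proof (cases "x \<in> E")
          case False
          then have "x islimpt E" using x by (simp add: closure_def)
          moreover have "E \<subseteq> {w \<in> U. F w = G w}" by (auto simp: E_def)
          ultimately have "x islimpt {w \<in> U. F w = G w}" using islimpt_subset by blast
          then show ?thesis using lim x by blast
        qed
      qed
    qed
    then show ?thesis by (metis closed_closure closedin_closed_Int)
  qed
  moreover have "E \<noteq> {}" using lim \<xi> by blast
  ultimately have "E = U" using U(2) unfolding connected_clopen by blast
  then obtain e where "e > 0" "\<forall>w\<in>ball z e. F w = G w" using z unfolding E_def by blast
  then show ?thesis by simp
qed

text \<open>As F is not locally constant, the image of each small disc about z is a neighbourhood of
  v and therefore contains points of Z other than v.\<close>

lemma hol_germ_open_mapping_finite: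
  assumes F: "hol_germ F z" "\<not> z islimpt {w. F w = F z}" and v: "F z = Some v" "v islimpt Z"
  shows "z islimpt {w. F w \<in> Some ` Z}"
  unfolding islimpt_approachable
proof (intro allI impI)
  fix r :: real assume "r > 0"
  obtain e h where h: "e > 0" "h holomorphic_on ball z e" "\<And>w. w \<in> ball z e \<Longrightarrow> F w = Some (h w)" "h z = v"
    using hol_germ_finiteE[OF F(1) v(1)] by blast
  define d where "d = min e r"
  have d: "d > 0" "d \<le> e" "d \<le> r" using h \<open>r > 0\<close> by (auto simp: d_def)
  have "\<not> h constant_on ball z d"
  proof
    assume "h constant_on ball z d"
    then have "\<And>w. w \<in> ball z d \<Longrightarrow> h w = h z" using d(1) by (metis centre_in_ball constant_on_def)
    then have "ball z d \<subseteq> {w. F w = F z}" using h d by auto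
    then have "z islimpt {w. F w = F z}"
      using islimpt_subset[of z "ball z d"] d(1) by (simp add: islimpt_ball)
    with F(2) show False by blast
  qed
  then have "open (h ` ball z d)"
    using h d by (intro open_mapping_thm[of h "ball z d"]) (auto intro: holomorphic_on_subset)
  moreover have "v \<in> h ` ball z d" using h d by (metis centre_in_ball imageI)
  ultimately obtain u where u: "u \<in> Z" "u \<in> h ` ball z d" "u \<noteq> v"
    using v(2) unfolding islimpt_def by blast
  then obtain w where w: "w \<in> ball z d" "u = h w" by blast
  have "F w = Some u" using w h d by auto
  then show "\<exists>x'\<in>{w. F w \<in> Some ` Z}. x' \<noteq> z \<and> dist x' z < r"
    using w u h d by (intro bexI[of _ w]) (auto simp: dist_commute)
qed

text \<open>An unbounded set accumulates at infinity; after inversion it accumulates at 0 and the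
  finite case applies.\<close>

lemma hol_germ_open_mapping_inf:
  assumes F: "hol_germ F z" "\<not> z islimpt {w. F w = F z}" and v: "F z = None" "\<And>L. \<exists>u\<in>Z. L < cmod u"
  shows "z islimpt {w. F w \<in> Some ` Z}"
proof -
  have "0 islimpt inverse ` (Z - {0})"
    unfolding islimpt_approachable
  proof (intro allI impI)
    fix r :: real assume "r > 0"
    obtain u where u: "u \<in> Z" "inverse r < cmod u" using v(2) by blast
    have "cmod u > 0" using u(2) \<open>r > 0\<close> by (meson inverse_positive_iff_positive order.strict_trans)
    have "inverse (cmod u) < inverse (inverse r)" using u \<open>r > 0\<close> by (intro less_imp_inverse_less) auto
    then have "cmod (inverse u) < r" "u \<noteq> 0" using \<open>cmod u > 0\<close> by (auto simp: norm_inverse)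
    then show "\<exists>x'\<in>inverse ` (Z - {0}). x' \<noteq> 0 \<and> dist x' 0 < r"
      using u by (intro bexI[of _ "inverse u"]) auto
  qed
  moreover have "{w. sphere_inv (F w) = sphere_inv (F z)} = {w. F w = F z}"
    by (metis sphere_inv_simps(4))
  ultimately have "z islimpt {w. sphere_inv (F w) \<in> Some ` inverse ` (Z - {0})}"
    using F v(1) by (intro hol_germ_open_mapping_finite[of _ _ 0]) (auto simp: hol_germ_sphere_inv)
  moreover have "{w. sphere_inv (F w) \<in> Some ` inverse ` (Z - {0})} \<subseteq> {w. F w \<in> Some ` Z}"
  proof
    fix w assume "w \<in> {w. sphere_inv (F w) \<in> Some ` inverse ` (Z - {0})}"
    then obtain u where u: "u \<in> Z" "u \<noteq> 0" "sphere_inv (F w) = Some (inverse u)" by auto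
    then have "F w = chart_infty (inverse u)" by (metis sphere_inv_simps(2,4))
    then show "w \<in> {w. F w \<in> Some ` Z}" using u by (auto simp: chart_infty_def)
  qed
  ultimately show ?thesis using islimpt_subset by blast
qed

lemma hol_germ_const: "hol_germ (\<lambda>_. x) z"
proof (cases x)
  case None
  then show ?thesis by (intro hol_germ_chartI[of UNIV "\<lambda>_. 0"]) auto
next
  case (Some v)
  then show ?thesis by (intro hol_germ_SomeI[of UNIV "\<lambda>_. v"]) auto
qed

definition sphere_cnj :: "riemann_sphere \<Rightarrow> riemann_sphere" where
  "sphere_cnj x = map_option cnj x"

lemma hol_germ_sphere_cnj:
  assumes "hol_germ F (cnj z)"
  shows "hol_germ (\<lambda>w. sphere_cnj (F (cnj w))) z"
proof -
  obtain e h where eh: "e > 0" "h holomorphic_on ball (cnj z) e"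
    and H: "(\<forall>w\<in>ball (cnj z) e. F w = Some (h w)) \<or> (\<forall>w\<in>ball (cnj z) e. F w = chart_infty (h w))"
    using assms unfolding hol_germ_def by blast
  have im: "cnj ` ball z e = ball (cnj z) e"
  proof -
    have iff: "cnj w \<in> ball (cnj z) e \<longleftrightarrow> w \<in> ball z e" for w
      by (simp add: dist_norm flip: complex_cnj_diff)
    have "x \<in> cnj ` ball z e" if "x \<in> ball (cnj z) e" for x
      using iff[of "cnj x"] that by (intro image_eqI[of _ _ "cnj x"]) auto
    then show ?thesis using iff by blast
  qed
  have "(cnj \<circ> h \<circ> cnj) holomorphic_on ball z e"
    by (rule holomorphic_on_compose_cnj_cnj) (use eh im in auto)
  moreover have "cnj w \<in> ball (cnj z) e" if "w \<in> ball z e" for w using im that by blast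
  then have "(\<forall>w\<in>ball z e. sphere_cnj (F (cnj w)) = Some ((cnj \<circ> h \<circ> cnj) w)) \<or>
    (\<forall>w\<in>ball z e. sphere_cnj (F (cnj w)) = chart_infty ((cnj \<circ> h \<circ> cnj) w))"
    using H by (auto simp: sphere_cnj_def chart_infty_def)
  ultimately show ?thesis using eh(1) unfolding hol_germ_def by blast
qed

definition reflect :: "riemann_sphere \<Rightarrow> riemann_sphere" where
  "reflect x = sphere_inv (sphere_cnj x)"

lemma reflect_simps [simp]: "reflect None = Some 0" "reflect (Some 0) = None"
  "z \<noteq> 0 \<Longrightarrow> reflect (Some z) = Some (inverse (cnj z))"
  by (auto simp: reflect_def sphere_cnj_def chart_infty_def)

lemma reflect_reflect [simp]: "reflect (reflect x) = x"
  by (cases x) (auto simp: reflect_def sphere_cnj_def chart_infty_def)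

lemma reflect_circle:
  assumes "cmod z = 1"
  shows "reflect (Some z) = Some z" "inverse (cnj z) = z"
proof -
  have "z * cnj z = 1" using assms by (simp add: complex_norm_square[symmetric])
  then show "inverse (cnj z) = z" by (metis inverse_unique mult.commute)
  moreover have "z \<noteq> 0" using assms by auto
  ultimately show "reflect (Some z) = Some z" by simp
qed

lemma hol_germ_reflect:
  assumes "hol_germ F (inverse (cnj z))" "z \<noteq> 0"
  shows "hol_germ (\<lambda>w. reflect (F (inverse (cnj w)))) z"
proof -
  have "hol_germ F (cnj (inverse z))" using assms by simp
  then have "hol_germ (\<lambda>w. sphere_cnj (F (cnj w))) (inverse z)" by (rule hol_germ_sphere_cnj)
  then have "hol_germ (\<lambda>w. sphere_cnj (F (cnj (inverse w)))) z"
    by (rule hol_germ_compose[where S = "- {0}" and h = inverse]) (use assms in \<open>auto intro!: holomorphic_intros\<close>)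
  then show ?thesis unfolding reflect_def hol_germ_sphere_inv by simp
qed

text \<open>F already lives on both sides of the circle, so nothing has to be continued: the
  reflected function is holomorphic as well, agrees with F on the circle, and the identity theorem
  applies. For iterates, U is the plane without a countable set.\<close>

lemma hol_germ_reflection_principle:
  assumes "open U" "connected U" "0 \<notin> U" and U: "\<And>z. z \<in> U \<Longrightarrow> hol_germ F z \<and> hol_germ F (inverse (cnj z))"
    and circ: "\<And>z. cmod z = 1 \<Longrightarrow> z \<in> U \<and> (\<exists>w. F z = Some w \<and> cmod w = 1)" and z: "z \<in> U"
  shows "F z = reflect (F (inverse (cnj z)))"
proof (rule hol_germ_identity[OF assms(1,2) _ _ _ _ z])
  show "hol_germ F w" if "w \<in> U" for w using U that by blast
  show "hol_germ (\<lambda>z. reflect (F (inverse (cnj z)))) w" if "w \<in> U" for w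
    using U[OF that] that \<open>0 \<notin> U\<close> by (intro hol_germ_reflect) auto
  show "1 \<in> U" using circ by simp
  have eq: "F w = reflect (F (inverse (cnj w)))" if "cmod w = 1" for w
    using circ[OF that] reflect_circle that by metis
  have "1 islimpt sphere (0::complex) 1"
  proof -
    have "connected (sphere (0::complex) 1)" by (rule connected_sphere) simp
    moreover have "(-1::complex) \<in> sphere 0 1" "(1::complex) \<in> sphere 0 1" by auto
    ultimately show ?thesis by (metis connected_imp_perfect one_neq_neg_one singletonD)
  qed
  then show "1 islimpt {w \<in> U. F w = reflect (F (inverse (cnj w)))}"
    by (rule islimpt_subset) (use circ eq in auto)
qed

section \<open>Invariant circles of transcendental maps\<close>

text \<open>Near 0 the function k is the l-th power of an injective one. Its order l gives the lower
  bound, and the l-th roots of v bound the fibres.\<close>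

lemma local_power_form:
  assumes k: "k holomorphic_on ball 0 e" "e > 0" "k 0 = 0" and nc: "\<not> 0 islimpt {w. k w = 0}"
  obtains l c d where "l \<ge> 1" "c > 0" "d > 0" "d \<le> e" "\<And>w. w \<in> ball 0 d \<Longrightarrow> c * cmod w ^ l \<le> cmod (k w)"
    "\<And>v. finite {w. w \<in> ball 0 d - {0} \<and> k w = v} \<and> card {w. w \<in> ball 0 d - {0} \<and> k w = v} \<le> l"
proof -
  have nck: "\<not> k constant_on ball 0 e"
  proof
    assume "k constant_on ball 0 e"
    then have "\<And>w. w \<in> ball 0 e \<Longrightarrow> k w = k 0" using k(2) by (metis centre_in_ball constant_on_def)
    then have "ball 0 e \<subseteq> {w. k w = 0}" using k by auto
    moreover have "(0::complex) islimpt ball 0 e" using k(2) by (simp add: islimpt_ball)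
    ultimately have "0 islimpt {w. k w = 0}" by (rule islimpt_subset[rotated])
    with nc show False by blast
  qed
  have "(0::complex) \<in> ball 0 e" using k(2) by simp
  then obtain g r l where g: "0 < l" "0 < r" "ball (0::complex) r \<subseteq> ball 0 e" "g holomorphic_on ball 0 r"
     "\<And>w. w \<in> ball 0 r \<Longrightarrow> k w = (w - 0) ^ l * g w" "\<And>w. w \<in> ball 0 r \<Longrightarrow> g w \<noteq> 0"
    by (rule holomorphic_factor_zero_nonconstant[OF k(1) open_ball connected_ball _ k(3) nck]) (rule that)
  obtain q where q: "q holomorphic_on ball 0 r" "\<And>z. z \<in> ball 0 r \<Longrightarrow> g z = exp (q z)"
    by (rule contractible_imp_holomorphic_log[OF g(4)]) (use g in \<open>auto intro: convex_imp_contractible\<close>)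
  \<comment> \<open>An l-th root of w ^ l * exp (q w). Its derivative exp (q 0 / l) at 0 does not
    vanish, so it is injective near 0.\<close>
  define \<phi> where "\<phi> = (\<lambda>w. w * exp (q w / of_nat l))"
  have hol\<phi>: "\<phi> holomorphic_on ball 0 r" unfolding \<phi>_def using g(1) by (auto intro!: holomorphic_intros q)
  have pow: "\<phi> w ^ l = k w" if "w \<in> ball 0 r" for w
    using g(1) g(5)[OF that] q(2)[OF that] by (simp add: \<phi>_def power_mult_distrib flip: exp_of_nat_mult)
  have "(\<phi> has_field_derivative exp (q 0 / of_nat l)) (at 0)"
  proof -
    have "(q has_field_derivative deriv q 0) (at 0)" using q(1) g(2) by (intro holomorphic_derivI[of _ "ball 0 r"]) auto
    then show ?thesis unfolding \<phi>_def using g(1) by (auto intro!: derivative_eq_intros)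
  qed
  then have d0: "deriv \<phi> 0 \<noteq> 0" by (simp add: DERIV_imp_deriv)
  obtain s where s: "s > 0" "ball (0::complex) s \<subseteq> ball 0 r" "inj_on \<phi> (ball 0 s)"
    by (rule has_complex_derivative_locally_injective[OF hol\<phi> _ open_ball d0]) (use g(2) in auto)
  have "isCont g 0" using g holomorphic_on_imp_continuous_on continuous_on_eq_continuous_at by (metis centre_in_ball open_ball)
  moreover have "cmod (g 0) > 0" using g by simp
  ultimately obtain t where t: "t > 0" "\<And>w. dist w 0 < t \<Longrightarrow> dist (g w) (g 0) < cmod (g 0) / 2"
    unfolding continuous_at_eps_delta by (metis half_gt_zero)
  define d where "d = min s t"
  have gr: "r \<le> e" using g(2,3) by (simp add: ball_subset_ball_iff)
  have sr: "s \<le> r" using s(1,2) by (simp add: ball_subset_ball_iff)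
  show ?thesis
  proof (rule that[of l "cmod (g 0) / 2" d])
    show "d \<le> e" using gr sr by (simp add: d_def)
    show "cmod (g 0) / 2 * cmod w ^ l \<le> cmod (k w)" if "w \<in> ball 0 d" for w
    proof -
      have "cmod (g w - g 0) < cmod (g 0) / 2" using t(2)[of w] that by (simp add: d_def dist_norm)
      moreover have "cmod (g 0) \<le> cmod (g w) + cmod (g w - g 0)"
        by (metis norm_minus_commute norm_triangle_sub)
      ultimately have "cmod (g 0) / 2 \<le> cmod (g w)" by linarith
      then have "cmod (g 0) / 2 * cmod w ^ l \<le> cmod (g w) * cmod w ^ l" by (intro mult_right_mono) auto
      moreover have "k w = w ^ l * g w" using g(5)[of w] that sr by (simp add: d_def)
      ultimately show ?thesis by (simp add: norm_mult norm_power mult.commute)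
    qed
    fix v
    define A where "A = {w. w \<in> ball 0 d - {0} \<and> k w = v}"
    have inj: "inj_on \<phi> A" using s(3) by (rule inj_on_subset) (auto simp: A_def d_def)
    have "finite A \<and> card A \<le> l"
    proof (cases "v = 0")
      case True
      have "A = {}" using True g(5) sr by (auto simp: A_def d_def g(6))
      then show ?thesis by simp
    next
      case False
      have im: "\<phi> ` A \<subseteq> {x. x ^ l = v}" using pow sr by (auto simp: A_def d_def)
      have fin: "finite {x::complex. x ^ l = v}" using g(1) by (intro finite_nth_roots) auto
      have "card A = card (\<phi> ` A)" using inj by (simp add: card_image)
      also have "\<dots> \<le> card {x. x ^ l = v}" using im fin by (rule card_mono[rotated])
      also have "\<dots> = l" using False g(1) by (simp add: card_nth_roots)
      finally show ?thesis using im fin inj finite_subset finite_imageD by blast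
    qed
    then show "finite {w. w \<in> ball 0 d - {0} \<and> k w = v} \<and> card {w. w \<in> ball 0 d - {0} \<and> k w = v} \<le> l"
      by (simp add: A_def)
  qed (use g s t in \<open>auto simp: d_def\<close>)
qed

text \<open>The polynomial bound lets (g (1 / w) - y) w ^ B extend holomorphically to 0. Since y is
  taken arbitrarily far out, the zeros of this function accumulate at 0 and it vanishes
  identically.\<close>

lemma nonessential_eventually_constant:
  assumes hol: "g holomorphic_on {z. R < cmod z}" and bd: "\<And>z. L < cmod z \<Longrightarrow> cmod (g z) \<le> cmod z ^ B"
    and unb: "\<And>M. \<exists>z. M < cmod z \<and> g z = y"
  shows "\<exists>M. \<forall>z. M < cmod z \<longrightarrow> g z = y"
proof -
  define r where "r = 1 / (max (max R L) 0 + 1)"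
  have r: "r > 0" "inverse r > R" "inverse r > L" by (auto simp: r_def)
  have far: "R < cmod (inverse w) \<and> L < cmod (inverse w)" if "w \<in> ball 0 r - {0}" for w
  proof -
    have "inverse r < inverse (cmod w)" using that by (intro less_imp_inverse_less) auto
    then show ?thesis using r by (auto simp: norm_inverse)
  qed
  define q where "q = (\<lambda>w. (g (inverse w) - y) * w ^ B)"
  have "(\<lambda>w. g (inverse w)) holomorphic_on ball 0 r - {0}"
    using far by (intro holomorphic_on_compose_gen[OF _ hol, unfolded o_def] holomorphic_intros) auto
  then have hq: "q holomorphic_on ball 0 r - {0}" unfolding q_def by (intro holomorphic_intros)
  have "q \<in> O[at 0](\<lambda>_. 1)"
  proof (rule bigoI)
    have "cmod (q w) \<le> (1 + cmod y * r ^ B) * cmod 1" if w: "w \<in> ball 0 r - {0}" for w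
    proof -
      have "cmod (q w) \<le> (cmod (g (inverse w)) + cmod y) * cmod w ^ B"
        unfolding q_def norm_mult norm_power by (intro mult_right_mono norm_triangle_ineq4) auto
      also have "\<dots> \<le> (cmod (inverse w) ^ B + cmod y) * cmod w ^ B"
        using bd far[OF w] by (intro mult_right_mono add_right_mono) auto
      also have "\<dots> = 1 + cmod y * cmod w ^ B"
        using w by (simp add: distrib_right norm_inverse flip: power_mult_distrib)
      also have "\<dots> \<le> 1 + cmod y * r ^ B" using w by (intro add_left_mono mult_left_mono power_mono) auto
      finally show ?thesis by simp
    qed
    moreover have "\<forall>\<^sub>F w in at 0. w \<in> ball 0 r - {0}" using r by (intro eventually_at_in_open) auto
    ultimately show "\<forall>\<^sub>F w in at 0. cmod (q w) \<le> (1 + cmod y * r ^ B) * cmod 1"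
      by (metis (mono_tags, lifting) eventually_mono)
  qed
  then obtain Q where Q: "Q holomorphic_on ball 0 r" "\<And>w. w \<in> ball 0 r - {0} \<Longrightarrow> Q w = q w"
    using holomorphic_on_extend[OF hq] r by (auto simp: interior_open)
  have lim: "0 islimpt {w \<in> ball 0 r - {0}. q w = 0}"
    unfolding islimpt_approachable
  proof (intro allI impI)
    fix d :: real assume "d > 0"
    obtain z where z: "inverse (min d r) < cmod z" "g z = y" using unb by blast
    have pos: "0 < inverse (min d r)" using \<open>d > 0\<close> r by simp
    have "z \<noteq> 0" using z(1) pos by auto
    have "inverse (cmod z) < inverse (inverse (min d r))" using z(1) pos by (intro less_imp_inverse_less)
    then have "cmod (inverse z) < d" "cmod (inverse z) < r" by (auto simp: norm_inverse)
    then show "\<exists>x'\<in>{w \<in> ball 0 r - {0}. q w = 0}. x' \<noteq> 0 \<and> dist x' 0 < d"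
      using z \<open>z \<noteq> 0\<close> by (intro bexI[of _ "inverse z"]) (auto simp: q_def)
  qed
  have Q0: "Q w = 0" if "w \<in> ball 0 r" for w
    by (rule analytic_continuation[OF Q(1) open_ball connected_ball _ _ lim]) (use that r Q(2) in auto)
  show ?thesis
  proof (intro exI allI impI)
    fix z assume z: "inverse r < cmod z"
    have pos: "0 < inverse r" using r by simp
    have "z \<noteq> 0" using z pos by auto
    have "inverse (cmod z) < inverse (inverse r)" using z pos by (intro less_imp_inverse_less)
    then have "inverse z \<in> ball 0 r - {0}" using \<open>z \<noteq> 0\<close> by (simp add: norm_inverse)
    then have "q (inverse z) = 0" using Q Q0 by auto
    then show "g z = y" using \<open>z \<noteq> 0\<close> by (simp add: q_def)
  qed
qed

lemma unbounded_fibre_finite: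
  assumes "finite Y" and unb: "\<And>M::real. \<exists>z. M < cmod z \<and> F z \<in> Y"
  shows "\<exists>y\<in>Y. \<forall>M. \<exists>z. M < cmod z \<and> F z = y"
proof (rule ccontr)
  assume "\<not> ?thesis"
  then have "\<forall>y\<in>Y. \<exists>M. \<forall>z. M < cmod z \<longrightarrow> F z \<noteq> y" by blast
  then obtain M where M: "\<And>y z. y \<in> Y \<Longrightarrow> M y < cmod z \<Longrightarrow> F z \<noteq> y" by metis
  obtain z where z: "Max (insert 0 (M ` Y)) < cmod z" "F z \<in> Y" using unb by blast
  have "M (F z) \<le> Max (insert 0 (M ` Y))" using assms(1) z(2) by (intro Max_ge) auto
  then show False using M[of "F z" z] z by auto
qed

text \<open>Under a polynomial bound, some y in Y would be taken arbitrarily far out and g would be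
  equal to y near infinity, so it could not meet Y' there.\<close>

lemma essentialI:
  assumes hol: "g holomorphic_on {z. R < cmod z}"
    and Y: "finite Y" "\<And>M. \<exists>z. M < cmod z \<and> g z \<in> Y" and Y': "finite Y'" "\<And>M. \<exists>z. M < cmod z \<and> g z \<in> Y'"
    and "Y \<inter> Y' = {}"
  shows "essential_at_infinity g"
proof (rule ccontr)
  assume "\<not> essential_at_infinity g"
  then obtain B L where bd: "\<And>z. L < cmod z \<Longrightarrow> cmod (g z) \<le> cmod z ^ B"
    unfolding essential_at_infinity_def by (meson not_le)
  obtain y where y: "y \<in> Y" "\<And>M. \<exists>z. M < cmod z \<and> g z = y" using unbounded_fibre_finite[OF Y] by blast
  obtain M where "\<And>z. M < cmod z \<Longrightarrow> g z = y" using nonessential_eventually_constant[OF hol bd y(2)] by blast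
  moreover obtain z where "M < cmod z" "g z \<in> Y'" using Y' by blast
  ultimately show False using y assms by auto
qed

lemma countable_no_limit_points:
  fixes S :: "complex set"
  assumes "\<And>x. \<not> x islimpt S"
  shows "countable S"
proof -
  have "S sparse_in UNIV" unfolding sparse_in_def using assms by blast
  then show ?thesis using sparse_imp_countable[of UNIV S] by simp
qed

text \<open>An accumulating fibre would contain a disc, which is uncountable.\<close>

lemma hol_germ_not_locally_constant:
  assumes "hol_germ F z" "countable ({w. F w = x} \<inter> ball z e)" "e > 0"
  shows "\<not> z islimpt {w. F w = x}"
proof
  assume "z islimpt {w. F w = x}"
  then obtain d where d: "d > 0" "\<And>w. w \<in> ball z d \<Longrightarrow> F w = x"
    using hol_germ_local_identity[OF assms(1) hol_germ_const, of x] by blast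
  have "ball z (min d e) \<subseteq> {w. F w = x} \<inter> ball z e" using d by auto
  then have "countable (ball z (min d e))" using assms(2) by (rule countable_subset)
  moreover have "uncountable (ball z (min d e))" using d assms by (intro uncountable_ball) auto
  ultimately show False by blast
qed

section \<open>Iterates of a transcendental map on their domains\<close>

locale transcendental_sphere_map =
  fixes f :: "riemann_sphere \<Rightarrow> riemann_sphere"
  assumes hol: "\<And>z. hol_germ (\<lambda>w. f (Some w)) z"
    and picard: "\<And>Y L. finite Y \<Longrightarrow> 3 \<le> card Y \<Longrightarrow> \<exists>z. L < cmod z \<and> f (Some z) \<in> Y"
begin

text \<open>The domain of \<open>f ^^ n\<close> in the plane. Only the values before the n-th must
  be finite; the n-th may be infinite. Thus f is never evaluated at infinity, and already
  \<open>\<Omega> 1\<close> is the whole plane.\<close>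

definition \<Omega> :: "nat \<Rightarrow> complex set" where
  "\<Omega> n = {z. \<forall>k<n. (f ^^ k) (Some z) \<noteq> None}"

definition Pre :: "nat \<Rightarrow> riemann_sphere set \<Rightarrow> complex set" where
  "Pre n Y = {z \<in> \<Omega> n. (f ^^ n) (Some z) \<in> Y}"

lemma \<Omega>_simps [simp]: "\<Omega> 0 = UNIV" "\<Omega> (Suc 0) = UNIV"
  by (auto simp: \<Omega>_def)

lemma \<Omega>_Suc: "\<Omega> (Suc n) = \<Omega> n - Pre n {None}"
  by (auto simp: \<Omega>_def Pre_def less_Suc_eq)

lemma \<Omega>_mono: "m \<le> n \<Longrightarrow> \<Omega> n \<subseteq> \<Omega> m"
  by (auto simp: \<Omega>_def)

lemma \<Omega>_add:
  assumes "z \<in> \<Omega> j" "(f ^^ j) (Some z) = Some u"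
  shows "z \<in> \<Omega> (j + i) \<longleftrightarrow> u \<in> \<Omega> i" "(f ^^ (j + i)) (Some z) = (f ^^ i) (Some u)"
proof -
  have eq: "(f ^^ (j + k)) (Some z) = (f ^^ k) (Some u)" for k
    using assms(2) by (simp add: funpow_add add.commute[of j k])
  show "(f ^^ (j + i)) (Some z) = (f ^^ i) (Some u)" by (rule eq)
  show "z \<in> \<Omega> (j + i) \<longleftrightarrow> u \<in> \<Omega> i"
  proof
    assume z: "z \<in> \<Omega> (j + i)"
    show "u \<in> \<Omega> i"
      unfolding \<Omega>_def
    proof (intro CollectI allI impI notI)
      fix k assume "k < i" "(f ^^ k) (Some u) = None"
      then have "j + k < j + i" "(f ^^ (j + k)) (Some z) = None" using eq by auto
      then show False using z unfolding \<Omega>_def by blast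
    qed
  next
    assume u: "u \<in> \<Omega> i"
    show "z \<in> \<Omega> (j + i)"
      unfolding \<Omega>_def
    proof (intro CollectI allI impI notI)
      fix k assume k: "k < j + i" "(f ^^ k) (Some z) = None"
      show False
      proof (cases "k < j")
        case True
        then show False using assms(1) k unfolding \<Omega>_def by blast
      next
        case False
        then have "(f ^^ (k - j)) (Some u) = None" "k - j < i" using eq[of "k - j"] k by auto
        then show False using u unfolding \<Omega>_def by blast
      qed
    qed
  qed
qed

lemma Pre_add:
  assumes "z \<in> \<Omega> j" "(f ^^ j) (Some z) = Some u"
  shows "z \<in> Pre (j + i) Y \<longleftrightarrow> u \<in> Pre i Y"
  using \<Omega>_add[OF assms, of i] by (auto simp: Pre_def)

lemma hol_iterate: "z \<in> \<Omega> n \<Longrightarrow> hol_germ (\<lambda>w. (f ^^ n) (Some w)) z"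
proof (induction n)
  case 0
  show ?case by (rule hol_germ_SomeI[of UNIV "\<lambda>w. w"]) auto
next
  case (Suc n)
  then have z: "z \<in> \<Omega> n" "(f ^^ n) (Some z) \<noteq> None" by (auto simp: \<Omega>_def)
  have "hol_at f ((f ^^ n) (Some z))" using z(2) hol by auto
  then have "hol_germ (\<lambda>w. f ((f ^^ n) (Some w))) z" using hol_germ_hol_at[OF Suc.IH[OF z(1)]] by blast
  then show ?case by simp
qed

lemma open_\<Omega>: "open (\<Omega> n)"
proof (induction n)
  case (Suc n)
  show ?case
    unfolding open_contains_ball
  proof
    fix z assume z: "z \<in> \<Omega> (Suc n)"
    then have zn: "z \<in> \<Omega> n" "(f ^^ n) (Some z) \<noteq> None" by (auto simp: \<Omega>_def)
    obtain e where e: "e > 0" "\<And>w. w \<in> ball z e \<Longrightarrow> (f ^^ n) (Some w) \<noteq> None"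
      using hol_germ_ne_None[OF hol_iterate[OF zn(1)] zn(2)] by blast
    obtain d where d: "d > 0" "ball z d \<subseteq> \<Omega> n" using Suc.IH zn openE by blast
    have "ball z (min d e) \<subseteq> \<Omega> (Suc n)" using e d by (auto simp: \<Omega>_def less_Suc_eq)
    then show "\<exists>e>0. ball z e \<subseteq> \<Omega> (Suc n)" using e d by (intro exI[of _ "min d e"]) auto
  qed
qed auto

text \<open>An accumulating fibre would make f constant on the plane, whereas \<open>picard\<close>
  yields a value among any three others.\<close>

lemma fibre_no_limit: "\<not> z islimpt {w. f (Some w) = x}"
proof
  assume lim: "z islimpt {w. f (Some w) = x}"
  have const: "f (Some w) = x" for w
    by (rule hol_germ_identity[OF open_UNIV connected_UNIV hol hol_germ_const, of z]) (use lim in auto)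
  have "infinite (UNIV - {x})" by (simp add: infinite_UNIV_char_0)
  then obtain Y where Y: "Y \<subseteq> UNIV - {x}" "finite Y" "card Y = 3"
    using infinite_arbitrarily_large by blast
  obtain w where "f (Some w) \<in> Y" using picard[OF Y(2)] Y(3) by auto
  then show False using const Y by auto
qed

text \<open>Fibres of an iterate can accumulate in the plane, at points where an earlier iterate is
  infinite. Countability survives composition; it suffices to keep domains connected and to exclude
  locally constant iterates.\<close>

lemma countable_Pre: "countable (Pre n {x})"
proof (induction n arbitrary: x)
  case 0
  have "Pre 0 {x} \<subseteq> {the x}" by (auto simp: Pre_def)
  then show ?case using countable_subset by blast
next
  case (Suc n)
  have "Pre (Suc n) {x} \<subseteq> {w. f (Some w) = x} \<union> (\<Union>u\<in>Pre n {x}. {w. f (Some w) = Some u})"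
  proof
    fix z assume z: "z \<in> Pre (Suc n) {x}"
    show "z \<in> {w. f (Some w) = x} \<union> (\<Union>u\<in>Pre n {x}. {w. f (Some w) = Some u})"
    proof (cases "f (Some z)")
      case None
      \<comment> \<open>In the domain of \<open>f ^^ Suc n\<close> the first value can be infinite
        only if it is also the last one.\<close>
      have "n = 0"
      proof (rule ccontr)
        assume "n \<noteq> 0"
        then have "(f ^^ 1) (Some z) \<noteq> None" using z by (fastforce simp: Pre_def \<Omega>_def)
        then show False using None by simp
      qed
      then show ?thesis using z by (auto simp: Pre_def)
    next
      case (Some u)
      then have "u \<in> Pre n {x}" using Pre_add[of z 1 u n "{x}"] z by simp
      then show ?thesis using Some by auto
    qed
  qed
  moreover have "countable {w. f (Some w) = y}" for y
    using fibre_no_limit by (rule countable_no_limit_points)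
  ultimately show ?case using Suc.IH by (meson countable_UN countable_Un countable_subset)
qed

lemma countable_Compl_\<Omega>: "countable (- \<Omega> n)"
proof (induction n)
  case (Suc n)
  have "- \<Omega> (Suc n) \<subseteq> - \<Omega> n \<union> Pre n {None}" by (auto simp: \<Omega>_Suc)
  then show ?case using Suc.IH countable_Pre by (meson countable_Un countable_subset)
qed auto

lemma iterate_not_locally_constant:
  assumes "z \<in> \<Omega> n"
  shows "\<not> z islimpt {w. (f ^^ n) (Some w) = x}"
proof -
  obtain e where e: "e > 0" "ball z e \<subseteq> \<Omega> n" using assms open_\<Omega> openE by blast
  have "countable ({w. (f ^^ n) (Some w) = x} \<inter> ball z e)"
    by (rule countable_subset[OF _ countable_Pre[of n x]]) (use e in \<open>auto simp: Pre_def\<close>)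
  then show ?thesis using hol_germ_not_locally_constant[OF hol_iterate[OF assms]] e by blast
qed

lemma Pre_no_limit:
  assumes "z \<in> \<Omega> n" "finite Y"
  shows "\<not> z islimpt Pre n Y"
  using assms(2)
proof (induction Y rule: finite_induct)
  case empty
  then show ?case by (simp add: Pre_def)
next
  case (insert y Y)
  have "\<not> z islimpt Pre n {y}"
  proof
    assume "z islimpt Pre n {y}"
    then have "z islimpt {w. (f ^^ n) (Some w) = y}" by (rule islimpt_subset) (auto simp: Pre_def)
    then show False using iterate_not_locally_constant[OF assms(1)] by blast
  qed
  moreover have "Pre n (insert y Y) = Pre n {y} \<union> Pre n Y" by (auto simp: Pre_def)
  ultimately show ?case using insert.IH by (simp add: islimpt_Un)
qed

text \<open>By \<open>picard\<close>, three points or infinitely many have preimages under f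
  arbitrarily far out. These preimages are infinite in number, which feeds the next induction
  step.\<close>

lemma Pre_unbounded:
  assumes "n \<ge> 1" "infinite Y \<or> 3 \<le> card Y"
  shows "\<exists>z\<in>Pre n Y. L < cmod z"
  using assms
proof (induction n arbitrary: Y L rule: dec_induct)
  have ex: "\<exists>z. L < cmod z \<and> f (Some z) \<in> Y" if "infinite Y \<or> 3 \<le> card Y" for Y L
  proof (cases "finite Y")
    case True
    then show ?thesis using picard that by blast
  next
    case False
    then obtain Y' where Y': "Y' \<subseteq> Y" "finite Y'" "card Y' = 3" using infinite_arbitrarily_large by blast
    then show ?thesis using picard[OF Y'(2), of L] by auto
  qed
  {
    case base
    then show ?case using ex[of Y L] by (auto simp: Pre_def)
  next
    case (step n)
    have "infinite (Pre n Y)"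
    proof
      assume "finite (Pre n Y)"
      then have "bounded (Pre n Y)" by (rule finite_imp_bounded)
      then obtain M where M: "\<forall>z\<in>Pre n Y. cmod z \<le> M" unfolding bounded_iff by blast
      obtain z where "z \<in> Pre n Y" "M < cmod z" using step.IH[OF step.prems, of M] by blast
      then show False using M by force
    qed
    then have "infinite (Some ` Pre n Y)" by (simp add: finite_image_iff)
    then obtain z where z: "L < cmod z" "f (Some z) \<in> Some ` Pre n Y" using ex by blast
    then obtain u where "u \<in> Pre n Y" "f (Some z) = Some u" by blast
    then show ?case using Pre_add[of z 1 u n Y] z by auto
  }
qed

lemma limit_point_preimage:
  assumes "z \<in> \<Omega> n" "(f ^^ n) (Some z) = Some v" "v islimpt Z"
  shows "z islimpt Pre n (Some ` Z)"
proof -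
  have "z islimpt {w. (f ^^ n) (Some w) \<in> Some ` Z}"
    using hol_germ_open_mapping_finite[OF hol_iterate[OF assms(1)] iterate_not_locally_constant[OF assms(1)] assms(2,3)] .
  then have "z islimpt {w. (f ^^ n) (Some w) \<in> Some ` Z} \<inter> \<Omega> n"
    using open_\<Omega> assms(1) by (intro islimpt_Int_eventually eventually_at_in_open') auto
  then show ?thesis by (rule islimpt_subset) (auto simp: Pre_def)
qed

lemma limit_point_preimage_inf:
  assumes "z \<in> \<Omega> n" "(f ^^ n) (Some z) = None" "\<And>L. \<exists>u\<in>Z. L < cmod u"
  shows "z islimpt Pre n (Some ` Z)"
proof -
  have "z islimpt {w. (f ^^ n) (Some w) \<in> Some ` Z}"
    using hol_germ_open_mapping_inf[OF hol_iterate[OF assms(1)] iterate_not_locally_constant[OF assms(1)] assms(2,3)] .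
  then have "z islimpt {w. (f ^^ n) (Some w) \<in> Some ` Z} \<inter> \<Omega> n"
    using open_\<Omega> assms(1) by (intro islimpt_Int_eventually eventually_at_in_open') auto
  then show ?thesis by (rule islimpt_subset) (auto simp: Pre_def)
qed

lemma not_\<Omega>E:
  assumes "z \<notin> \<Omega> n"
  obtains e where "e < n" "z \<in> \<Omega> e" "(f ^^ e) (Some z) = None"
proof -
  define e where "e = (LEAST e. (f ^^ e) (Some z) = None)"
  obtain k where k: "k < n" "(f ^^ k) (Some z) = None" using assms by (auto simp: \<Omega>_def)
  then have "(f ^^ e) (Some z) = None" unfolding e_def by (rule_tac LeastI)
  moreover have "e \<le> k" unfolding e_def using k(2) by (rule Least_le)
  moreover have "z \<in> \<Omega> e" unfolding \<Omega>_def e_def using not_less_Least by blast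
  ultimately show ?thesis using k by (intro that[of e]) auto
qed

text \<open>The derived set; its iterates are the finite Cantor-Bendixson derivatives.\<close>

definition LP :: "complex set \<Rightarrow> complex set" where
  "LP Z = {x. x islimpt Z}"

lemma LP_mono: "A \<subseteq> A' \<Longrightarrow> LP A \<subseteq> LP A'"
  unfolding LP_def using islimpt_subset by blast

text \<open>Inside the open set \<open>\<Omega> n\<close> the only newly omitted points are those
  where \<open>f ^^ n\<close> is infinite, and these do not accumulate there. Each derivation thus
  lowers n by one, so the complement of \<open>\<Omega> n\<close> is exhausted after n of
  them.\<close>

lemma LP_Compl_\<Omega>: "LP (- \<Omega> (Suc n)) \<subseteq> - \<Omega> n"
proof
  fix z assume "z \<in> LP (- \<Omega> (Suc n))"
  then have lim: "z islimpt - \<Omega> (Suc n)" by (simp add: LP_def)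
  show "z \<in> - \<Omega> n"
  proof
    assume z: "z \<in> \<Omega> n"
    then have "z islimpt - \<Omega> (Suc n) \<inter> \<Omega> n"
      using open_\<Omega> lim by (intro islimpt_Int_eventually eventually_at_in_open') auto
    then have "z islimpt Pre n {None}" by (rule islimpt_subset) (auto simp: \<Omega>_Suc)
    then show False using Pre_no_limit z by blast
  qed
qed

lemma LP_iterate_Compl_\<Omega>: "A \<subseteq> - \<Omega> n \<Longrightarrow> (LP ^^ n) A = {}"
proof (induction n arbitrary: A)
  case (Suc n)
  have "LP A \<subseteq> - \<Omega> n" using LP_mono[OF Suc.prems] LP_Compl_\<Omega> by blast
  then have "(LP ^^ n) (LP A) = {}" by (rule Suc.IH)
  then show ?case by (simp add: funpow_swap1)
qed auto

lemma LP_Compl_Un_Pre: "finite Y \<Longrightarrow> LP (- \<Omega> n \<union> Pre n Y) \<subseteq> - \<Omega> n"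
proof
  fix z assume "finite Y" "z \<in> LP (- \<Omega> n \<union> Pre n Y)"
  then have lim: "z islimpt - \<Omega> n \<or> z islimpt Pre n Y" by (simp add: LP_def islimpt_Un)
  show "z \<in> - \<Omega> n"
  proof
    assume z: "z \<in> \<Omega> n"
    then have "\<not> z islimpt - \<Omega> n" using open_\<Omega>[of n] by (metis ComplD closed_Compl closed_limpt)
    then show False using lim Pre_no_limit z \<open>finite Y\<close> by blast
  qed
qed

text \<open>The domain of the \<open>p\<close>-th iterate \<open>F\<close> cannot contain \<open>0\<close>, the reflection of infinity, so \<open>f ^^ j\<close>
  sends \<open>0\<close> to infinity for some \<open>j < p\<close>. Let \<open>h z\<close> be the value of \<open>f ^^ j\<close> at the reflection of \<open>z\<close>; near
  infinity it grows like a power. If \<open>Z\<close> is the set where \<open>f ^^ (p - j)\<close> is undefined or has a value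
  among three points of the circle, then by symmetry \<open>(f ^^ j) z \<in> Z\<close> implies \<open>h z \<in> Z\<close>. Replacing \<open>Z\<close> by
  iterated sets of limit points keeps this property and makes \<open>Z\<close> discrete near infinity, and then
  \<open>f ^^ j\<close> takes values in \<open>Z\<close> more often than \<open>h\<close> allows.\<close>

lemma no_invariant_unit_circle:
  assumes circ: "\<And>z. cmod z = 1 \<Longrightarrow> z \<in> \<Omega> p \<and> (\<exists>w. (f ^^ p) (Some z) = Some w \<and> cmod w = 1)"
    and p: "p \<ge> 1"
  shows False
proof -
  define F where "F = (\<lambda>z. (f ^^ p) (Some z))"
  define \<tau> where "\<tau> = (\<lambda>z::complex. inverse (cnj z))"
  have \<tau>\<tau>: "\<tau> (\<tau> z) = z" for z by (simp add: \<tau>_def)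
  have cont\<tau>: "isCont \<tau> z" if "z \<noteq> 0" for z
    unfolding \<tau>_def using that by (intro continuous_intros) auto
  have inj\<tau>: "inj \<tau>" by (rule injI) (metis \<tau>\<tau>)
  have lim\<tau>: "\<tau> z islimpt A" if z: "z \<noteq> 0" and lim: "z islimpt {w. \<tau> w \<in> A}" for z A
  proof -
    have "\<tau> z islimpt \<tau> ` {w. \<tau> w \<in> A}"
      using islimpt_isCont_image[OF lim cont\<tau>[OF z]] inj\<tau>
      by (simp add: eventually_at_filter inj_eq)
    then show ?thesis by (rule islimpt_subset) auto
  qed
  \<comment> \<open>The points where F and its reflected copy are both defined. The complement is
    countable, so U is connected and the symmetry holds on all of it.\<close>
  define U where "U = {z \<in> \<Omega> p. z \<noteq> 0 \<and> \<tau> z \<in> \<Omega> p}"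
  have Ueq: "U = - (- \<Omega> p \<union> {0} \<union> \<tau> ` (- \<Omega> p))"
  proof -
    have "z \<in> \<tau> ` (- \<Omega> p) \<longleftrightarrow> \<tau> z \<notin> \<Omega> p" for z
      by (metis ComplD ComplI \<tau>\<tau> image_iff)
    then show ?thesis by (auto simp: U_def)
  qed
  have "open U"
  proof -
    have "open ((- {0}) \<inter> \<tau> -` \<Omega> p)"
      using cont\<tau> open_\<Omega> by (intro continuous_open_preimage continuous_at_imp_continuous_on) auto
    then have "open (\<Omega> p \<inter> ((- {0}) \<inter> \<tau> -` \<Omega> p))" using open_\<Omega> by blast
    moreover have "U = \<Omega> p \<inter> ((- {0}) \<inter> \<tau> -` \<Omega> p)" by (auto simp: U_def)
    ultimately show ?thesis by simp
  qed
  have "countable (- \<Omega> p \<union> {0} \<union> \<tau> ` (- \<Omega> p))" using countable_Compl_\<Omega> by simp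
  then have "connected U"
    unfolding Ueq using connected_open_diff_countable[of UNIV "- \<Omega> p \<union> {0} \<union> \<tau> ` (- \<Omega> p)"]
    by (simp add: Compl_eq_Diff_UNIV connected_UNIV)
  have sym: "F z = reflect (F (\<tau> z))" if "z \<in> U" for z
    unfolding \<tau>_def
  proof (rule hol_germ_reflection_principle[OF \<open>open U\<close> \<open>connected U\<close> _ _ _ that])
    show "hol_germ F w \<and> hol_germ F (inverse (cnj w))" if "w \<in> U" for w
      using that hol_iterate unfolding F_def U_def \<tau>_def by blast
    show "w \<in> U \<and> (\<exists>v. F w = Some v \<and> cmod v = 1)" if "cmod w = 1" for w
      using circ[OF that] reflect_circle[OF that] that by (auto simp: U_def \<tau>_def F_def)
  qed (auto simp: U_def)
  have pre: "\<tau> w \<in> Pre p (reflect ` Y)" if "w \<in> Pre p Y" "w \<noteq> 0" "\<tau> w \<in> \<Omega> p" for w Y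
  proof -
    have "w \<in> U" using that by (auto simp: U_def Pre_def)
    then have "F (\<tau> w) = reflect (F w)" using sym by simp
    then show ?thesis using that by (auto simp: Pre_def F_def)
  qed
  \<comment> \<open>Three points of the circle, as many as \<open>picard\<close> asks for; the
    reflection fixes them. They are distinct because cosine is injective on [0, pi].\<close>
  define c :: "nat \<Rightarrow> complex" where "c = (\<lambda>n. cis (real n))"
  define Y where "Y = Some ` c ` {0..<3::nat}"
  have inj_c: "inj_on c {0..<3::nat}"
  proof (rule inj_onI)
    fix m n :: nat assume mn: "m \<in> {0..<3}" "n \<in> {0..<3}" "c m = c n"
    then have "cos (real m) = cos (real n)" by (simp add: c_def complex_eq_iff)
    moreover have "real m \<le> 3" "real n \<le> 3" using mn by auto
    then have "real m \<le> pi" "real n \<le> pi" using pi_gt3 by linarith+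
    ultimately have "real m = real n" using cos_inj_pi[of "real m" "real n"] by simp
    then show "m = n" by simp
  qed
  have Y: "finite Y" "card Y = 3" "reflect ` Y = Y"
  proof -
    show "finite Y" unfolding Y_def by (intro finite_imageI finite_atLeastLessThan)
    have "card Y = card (c ` {0..<3})" unfolding Y_def by (rule card_image) auto
    also have "\<dots> = card {0..<3::nat}" using inj_c by (rule card_image)
    finally show "card Y = 3" by simp
    have "reflect y = y" if y: "y \<in> Y" for y
    proof -
      obtain n where "y = Some (c n)" using y unfolding Y_def by blast
      moreover have "cmod (c n) = 1" by (simp add: c_def)
      ultimately show ?thesis using reflect_circle(1) by blast
    qed
    then show "reflect ` Y = Y" by (simp add: image_def)
  qed
  have preY: "\<tau> w \<in> Pre p Y" if "w \<in> Pre p Y" "w \<noteq> 0" "\<tau> w \<in> \<Omega> p" for w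
    using pre[OF that] Y(3) by simp
  \<comment> \<open>F has values in Y arbitrarily far out, hence by symmetry at points tending to 0;
    but such points do not accumulate within the domain of F.\<close>
  have "0 \<notin> \<Omega> p"
  proof
    assume 0: "0 \<in> \<Omega> p"
    obtain e where e: "e > 0" "ball 0 e \<subseteq> \<Omega> p" using 0 open_\<Omega> openE by blast
    have "0 islimpt Pre p Y"
      unfolding islimpt_approachable
    proof (intro allI impI)
      fix r :: real assume "r > 0"
      obtain w where w: "w \<in> Pre p Y" "inverse (min e r) < cmod w"
        using Pre_unbounded[OF p, of Y "inverse (min e r)"] Y by auto
      have pos: "0 < inverse (min e r)" using e \<open>r > 0\<close> by simp
      have "w \<noteq> 0" using w(2) pos by auto
      have "inverse (cmod w) < inverse (inverse (min e r))" using w(2) pos by (intro less_imp_inverse_less)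
      then have "cmod (\<tau> w) < e" "cmod (\<tau> w) < r" by (auto simp: \<tau>_def norm_inverse)
      then have "\<tau> w \<in> Pre p Y" using preY[OF w(1) \<open>w \<noteq> 0\<close>] e by auto
      then show "\<exists>x'\<in>Pre p Y. x' \<noteq> 0 \<and> dist x' 0 < r"
        using \<open>cmod (\<tau> w) < r\<close> \<open>w \<noteq> 0\<close> by (intro bexI[of _ "\<tau> w"]) (auto simp: \<tau>_def)
    qed
    then show False using Pre_no_limit[OF 0 Y(1)] by blast
  qed
  \<comment> \<open>Where F is undefined an earlier iterate is infinite, so preimages of Y
    accumulate there. Their reflections accumulate at \<open>\<tau> z\<close>, which is impossible
    inside the domain.\<close>
  have sym\<Omega>1: "\<tau> z \<notin> \<Omega> p" if "z \<noteq> 0" "z \<notin> \<Omega> p" for z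
  proof
    assume \<tau>z: "\<tau> z \<in> \<Omega> p"
    obtain e where e: "e < p" "z \<in> \<Omega> e" "(f ^^ e) (Some z) = None" using not_\<Omega>E[OF \<open>z \<notin> \<Omega> p\<close>] by blast
    have "z islimpt Pre e (Some ` Pre (p - e) Y)"
      using limit_point_preimage_inf[OF e(2,3)] Pre_unbounded[of "p - e" Y] e(1) Y by simp
    moreover have "Pre e (Some ` Pre (p - e) Y) \<subseteq> Pre p Y"
    proof
      fix w assume "w \<in> Pre e (Some ` Pre (p - e) Y)"
      then obtain u where u: "w \<in> \<Omega> e" "(f ^^ e) (Some w) = Some u" "u \<in> Pre (p - e) Y" by (auto simp: Pre_def)
      then show "w \<in> Pre p Y" using Pre_add[OF u(1,2), of "p - e" Y] e(1) by simp
    qed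
    ultimately have lim: "z islimpt Pre p Y" using islimpt_subset by blast
    obtain d where d: "d > 0" "ball (\<tau> z) d \<subseteq> \<Omega> p" using \<tau>z open_\<Omega> openE by blast
    have "\<forall>\<^sub>F w in at z. w \<noteq> 0" using \<open>z \<noteq> 0\<close> by (intro eventually_at_in_open'[of "- {0}", simplified]) auto
    moreover have "\<forall>\<^sub>F w in at z. \<tau> w \<in> \<Omega> p"
      using cont\<tau>[OF \<open>z \<noteq> 0\<close>] open_\<Omega> \<tau>z unfolding isCont_def by (metis topological_tendstoD)
    ultimately have "\<forall>\<^sub>F w in at z. w \<in> {w. w \<noteq> 0 \<and> \<tau> w \<in> \<Omega> p}" by eventually_elim auto
    with lim have "z islimpt Pre p Y \<inter> {w. w \<noteq> 0 \<and> \<tau> w \<in> \<Omega> p}" by (rule islimpt_Int_eventually)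
    then have "z islimpt {w. \<tau> w \<in> Pre p Y}" by (rule islimpt_subset) (use preY in auto)
    then have "\<tau> z islimpt Pre p Y" using lim\<tau> \<open>z \<noteq> 0\<close> by blast
    then show False using Pre_no_limit[OF \<tau>z Y(1)] by blast
  qed
  have sym\<Omega>: "z \<in> \<Omega> p \<longleftrightarrow> \<tau> z \<in> \<Omega> p" if "z \<noteq> 0" for z
    using sym\<Omega>1[of z] sym\<Omega>1[of "\<tau> z"] \<tau>\<tau> that by (auto simp: \<tau>_def)
  obtain j where j: "j < p" "0 \<in> \<Omega> j" "(f ^^ j) (Some 0) = None"
    using not_\<Omega>E[OF \<open>0 \<notin> \<Omega> p\<close>] by blast
  have "j \<ge> 1" using j(3) by (cases j) auto
  define i where "i = p - j"
  have i: "i \<ge> 1" "j + i = p" using j by (auto simp: i_def)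
  obtain e1 k where k: "e1 > 0" "k holomorphic_on ball 0 e1" "\<And>w. w \<in> ball 0 e1 \<Longrightarrow> (f ^^ j) (Some w) = chart_infty (k w)" "k 0 = 0"
    using hol_germ_infE[OF hol_iterate[OF j(2)] j(3)] by blast
  have nlim0: "\<not> 0 islimpt {w. (f ^^ j) (Some w) = None}" by (rule iterate_not_locally_constant[OF j(2)])
  have nlimk: "\<not> 0 islimpt {w. k w = 0}"
  proof
    assume "0 islimpt {w. k w = 0}"
    then have "0 islimpt {w. k w = 0} \<inter> ball 0 e1"
      using k(1) by (intro islimpt_Int_eventually eventually_at_in_open') auto
    then have "0 islimpt {w. (f ^^ j) (Some w) = None}" by (rule islimpt_subset) (use k(3) in auto)
    with nlim0 show False by blast
  qed
  obtain l c0 d where lcd: "l \<ge> 1" "c0 > 0" "d > 0" "d \<le> e1" "\<And>w. w \<in> ball 0 d \<Longrightarrow> c0 * cmod w ^ l \<le> cmod (k w)"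
    "\<And>v. finite {w. w \<in> ball 0 d - {0} \<and> k w = v} \<and> card {w. w \<in> ball 0 d - {0} \<and> k w = v} \<le> l"
    by (rule local_power_form[OF k(2,1,4) nlimk]) (rule that)
  obtain e2 where e2: "e2 > 0" "ball 0 e2 \<subseteq> \<Omega> j" using j(2) open_\<Omega> openE by blast
  define e where "e = min d e2"
  have e: "e > 0" "e \<le> d" "e \<le> e1" "ball 0 e \<subseteq> \<Omega> j" using lcd e2 by (auto simp: e_def)
  have k0: "k w \<noteq> 0" if "w \<in> ball 0 e - {0}" for w
  proof -
    have "c0 * cmod w ^ l > 0" using that lcd by simp
    then show ?thesis using lcd(5)[of w] that e by fastforce
  qed
  define R0 where "R0 = inverse e"
  have R0: "R0 > 0" using e by (simp add: R0_def)
  have \<tau>ball: "z \<noteq> 0 \<and> \<tau> z \<in> ball 0 e - {0}" if "R0 < cmod z" for z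
  proof -
    have "inverse (cmod z) < inverse R0" using that R0 by (intro less_imp_inverse_less)
    moreover have "z \<noteq> 0" using that R0 by auto
    ultimately show ?thesis using e(1) by (auto simp: \<tau>_def norm_inverse R0_def)
  qed
  define h where "h = (\<lambda>z. inverse (k (\<tau> z)))"
  have fh: "\<tau> z \<in> \<Omega> j \<and> (f ^^ j) (Some (\<tau> z)) = Some (h z)" if "R0 < cmod z" for z
  proof -
    have "k (\<tau> z) \<noteq> 0" using \<tau>ball[OF that] k0 by blast
    then show ?thesis using \<tau>ball[OF that] k(3)[of "\<tau> z"] e by (auto simp: h_def chart_infty_def)
  qed
  have hbound: "cmod (h z) \<le> inverse c0 * cmod z ^ l" if "R0 < cmod z" for z
  proof -
    have "c0 * cmod (\<tau> z) ^ l \<le> cmod (k (\<tau> z))" using lcd(5)[of "\<tau> z"] \<tau>ball[OF that] e by auto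
    moreover have "0 < c0 * cmod (\<tau> z) ^ l" using \<tau>ball[OF that] lcd by simp
    ultimately have "inverse (cmod (k (\<tau> z))) \<le> inverse (c0 * cmod (\<tau> z) ^ l)" by (intro le_imp_inverse_le)
    then show ?thesis by (simp add: h_def norm_inverse \<tau>_def power_inverse)
  qed
  have hfib: "finite {z. R0 < cmod z \<and> h z = v} \<and> card {z. R0 < cmod z \<and> h z = v} \<le> l" for v
  proof -
    have sub: "\<tau> ` {z. R0 < cmod z \<and> h z = v} \<subseteq> {w. w \<in> ball 0 d - {0} \<and> k w = inverse v}"
      using \<tau>ball order.strict_trans2[OF _ e(2)] by (auto simp: h_def)
    have inj: "inj_on \<tau> {z. R0 < cmod z \<and> h z = v}" using inj\<tau> by (rule inj_on_subset) auto
    have fin: "finite {w. w \<in> ball 0 d - {0} \<and> k w = inverse v}" using lcd(6) by blast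
    have "finite {z. R0 < cmod z \<and> h z = v}" using finite_subset[OF sub fin] inj by (rule finite_imageD)
    moreover have "card {z. R0 < cmod z \<and> h z = v} \<le> card {w. w \<in> ball 0 d - {0} \<and> k w = inverse v}"
      using card_inj_on_le[OF inj sub fin] .
    ultimately show ?thesis using lcd(6)[of "inverse v"] by linarith
  qed
  have hinf: "\<exists>R\<ge>R0. \<forall>z. R < cmod z \<longrightarrow> \<rho> < cmod (h z)" for \<rho>
  proof -
    have "isCont k 0" using k holomorphic_on_imp_continuous_on continuous_on_eq_continuous_at by (metis centre_in_ball open_ball)
    moreover define \<rho>' where "\<rho>' = max \<rho> 1"
    moreover have "inverse \<rho>' > 0" by (auto simp: \<rho>'_def)
    ultimately obtain s where s: "s > 0" "\<And>w. dist w 0 < s \<Longrightarrow> dist (k w) (k 0) < inverse \<rho>'"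
      unfolding continuous_at_eps_delta by metis
    have "\<rho> < cmod (h z)" if z: "max R0 (inverse s) < cmod z" for z
    proof -
      have "0 < inverse s" using s by simp
      then have "inverse (cmod z) < inverse (inverse s)" using z by (intro less_imp_inverse_less) auto
      then have "dist (\<tau> z) 0 < s" by (simp add: \<tau>_def norm_inverse)
      then have "cmod (k (\<tau> z)) < inverse \<rho>'" using s(2)[of "\<tau> z"] k(4) by simp
      moreover have "k (\<tau> z) \<noteq> 0" using z \<tau>ball k0 by auto
      ultimately have "inverse (inverse \<rho>') < inverse (cmod (k (\<tau> z)))" by (intro less_imp_inverse_less) auto
      then show ?thesis by (simp add: h_def norm_inverse \<rho>'_def)
    qed
    then show ?thesis by (intro exI[of _ "max R0 (inverse s)"]) auto
  qed
  \<comment> \<open>Limit points are carried along because h is continuous and, having finite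
    fibres, does not repeat the value h z near z.\<close>
  have hlim: "h z islimpt Z" if z: "R0 < cmod z" and lim: "z islimpt {w. R0 < cmod w \<longrightarrow> h w \<in> Z}" for z Z
  proof -
    have cont: "isCont h z"
    proof -
      have "\<tau> z \<in> ball 0 e1" using \<tau>ball[OF z] e by auto
      then have ck: "isCont k (\<tau> z)"
        using holomorphic_on_imp_continuous_on[OF k(2)] continuous_on_eq_continuous_at[OF open_ball] by blast
      have z0: "z \<noteq> 0" using \<tau>ball[OF z] by blast
      have "isCont (\<lambda>z. k (\<tau> z)) z" by (rule isCont_o2[OF cont\<tau>[OF z0] ck])
      moreover have "k (\<tau> z) \<noteq> 0" using k0 \<tau>ball[OF z] by blast
      ultimately show ?thesis unfolding h_def by (rule continuous_at_within_inverse)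
    qed
    have "\<forall>\<^sub>F w in at z. w \<in> {w. R0 < cmod w}"
      using z by (intro eventually_at_in_open' open_outside_disc) auto
    with lim have lim': "z islimpt {w. R0 < cmod w \<longrightarrow> h w \<in> Z} \<inter> {w. R0 < cmod w}" by (rule islimpt_Int_eventually)
    have "\<not> z islimpt {w. R0 < cmod w \<and> h w = h z}" using hfib[of "h z"] islimpt_finite by blast
    then have "\<forall>\<^sub>F w in at z. w \<notin> {w. R0 < cmod w \<and> h w = h z}" by (simp add: islimpt_iff_eventually)
    moreover have "\<forall>\<^sub>F w in at z. R0 < cmod w" using \<open>\<forall>\<^sub>F w in at z. w \<in> {w. R0 < cmod w}\<close> by simp
    ultimately have "\<forall>\<^sub>F w in at z. h w \<noteq> h z" by eventually_elim auto
    then have "h z islimpt h ` ({w. R0 < cmod w \<longrightarrow> h w \<in> Z} \<inter> {w. R0 < cmod w})"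
      by (intro islimpt_isCont_image[OF lim' cont])
    then show ?thesis by (rule islimpt_subset) auto
  qed
  define Q where "Q = (\<lambda>Z. \<forall>z u. R0 < cmod z \<longrightarrow> z \<in> \<Omega> j \<longrightarrow> (f ^^ j) (Some z) = Some u \<longrightarrow> u \<in> Z \<longrightarrow> h z \<in> Z)"
  define Z0 where "Z0 = - \<Omega> i \<union> Pre i Y"
  \<comment> \<open>Leaving the domain of F and having an F-value in Y are both symmetric under
    \<tau>. Factoring \<open>f ^^ p\<close> through \<open>f ^^ j\<close> at z and at its reflection
    turns this into a statement about u and h z.\<close>
  have Q0: "Q Z0"
    unfolding Q_def
  proof (intro allI impI)
    fix z u assume z: "R0 < cmod z" "z \<in> \<Omega> j" "(f ^^ j) (Some z) = Some u" "u \<in> Z0"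
    have z0: "z \<noteq> 0" using \<tau>ball z by blast
    have A: "z \<in> \<Omega> p \<longleftrightarrow> u \<in> \<Omega> i" "z \<in> Pre p Y \<longleftrightarrow> u \<in> Pre i Y"
      using \<Omega>_add(1)[OF z(2,3), of i] Pre_add[OF z(2,3), of i Y] i by auto
    have B: "\<tau> z \<in> \<Omega> p \<longleftrightarrow> h z \<in> \<Omega> i" "\<tau> z \<in> Pre p Y \<longleftrightarrow> h z \<in> Pre i Y"
      using \<Omega>_add(1)[of "\<tau> z" j "h z" i] Pre_add[of "\<tau> z" j "h z" i Y] fh[OF z(1)] i by auto
    show "h z \<in> Z0"
    proof (cases "\<tau> z \<in> \<Omega> p")
      case False
      then show ?thesis using B by (simp add: Z0_def)
    next
      case True
      then have "u \<in> Pre i Y" using sym\<Omega>[OF z0] A z(4) by (auto simp: Z0_def)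
      then have "z \<in> Pre p Y" using A by simp
      then have "\<tau> z \<in> Pre p Y" using preY[of z] z0 True by simp
      then show ?thesis using B by (simp add: Z0_def)
    qed
  qed
  \<comment> \<open>If \<open>f ^^ j\<close> sends z to a limit point of Z, the open mapping
    property provides points tending to z with values in Z; h sends them into Z, and their images
    accumulate at h z.\<close>
  have QLP: "Q (LP Z)" if Q: "Q Z" for Z
    unfolding Q_def
  proof (intro allI impI)
    fix z v assume z: "R0 < cmod z" "z \<in> \<Omega> j" "(f ^^ j) (Some z) = Some v" "v \<in> LP Z"
    then have "z islimpt Pre j (Some ` Z)" using limit_point_preimage by (simp add: LP_def)
    then have "z islimpt {w. R0 < cmod w \<longrightarrow> h w \<in> Z}"
      by (rule islimpt_subset) (use Q in \<open>auto simp: Q_def Pre_def\<close>)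
    then show "h z \<in> LP Z" using hlim z by (simp add: LP_def)
  qed
  have Qm: "Q ((LP ^^ m) Z0)" for m by (induction m) (auto simp: Q0 QLP)
  define unb where "unb = (\<lambda>A. \<forall>L. \<exists>z\<in>A. L < cmod z)"
  have "\<exists>z\<in>Pre i Y. L < cmod z" for L by (rule Pre_unbounded[OF i(1)]) (simp add: Y)
  then have "unb Z0" unfolding unb_def Z0_def by blast
  have "LP Z0 \<subseteq> - \<Omega> i" unfolding Z0_def using Y(1) by (rule LP_Compl_Un_Pre)
  then have "(LP ^^ i) (LP Z0) = {}" by (rule LP_iterate_Compl_\<Omega>)
  then have "(LP ^^ Suc i) Z0 = {}" by (simp add: funpow_swap1)
  then have "\<not> unb ((LP ^^ Suc i) Z0)" by (simp add: unb_def)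
  then have ex: "\<exists>m. \<not> unb ((LP ^^ m) Z0)" by blast
  \<comment> \<open>The derived sets finally vanish, so there is a first bounded one. Its
    predecessor, called Z below, is unbounded while its limit points stay in a bounded
    region.\<close>
  define m where "m = (LEAST m. \<not> unb ((LP ^^ m) Z0))"
  have m: "\<not> unb ((LP ^^ m) Z0)" unfolding m_def using ex by (rule LeastI_ex)
  have "m \<noteq> 0" using m \<open>unb Z0\<close> by (metis funpow_0)
  then obtain m' where m': "m = Suc m'" by (cases m) auto
  define Z where "Z = (LP ^^ m') Z0"
  have "unb Z" using not_less_Least[of m' "\<lambda>m. \<not> unb ((LP ^^ m) Z0)"] m' by (auto simp: Z_def m_def)
  have "\<not> unb (LP Z)" using m m' by (simp add: Z_def)
  have QZ: "Q Z" using Qm by (simp add: Z_def)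
  obtain \<rho> where \<rho>: "\<And>z. z \<in> LP Z \<Longrightarrow> cmod z \<le> \<rho>" using \<open>\<not> unb (LP Z)\<close> by (auto simp: unb_def not_less)
  obtain R1 where R1: "R0 \<le> R1" "\<And>z. R1 < cmod z \<Longrightarrow> \<rho> + 1 < cmod (h z)" using hinf by blast
  define R where "R = max R1 1"
  have R: "R \<ge> 1" "\<And>z. R < cmod z \<Longrightarrow> R0 < cmod z \<and> \<rho> + 1 < cmod (h z)"
    using R1 by (auto simp: R_def)
  have infZ: "infinite Z"
  proof
    assume "finite Z"
    then obtain M where "\<forall>z\<in>Z. cmod z \<le> M" using finite_imp_bounded bounded_iff by metis
    then show False using \<open>unb Z\<close> unfolding unb_def by (meson not_le)
  qed
  \<comment> \<open>If \<open>f ^^ e\<close> were infinite at z, preimages of Z under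
    \<open>f ^^ j\<close> would accumulate at z and h z would be a limit point of Z; far out,
    however, h z lies beyond all of these. This makes \<open>f ^^ j\<close> holomorphic near
    infinity.\<close>
  have nopole: False if z: "R < cmod z" "e \<le> j" "z \<in> \<Omega> e" "(f ^^ e) (Some z) = None" for z e
  proof -
    define A where "A = Pre (j - e) (Some ` Z)"
    have "\<exists>u\<in>A. L < cmod u" for L
    proof (cases "j - e = 0")
      case True
      then have "A = Z" by (auto simp: A_def Pre_def)
      then show ?thesis using \<open>unb Z\<close> by (simp add: unb_def)
    next
      case False
      then show ?thesis using Pre_unbounded[of "j - e" "Some ` Z"] infZ by (simp add: A_def finite_image_iff)
    qed
    then have "z islimpt Pre e (Some ` A)" using limit_point_preimage_inf[OF z(3,4)] by blast
    moreover have "Pre e (Some ` A) \<subseteq> {w. R0 < cmod w \<longrightarrow> h w \<in> Z}"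
    proof
      fix w assume "w \<in> Pre e (Some ` A)"
      then obtain u where u: "w \<in> \<Omega> e" "(f ^^ e) (Some w) = Some u" "u \<in> A" by (auto simp: Pre_def)
      then have "w \<in> Pre j (Some ` Z)" using Pre_add[OF u(1,2), of "j - e"] z(2) by (simp add: A_def)
      then show "w \<in> {w. R0 < cmod w \<longrightarrow> h w \<in> Z}" using QZ by (auto simp: Q_def Pre_def)
    qed
    ultimately have "z islimpt {w. R0 < cmod w \<longrightarrow> h w \<in> Z}" by (rule islimpt_subset)
    then have "h z islimpt Z" using hlim R(2)[OF z(1)] by blast
    then have "cmod (h z) \<le> \<rho>" using \<rho> by (simp add: LP_def)
    then show False using R(2)[OF z(1)] by simp
  qed
  have \<Omega>j: "z \<in> \<Omega> j \<and> (f ^^ j) (Some z) \<noteq> None" if z: "R < cmod z" for z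
  proof -
    have "z \<in> \<Omega> (Suc j)"
    proof (rule ccontr)
      assume "z \<notin> \<Omega> (Suc j)"
      then obtain e where "e < Suc j" "z \<in> \<Omega> e" "(f ^^ e) (Some z) = None" using not_\<Omega>E by blast
      then show False using nopole[OF z, of e] by simp
    qed
    then show ?thesis by (simp add: \<Omega>_Suc Pre_def)
  qed
  define g where "g = (\<lambda>z. the ((f ^^ j) (Some z)))"
  have fg: "(f ^^ j) (Some z) = Some (g z)" if "R < cmod z" for z
    using \<Omega>j[OF that] unfolding g_def by (intro option.collapse[symmetric]) blast
  have holg: "g holomorphic_on {z. R < cmod z}"
    unfolding holomorphic_on_open[OF open_outside_disc]
  proof
    fix z assume z: "z \<in> {z. R < cmod z}"
    obtain s q where q: "s > 0" "q holomorphic_on ball z s" "\<And>w. w \<in> ball z s \<Longrightarrow> (f ^^ j) (Some w) = Some (q w)"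
    proof (rule hol_germ_finiteE[OF hol_iterate fg, of z])
      show "z \<in> \<Omega> j" "R < cmod z" using \<Omega>j z by auto
    qed (rule that)
    have "(q has_field_derivative deriv q z) (at z)" using q by (intro holomorphic_derivI[of _ "ball z s"]) auto
    then have "(g has_field_derivative deriv q z) (at z)"
      by (rule has_field_derivative_transform_within_open[of _ _ _ "ball z s"]) (use q in \<open>auto simp: g_def\<close>)
    then show "\<exists>f'. (g has_field_derivative f') (at z)" by blast
  qed
  have unbg: "\<exists>z. M < cmod z \<and> g z \<in> A" if A: "finite A" "card A = 3" for A M
  proof -
    obtain z where z: "z \<in> Pre j (Some ` A)" "max R M < cmod z"
      using Pre_unbounded[OF \<open>j \<ge> 1\<close>, of "Some ` A" "max R M"] A by (auto simp: card_image)
    then show ?thesis using fg[of z] by (auto simp: Pre_def)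
  qed
  \<comment> \<open>Both of two disjoint triples are met arbitrarily far out, which no polynomial
    bound permits.\<close>
  have ess: "essential_at_infinity g"
  proof (rule essentialI[OF holg])
    show "finite {0, 1, 2::complex}" "finite {3, 4, 5::complex}" "{0, 1, 2::complex} \<inter> {3, 4, 5} = {}" by auto
    show "\<exists>z. M < cmod z \<and> g z \<in> {0, 1, 2}" "\<exists>z. M < cmod z \<and> g z \<in> {3, 4, 5}" for M
      by (rule unbg; simp)+
  qed
  \<comment> \<open>Beyond modulus \<open>\<rho> + 1\<close> there are no limit points of Z, so
    every disc contains finitely many points of Z1. The map h respects the restriction because
    \<open>cmod (h z)\<close> exceeds this bound far out.\<close>
  define Z1 where "Z1 = Z \<inter> {w. \<rho> + 1 < cmod w}"
  define K where "K = max 1 (inverse c0)"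
  show False
  proof (rule essential_preimage_growth[OF holg ess R(1), of K l h Z1])
    show "K \<ge> 1" "l \<ge> 1" using lcd by (auto simp: K_def)
    show "cmod (h z) \<le> K * cmod z ^ l" if "R < cmod z" for z
    proof -
      have "inverse c0 * cmod z ^ l \<le> K * cmod z ^ l" by (intro mult_right_mono) (auto simp: K_def)
      then show ?thesis using hbound[of z] R(2)[OF that] by linarith
    qed
    show "finite {z. R < cmod z \<and> h z = v} \<and> card {z. R < cmod z \<and> h z = v} \<le> l" for v
    proof -
      have sub: "{z. R < cmod z \<and> h z = v} \<subseteq> {z. R0 < cmod z \<and> h z = v}" using R by auto
      then have "card {z. R < cmod z \<and> h z = v} \<le> card {z. R0 < cmod z \<and> h z = v}" using hfib by (intro card_mono) auto
      then show ?thesis using hfib[of v] finite_subset[OF sub] by linarith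
    qed
    show "infinite Z1"
    proof
      assume "finite Z1"
      then obtain M where M: "\<forall>z\<in>Z1. cmod z \<le> M" using finite_imp_bounded bounded_iff by metis
      obtain z where "z \<in> Z" "max M (\<rho> + 1) < cmod z" using \<open>unb Z\<close> unfolding unb_def by blast
      then have "z \<in> Z1" "M < cmod z" by (auto simp: Z1_def)
      then show False using M by force
    qed
    show "finite (Z1 \<inter> cball 0 r)" for r
    proof (rule ccontr)
      assume "infinite (Z1 \<inter> cball 0 r)"
      then obtain x where x: "x islimpt (Z1 \<inter> cball 0 r)"
        using Heine_Borel_imp_Bolzano_Weierstrass[OF compact_cball] by (metis inf_le2)
      then have "x islimpt Z" by (rule islimpt_subset) (auto simp: Z1_def)
      then have le: "cmod x \<le> \<rho>" using \<rho> by (simp add: LP_def)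
      have "x islimpt {w. \<rho> + 1 \<le> cmod w}" using x by (rule islimpt_subset) (auto simp: Z1_def)
      moreover have "closed {w. \<rho> + 1 \<le> cmod w}" by (intro closed_Collect_le continuous_intros)
      ultimately have "\<rho> + 1 \<le> cmod x" unfolding closed_limpt by blast
      with le show False by simp
    qed
    show "h z \<in> Z1" if "R < cmod z" "g z \<in> Z1" for z
      using QZ R(2)[OF that(1)] \<Omega>j[OF that(1)] fg[OF that(1)] that(2) unfolding Q_def Z1_def by blast
  qed
qed

end

section \<open>Meromorphic functions as sphere maps, and normalisation of the circle\<close>

lemma hol_germ_holomorphic:
  assumes "open S" "\<And>z. z \<in> S \<Longrightarrow> hol_germ F z \<and> F z \<noteq> None"
  shows "(\<lambda>z. the (F z)) holomorphic_on S"
  unfolding holomorphic_on_open[OF assms(1)]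
proof
  fix z assume "z \<in> S"
  then obtain v where "hol_germ F z" "F z = Some v" using assms(2) by blast
  then obtain e h where h: "e > 0" "h holomorphic_on ball z e" "\<And>w. w \<in> ball z e \<Longrightarrow> F w = Some (h w)"
    by (rule hol_germ_finiteE) (rule that)
  have "(h has_field_derivative deriv h z) (at z)" using h by (intro holomorphic_derivI[of _ "ball z e"]) auto
  then have "((\<lambda>z. the (F z)) has_field_derivative deriv h z) (at z)"
    by (rule has_field_derivative_transform_within_open[of _ _ _ "ball z e"]) (use h in auto)
  then show "\<exists>f'. ((\<lambda>z. the (F z)) has_field_derivative f') (at z)" by blast
qed

definition affine :: "complex \<Rightarrow> complex \<Rightarrow> riemann_sphere \<Rightarrow> riemann_sphere" where
  "affine a c x = map_option (\<lambda>z. a + c * z) x"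

lemma affine_simps [simp]: "affine a c None = None" "affine a c (Some z) = Some (a + c * z)"
  by (simp_all add: affine_def)

lemma affine_inverse: "c \<noteq> 0 \<Longrightarrow> affine a c (affine (- a / c) (1 / c) x) = x"
  "c \<noteq> 0 \<Longrightarrow> affine (- a / c) (1 / c) (affine a c x) = x"
  by (cases x; simp add: field_simps)+

lemma hol_at_affine:
  assumes "c \<noteq> 0"
  shows "hol_at (affine a c) x"
proof (cases x)
  case None
  have "hol_germ (\<lambda>w. affine a c (chart_infty w)) 0"
  proof (rule hol_germ_chartI[of "{w. a * w + c \<noteq> 0}" "\<lambda>w. w / (a * w + c)"])
    show "open {w. a * w + c \<noteq> 0}" by (intro open_Collect_neq continuous_intros)
    show "(\<lambda>w. w / (a * w + c)) holomorphic_on {w. a * w + c \<noteq> 0}" by (intro holomorphic_intros) auto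
    fix w assume "w \<in> {w. a * w + c \<noteq> 0}"
    then show "affine a c (chart_infty w) = chart_infty (w / (a * w + c))"
      by (auto simp: chart_infty_def field_simps)
  qed (use assms in auto)
  then show ?thesis by (simp add: None)
next
  case (Some z)
  have "hol_germ (\<lambda>w. affine a c (Some w)) z"
    by (rule hol_germ_SomeI[of UNIV "\<lambda>w. a + c * w"]) (auto intro!: holomorphic_intros)
  then show ?thesis by (simp add: Some)
qed

lemma hol_at_sphere_inv: "hol_at sphere_inv x"
proof (cases x)
  case None
  have "hol_germ (\<lambda>w. sphere_inv (chart_infty w)) 0"
    by (rule hol_germ_SomeI[of UNIV "\<lambda>w. w"]) auto
  then show ?thesis by (simp add: None)
next
  case (Some z)
  have "hol_germ (\<lambda>w. sphere_inv (Some w)) z"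
    by (rule hol_germ_chartI[of UNIV "\<lambda>w. w"]) auto
  then show ?thesis by (simp add: Some)
qed

text \<open>By the great Picard theorem q or its reciprocal has a limit at 0, so the singularity is
  removable or a pole.\<close>

lemma picard_meromorphic:
  assumes q: "q holomorphic_on ball 0 e - {0}" "e > 0"
    and omit: "\<And>w. w \<in> ball 0 e - {0} \<Longrightarrow> q w \<noteq> 0 \<and> q w \<noteq> c" "c \<noteq> 0"
  shows "q meromorphic_on {0}"
proof -
  have "isolated_singularity_at q 0"
    unfolding isolated_singularity_at_def
    by (intro exI[of _ e] conjI q) (use q in \<open>simp add: analytic_on_open open_Diff\<close>)
  moreover have "not_essential q 0"
  proof -
    obtain l where "q \<midarrow>0\<rightarrow> l \<or> (inverse \<circ> q) \<midarrow>0\<rightarrow> l"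
      by (rule great_Picard[OF open_ball _ omit(2)[symmetric] q(1)]) (use q(2) omit(1) in auto)
    then consider "q \<midarrow>0\<rightarrow> l" | "l \<noteq> 0" "(\<lambda>w. inverse (q w)) \<midarrow>0\<rightarrow> l" | "(\<lambda>w. inverse (q w)) \<midarrow>0\<rightarrow> 0"
      by (auto simp: o_def)
    then show ?thesis
    proof cases
      case 2
      then have "(\<lambda>w. inverse (inverse (q w))) \<midarrow>0\<rightarrow> inverse l" by (intro tendsto_inverse)
      then show ?thesis by (simp add: tendsto_imp_not_essential)
    next
      case 3
      have "\<forall>\<^sub>F w in at (0::complex). w \<in> ball 0 e - {0}" using q(2) by (intro eventually_at_in_open) auto
      then have "\<forall>\<^sub>F w in at 0. inverse (q w) \<noteq> 0" by eventually_elim (use omit(1) in auto)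
      then have "filterlim (\<lambda>w. inverse (q w)) (at 0) (at 0)" using 3 by (intro filterlim_atI)
      then have "is_pole q 0" unfolding is_pole_def by (simp add: filterlim_inverse_at_iff)
      then show ?thesis by (simp add: not_essential_def)
    qed (auto simp: not_essential_def)
  qed
  ultimately show ?thesis by (simp add: meromorphic_at_iff)
qed

text \<open>With infinity omitted F is finite near infinity, and two omitted finite values remain
  for the great Picard theorem.\<close>

lemma sphere_picard_infty:
  assumes F: "\<And>z. hol_germ F z" and Y: "finite Y" "3 \<le> card Y" "None \<in> Y"
    and omit: "\<And>z. L < cmod z \<Longrightarrow> F z \<notin> Y"
  shows "(\<lambda>w. the (F (inverse w))) meromorphic_on {0}"
proof -
  define e where "e = inverse (max L 0 + 1)"
  have e: "e > 0" by (auto simp: e_def add_nonneg_pos)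
  have big: "L < cmod (inverse w)" if "w \<in> ball 0 e - {0}" for w :: complex
  proof -
    have "inverse e < inverse (cmod w)" using that by (intro less_imp_inverse_less) auto
    then show ?thesis by (simp add: e_def norm_inverse)
  qed
  have "\<not> card (Y - {None}) \<le> Suc 0" using Y by simp
  then have "\<not> (\<forall>x1\<in>Y - {None}. \<forall>x2\<in>Y - {None}. x1 = x2)"
    using card_le_Suc0_iff_eq[of "Y - {None}"] Y(1) by blast
  then obtain x1 x2 where "x1 \<in> Y - {None}" "x2 \<in> Y - {None}" "x1 \<noteq> x2" by blast
  then obtain y1 y2 where y: "Some y1 \<in> Y" "Some y2 \<in> Y" "y1 \<noteq> y2" by auto
  define q where "q = (\<lambda>w. the (F (inverse w)) - y1)"
  have "(\<lambda>w. the (F (inverse w))) holomorphic_on ball 0 e - {0}"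
  proof (rule hol_germ_holomorphic)
    fix w :: complex assume w: "w \<in> ball 0 e - {0}"
    have "hol_germ (\<lambda>w. F (inverse w)) w"
      by (rule hol_germ_compose[where G = F and h = inverse and S = "- {0}", OF F]) (use w in \<open>auto intro!: holomorphic_intros\<close>)
    then show "hol_germ (\<lambda>w. F (inverse w)) w \<and> F (inverse w) \<noteq> None" using omit[OF big[OF w]] Y(3) by metis
  qed auto
  then have holq: "q holomorphic_on ball 0 e - {0}" unfolding q_def by (intro holomorphic_intros)
  have om: "q w \<noteq> 0 \<and> q w \<noteq> y2 - y1" if w: "w \<in> ball 0 e - {0}" for w
    using omit[OF big[OF w]] Y(3) y by (cases "F (inverse w)") (auto simp: q_def)
  have "q meromorphic_on {0}" by (rule picard_meromorphic[OF holq e om]) (use y(3) in auto)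
  then have "(\<lambda>w. q w + y1) meromorphic_on {0}" by (intro meromorphic_intros)
  then show ?thesis by (simp add: q_def)
qed

text \<open>If infinity is not in Y, the Moebius map T sends a point y0 of Y there, and g is
  recovered as y0 + 1 / G. The function g is tied to F only at finite values and is unconstrained at
  the poles.\<close>

lemma sphere_picard:
  assumes F: "\<And>z. hol_germ F z" and Y: "finite Y" "3 \<le> card Y" and poles: "\<And>z. \<not> z islimpt {w. F w = None}"
    and omit: "\<And>z. L < cmod z \<Longrightarrow> F z \<notin> Y" and g: "\<And>z v. F z = Some v \<Longrightarrow> g z = v"
  shows "(\<lambda>w. g (inverse w)) meromorphic_on {0}"
proof (cases "None \<in> Y")
  case True
  have mero: "(\<lambda>w. the (F (inverse w))) meromorphic_on {0}"
    by (rule sphere_picard_infty[of F, OF F Y True omit])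
  define e where "e = inverse (max L 0 + 1)"
  have "e > 0" by (auto simp: e_def add_nonneg_pos)
  then have "\<forall>\<^sub>F w in at (0::complex). w \<in> ball 0 e - {0}" by (intro eventually_at_in_open) auto
  then have "\<forall>\<^sub>F w in at 0. g (inverse w) = the (F (inverse w))"
  proof eventually_elim
    case (elim w)
    then have "inverse e < inverse (cmod w)" by (intro less_imp_inverse_less) auto
    then have "L < cmod (inverse w)" by (simp add: e_def norm_inverse)
    then have "F (inverse w) \<noteq> None" using omit True by metis
    then show ?case using g by auto
  qed
  then show ?thesis using mero by (subst meromorphic_on_cong[of "{0}" _ "\<lambda>w. the (F (inverse w))"]) auto
next
  case False
  have "Y \<noteq> {}" using Y by auto
  then obtain y0 where y0: "Some y0 \<in> Y" using False by (metis all_not_in_conv not_None_eq)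
  define T where "T = (\<lambda>x. sphere_inv (affine (- y0) 1 x))"
  have "inj T"
  proof (rule injI)
    fix x y assume "T x = T y"
    then have "affine (- y0) 1 x = affine (- y0) 1 y" unfolding T_def by (metis sphere_inv_simps(4))
    then show "x = y" by (cases x; cases y) auto
  qed
  define G where "G = (\<lambda>w. the (T (F (inverse w))))"
  have G: "G meromorphic_on {0}"
    unfolding G_def
  proof (rule sphere_picard_infty[of "\<lambda>z. T (F z)" "T ` Y" L])
    have "hol_at T x" for x
      unfolding T_def by (rule hol_at_compose[OF hol_at_affine hol_at_sphere_inv]) simp
    then show "hol_germ (\<lambda>z. T (F z)) z" for z using hol_germ_hol_at[OF F] by blast
    show "finite (T ` Y)" "3 \<le> card (T ` Y)" using Y \<open>inj T\<close> by (auto simp: card_image inj_on_subset)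
    show "None \<in> T ` Y" using y0 by (intro image_eqI[of _ _ "Some y0"]) (auto simp: T_def)
    show "T (F z) \<notin> T ` Y" if "L < cmod z" for z using omit[OF that] \<open>inj T\<close> by (simp add: inj_image_mem_iff)
  qed
  define e where "e = inverse (max L 0 + 1)"
  have e: "e > 0" by (auto simp: e_def add_nonneg_pos)
  have rel: "(F (inverse w) = None \<longleftrightarrow> G w = 0) \<and> (G w \<noteq> 0 \<longrightarrow> g (inverse w) = y0 + inverse (G w))"
    if w: "w \<in> ball 0 e - {0}" for w :: complex
  proof -
    have "inverse e < inverse (cmod w)" using w by (intro less_imp_inverse_less) auto
    then have "L < cmod (inverse w)" by (simp add: e_def norm_inverse)
    then have ne: "F (inverse w) \<noteq> Some y0" using omit y0 by metis
    show ?thesis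
    proof (cases "F (inverse w)")
      case None
      then show ?thesis by (simp add: G_def T_def)
    next
      case (Some v)
      then have "v - y0 \<noteq> 0" using ne by simp
      then show ?thesis using Some g[OF Some] by (simp add: G_def T_def chart_infty_def)
    qed
  qed
  have ev: "\<forall>\<^sub>F w in at (0::complex). w \<in> ball 0 e - {0}" using e by (intro eventually_at_in_open) auto
  \<comment> \<open>Zeros of G are poles of F. If they accumulated at 0, G would vanish near 0 and F
    would be infinite near infinity, against \<open>poles\<close>.\<close>
  have "\<not> (\<exists>\<^sub>F w in at 0. G w = 0)"
  proof
    assume "\<exists>\<^sub>F w in at 0. G w = 0"
    then have "\<forall>\<^sub>F w in at 0. G w = 0"
      using G not_essential_frequently_0_imp_eventually_0[of G 0] by (simp add: meromorphic_at_iff)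
    with ev have "\<forall>\<^sub>F w in at 0. F (inverse w) = None \<and> w \<in> ball 0 e - {0}" by eventually_elim (use rel in blast)
    then obtain d where d: "d > 0" "\<And>w. w \<noteq> 0 \<Longrightarrow> dist w 0 < d \<Longrightarrow> F (inverse w) = None"
      unfolding eventually_at by blast
    define z where "z = complex_of_real (inverse d + 1)"
    have N: "F z' = None" if "inverse d < cmod z'" for z'
    proof -
      have "0 < inverse d" using d by simp
      then have "inverse (cmod z') < inverse (inverse d)" using that by (intro less_imp_inverse_less)
      moreover have "z' \<noteq> 0" using that \<open>0 < inverse d\<close> by auto
      ultimately have "inverse (cmod z') < d" "z' \<noteq> 0" by simp_all
      then show ?thesis using d(2)[of "inverse z'"] by (simp add: norm_inverse)
    qed
    have "open {z'. inverse d < cmod z'}" by (intro open_Collect_less continuous_intros)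
    moreover have "cmod z = inverse d + 1" using d(1) unfolding z_def norm_of_real by (simp add: add_pos_pos)
    then have "z \<in> {z'. inverse d < cmod z'}" by simp
    ultimately have "z islimpt {z'. inverse d < cmod z'}" by (intro interior_limit_point) (simp add: interior_open)
    then have "z islimpt {w. F w = None}" by (rule islimpt_subset) (use N in auto)
    then show False using poles by blast
  qed
  then have "\<forall>\<^sub>F w in at 0. G w \<noteq> 0" by (simp add: frequently_def)
  with ev have "\<forall>\<^sub>F w in at 0. g (inverse w) = y0 + inverse (G w)" by eventually_elim (use rel in blast)
  moreover have "(\<lambda>w. y0 + inverse (G w)) meromorphic_on {0}" by (intro meromorphic_intros G)
  ultimately show ?thesis by (subst meromorphic_on_cong[of "{0}" _ "\<lambda>w. y0 + inverse (G w)"]) auto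
qed

text \<open>Off the poles g is analytic; at a pole its reciprocal extends by 0, which gives the
  chart at infinity.\<close>

lemma transcendental_meromorphic_hol_germ:
  assumes "g nicely_meromorphic_on UNIV" "\<And>z. f (Some z) = (if is_pole g z then None else Some (g z))"
  shows "hol_germ (\<lambda>z. f (Some z)) z"
proof -
  have mero: "g meromorphic_on {z}" using assms(1) meromorphic_on_subset unfolding nicely_meromorphic_on_def by blast
  have an: "g analytic_on {w}" if "\<not> is_pole g w" for w
    using nicely_meromorphic_on_imp_analytic_at[OF assms(1) _ that] by simp
  show ?thesis
  proof (cases "is_pole g z")
    case False
    then obtain e where e: "e > 0" "g holomorphic_on ball z e" using an analytic_at_ball by blast
    have "\<not> is_pole g w" if "w \<in> ball z e" for w
      using e that not_is_pole_holomorphic[OF open_ball] by blast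
    then show ?thesis using e assms(2) by (intro hol_germ_SomeI[of "ball z e" g]) auto
  next
    case True
    have "\<forall>\<^sub>F w in at z. \<not> is_pole g w"
      using mero eventually_not_pole by (simp add: meromorphic_at_iff)
    moreover have "\<forall>\<^sub>F w in at z. g w \<noteq> 0" using True non_zero_neighbour_pole by blast
    ultimately have "\<forall>\<^sub>F w in at z. \<not> is_pole g w \<and> g w \<noteq> 0" by eventually_elim auto
    then obtain e where e: "e > 0" "\<And>w. w \<noteq> z \<Longrightarrow> dist w z < e \<Longrightarrow> \<not> is_pole g w \<and> g w \<noteq> 0"
      unfolding eventually_at by blast
    define h where "h = (\<lambda>w. if w = z then 0 else inverse (g w))"
    have "(\<lambda>w. inverse (g w)) holomorphic_on ball z e - {z}"
    proof (intro holomorphic_intros analytic_imp_holomorphic)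
      show "g analytic_on ball z e - {z}"
        using an e by (subst analytic_on_analytic_at) (auto simp: dist_commute)
    qed (use e in \<open>auto simp: dist_commute\<close>)
    moreover have "(\<lambda>w. inverse (g w)) \<midarrow>z\<rightarrow> 0"
      using True unfolding is_pole_def by (rule tendsto_inverse_0[THEN filterlim_compose])
    ultimately have "h holomorphic_on ball z e" unfolding h_def by (intro removable_singularity) auto
    moreover have "f (Some w) = chart_infty (h w)" if "w \<in> ball z e" for w
      using e(2)[of w] that True assms(2) by (auto simp: h_def chart_infty_def dist_commute)
    ultimately show ?thesis using e by (intro hol_germ_chartI[of "ball z e" h]) auto
  qed
qed

lemma funpow_conj:
  assumes "\<And>x. A (A' x) = x"
  shows "((\<lambda>x. A' (f (A x))) ^^ n) (A' x) = A' ((f ^^ n) x)"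
  by (induction n arbitrary: x) (auto simp: assms)

text \<open>Conjugation by z to a + r z carries the unit circle to the given one and fixes infinity,
  so the \<open>picard\<close> property, obtained from the great Picard theorem, passes to the
  conjugate.\<close>

lemma transcendental_meromorphic_no_invariant_circle:
  assumes f: "transcendental_meromorphic f" and p: "p \<ge> 1" and r: "r > 0"
    and dom: "\<And>z. z \<in> sphere a r \<Longrightarrow> (\<forall>k<p. (f ^^ k) (Some z) \<noteq> None)"
    and inv: "(f ^^ p) ` Some ` sphere a r \<subseteq> Some ` sphere a r"
  shows False
proof -
  obtain g where g: "g nicely_meromorphic_on UNIV" "\<not> (\<lambda>w. g (inverse w)) meromorphic_on {0}"
    "\<And>z. f (Some z) = (if is_pole g z then None else Some (g z))"
    using f unfolding transcendental_meromorphic_def by blast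
  have germ: "hol_germ (\<lambda>z. f (Some z)) z" for z using transcendental_meromorphic_hol_germ[OF g(1,3)] .
  have iso: "isolated_singularity_at g z" for z
    using g(1) unfolding nicely_meromorphic_on_def by (simp add: meromorphic_on_altdef)
  have poles: "\<not> z islimpt {w. f (Some w) = None}" for z
  proof -
    have "\<forall>\<^sub>F w in at z. w \<notin> {w. f (Some w) = None}"
      using eventually_not_pole[OF iso[of z]] by eventually_elim (simp add: g(3))
    then show ?thesis by (simp add: islimpt_iff_eventually)
  qed
  have picard: "\<exists>z. L < cmod z \<and> f (Some z) \<in> Y" if Y: "finite Y" "3 \<le> card Y" for Y L
  proof (rule ccontr)
    assume "\<not> ?thesis"
    then have omit: "\<And>z. L < cmod z \<Longrightarrow> f (Some z) \<notin> Y" by blast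
    have "(\<lambda>w. g (inverse w)) meromorphic_on {0}"
      by (rule sphere_picard[of "\<lambda>z. f (Some z)", OF germ Y poles omit]) (auto simp: g(3) split: if_splits)
    then show False using g(2) by blast
  qed
  define A where "A = affine a (of_real r)"
  define A' where "A' = affine (- a / of_real r) (1 / of_real r)"
  have AA': "A (A' x) = x" "A' (A x) = x" for x using affine_inverse[of "of_real r" a x] r by (auto simp: A_def A'_def)
  define f1 where "f1 = (\<lambda>x. A' (f (A x)))"
  interpret transcendental_sphere_map f1
  proof
    fix z
    have "hol_germ (\<lambda>w. A (Some w)) z" using hol_at_affine[of "of_real r" a "Some z"] r by (simp add: A_def)
    moreover have "hol_at A' x" for x unfolding A'_def using r by (intro hol_at_affine) auto
    then have "hol_at (\<lambda>x. A' (f x)) (A (Some z))"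
      using germ by (simp add: A_def hol_germ_hol_at[OF germ])
    ultimately show "hol_germ (\<lambda>w. f1 (Some w)) z" unfolding f1_def by (rule hol_germ_hol_at)
  next
    fix Y :: "riemann_sphere set" and L :: real
    assume Y: "finite Y" "3 \<le> card Y"
    have "inj A" by (rule injI) (metis AA'(2))
    then have "3 \<le> card (A ` Y)" using Y by (simp add: card_image inj_on_subset)
    then obtain z where z: "cmod a + r * \<bar>L\<bar> < cmod z" "f (Some z) \<in> A ` Y" using picard[of "A ` Y"] Y by blast
    define w where "w = - a / of_real r + 1 / of_real r * z"
    have w: "A' (Some z) = Some w" by (simp add: A'_def w_def)
    then have "A (Some w) = Some z" using AA'(1) by metis
    then have "f1 (Some w) \<in> Y" using z(2) AA' by (auto simp: f1_def)
    moreover have "L < cmod w"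
    proof -
      have zw: "z = a + of_real r * w" using \<open>A (Some w) = Some z\<close> by (simp add: A_def)
      have "cmod z \<le> cmod a + r * cmod w" unfolding zw using norm_triangle_ineq[of a "of_real r * w"] r by (simp add: norm_mult)
      then have "r * \<bar>L\<bar> < r * cmod w" using z(1) by linarith
      then show ?thesis using r by simp
    qed
    ultimately show "\<exists>z. L < cmod z \<and> f1 (Some z) \<in> Y" by blast
  qed
  have pow: "(f1 ^^ n) (A' x) = A' ((f ^^ n) x)" for n x
    unfolding f1_def by (rule funpow_conj) (rule AA')
  have circ: "z \<in> \<Omega> p \<and> (\<exists>w. (f1 ^^ p) (Some z) = Some w \<and> cmod w = 1)" if z: "cmod z = 1" for z
  proof -
    define x where "x = a + of_real r * z"
    have x: "x \<in> sphere a r" using z r by (simp add: x_def dist_norm norm_mult)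
    have "Some z = A' (Some x)" using AA'(2)[of "Some z"] by (simp add: A_def x_def)
    then have fz: "(f1 ^^ n) (Some z) = A' ((f ^^ n) (Some x))" for n using pow by metis
    have "z \<in> \<Omega> p" using dom[OF x] by (auto simp: \<Omega>_def fz A'_def affine_def)
    moreover obtain y where y: "y \<in> sphere a r" "(f ^^ p) (Some x) = Some y" using inv x by blast
    have "(f1 ^^ p) (Some z) = Some ((y - a) / of_real r)" unfolding fz y by (simp add: A'_def diff_divide_distrib)
    moreover have "cmod ((y - a) / of_real r) = 1" using y(1) r by (simp add: dist_norm norm_divide norm_minus_commute)
    ultimately show ?thesis by blast
  qed
  show False using no_invariant_unit_circle[OF circ p] by blast
qed

section \<open>Counting preimages by winding numbers\<close>

definition locally_injective :: "(complex \<Rightarrow> riemann_sphere) \<Rightarrow> complex \<Rightarrow> bool" where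
  "locally_injective G z \<longleftrightarrow> (\<exists>e>0. inj_on G (ball z e))"

text \<open>G followed by the Moebius map v to 1 / (v - w0), which makes the value infinity harmless
  and turns the fibre of w0 into poles. On that fibre division by zero yields 0, so holomorphy is
  claimed only off it.\<close>

definition pole_at :: "complex \<Rightarrow> (complex \<Rightarrow> riemann_sphere) \<Rightarrow> complex \<Rightarrow> complex" where
  "pole_at w0 G z = (case G z of None \<Rightarrow> 0 | Some v \<Rightarrow> 1 / (v - w0))"

lemma pole_at_simps:
  "G z = None \<Longrightarrow> pole_at w0 G z = 0" "G z = Some v \<Longrightarrow> pole_at w0 G z = 1 / (v - w0)"
  by (auto simp: pole_at_def)

lemma pole_at_holomorphic:
  assumes "\<And>z. hol_germ G z" "closed {z. G z = Some w0}"
  shows "pole_at w0 G holomorphic_on {z. G z \<noteq> Some w0}"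
proof -
  define T where "T = (\<lambda>x. sphere_inv (affine (- w0) 1 x))"
  have T: "hol_at T x" for x
    unfolding T_def by (rule hol_at_compose[OF hol_at_affine hol_at_sphere_inv]) simp
  have TG: "T (G z) = Some (pole_at w0 G z)" if "G z \<noteq> Some w0" for z
    using that by (cases "G z") (auto simp: T_def pole_at_def chart_infty_def inverse_eq_divide)
  have "(\<lambda>z. the (T (G z))) holomorphic_on {z. G z \<noteq> Some w0}"
  proof (rule hol_germ_holomorphic)
    show "open {z. G z \<noteq> Some w0}" using assms(2) by (simp add: Collect_neg_eq open_Compl)
    show "hol_germ (\<lambda>z. T (G z)) z \<and> T (G z) \<noteq> None" if "z \<in> {z. G z \<noteq> Some w0}" for z
      using hol_germ_hol_at[OF assms(1) T] TG that by auto
  qed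
  then show ?thesis using TG by (subst (asm) holomorphic_cong[OF refl, of _ _ "pole_at w0 G"]) auto
qed

text \<open>An injective holomorphic function has a nonvanishing derivative, so v is taken with
  multiplicity one.\<close>

lemma locally_injective_factor:
  assumes "hol_germ G z" "locally_injective G z" "G z = Some v"
  obtains e g where "e > 0" "g holomorphic_on ball z e" "\<And>x. x \<in> ball z e \<Longrightarrow> g x \<noteq> 0"
    "\<And>x. x \<in> ball z e \<Longrightarrow> G x = Some (v + (x - z) * g x)"
proof -
  obtain e1 h where h: "e1 > 0" "h holomorphic_on ball z e1" "\<And>w. w \<in> ball z e1 \<Longrightarrow> G w = Some (h w)" "h z = v"
    using hol_germ_finiteE[OF assms(1,3)] by blast
  obtain e2 where e2: "e2 > 0" "inj_on G (ball z e2)" using assms(2) by (auto simp: locally_injective_def)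
  define e where "e = min e1 e2"
  have e: "e > 0" "e \<le> e1" "e \<le> e2" using h e2 by (auto simp: e_def)
  have hol: "h holomorphic_on ball z e" using h(2) by (rule holomorphic_on_subset) (use e in auto)
  have "inj_on h (ball z e)"
  proof (rule inj_onI)
    fix x y assume "x \<in> ball z e" "y \<in> ball z e" "h x = h y"
    then have "G x = G y" "x \<in> ball z e2" "y \<in> ball z e2" using h(3) e by auto
    then show "x = y" using e2(2) by (auto dest: inj_onD)
  qed
  then have dh: "deriv h z \<noteq> 0" using e by (intro holomorphic_injective_imp_regular[OF hol]) auto
  obtain g r where g: "0 < r" "g holomorphic_on ball z r"
    "\<And>w. w \<in> ball z r \<Longrightarrow> h w - h z = (w - z) ^ 1 * g w" "\<And>w. w \<in> ball z r \<Longrightarrow> g w \<noteq> 0"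
  proof (rule holomorphic_factor_order_of_zero[OF hol open_ball, of z 1])
    show "(deriv ^^ 1) h z \<noteq> 0" using dh by simp
  qed (use e that in auto)
  show ?thesis
  proof (rule that[of "min r e" g])
    show "g holomorphic_on ball z (min r e)" using g(2) by (rule holomorphic_on_subset) auto
    fix x assume x: "x \<in> ball z (min r e)"
    then show "g x \<noteq> 0" using g by auto
    have "G x = Some (h x)" using x h(3) e by auto
    moreover have "h x = v + (x - z) * g x" using g(3)[of x] x h(4) by (auto simp: algebra_simps)
    ultimately show "G x = Some (v + (x - z) * g x)" by simp
  qed (use g e in auto)
qed

text \<open>The argument principle for 1 / (G - w0) - 1 / (w - w0): zeros are the fibre of w and
  poles the fibre of w0, all simple by local injectivity. Two fibres are compared because G - w
  itself would have the poles of G counted as well.\<close>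

lemma count_difference_winding_number:
  assumes germ: "\<And>z. hol_germ G z"
    and fin: "finite {z. G z = Some w}" "finite {z. G z = Some w0}"
    and li: "\<And>z. G z = Some w \<Longrightarrow> locally_injective G z" "\<And>z. G z = Some w0 \<Longrightarrow> locally_injective G z"
    and ww: "w \<noteq> w0" and R: "R > 0"
    and avoid: "\<And>z. z \<in> sphere a R \<Longrightarrow> G z \<noteq> Some w \<and> G z \<noteq> Some w0"
  shows "of_nat (card {z \<in> ball a R. G z = Some w}) - of_nat (card {z \<in> ball a R. G z = Some w0})
    = winding_number (pole_at w0 G \<circ> circlepath a R) (1 / (w - w0))"
proof -
  define c where "c = 1 / (w - w0)"
  define \<kappa> where "\<kappa> = pole_at w0 G"
  define f where "f = (\<lambda>z. \<kappa> z - c)"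
  define poles where "poles = {z. G z = Some w0}"
  define \<gamma> where "\<gamma> = circlepath a R"
  have pi\<gamma>: "path_image \<gamma> = sphere a R" using R by (simp add: \<gamma>_def)
  have hol\<kappa>: "\<kappa> holomorphic_on {z. G z \<noteq> Some w0}"
    unfolding \<kappa>_def by (rule pole_at_holomorphic[OF germ finite_imp_closed[OF fin(2)]])
  have opn: "open {z. G z \<noteq> Some w0}" using finite_imp_closed[OF fin(2)] by (simp add: Collect_neg_eq open_Compl)
  have c0: "c \<noteq> 0" using ww by (simp add: c_def)
  have zero: "f z = 0 \<longleftrightarrow> G z = Some w" for z
  proof (cases "G z")
    case None
    then show ?thesis using c0 by (simp add: f_def \<kappa>_def pole_at_simps)
  next
    case (Some v)
    then show ?thesis using ww by (auto simp: f_def \<kappa>_def pole_at_simps c_def frac_eq_eq)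
  qed
  have zord_w: "zorder f z = 1" if z: "G z = Some w" for z
  proof -
    obtain e g where g: "e > 0" "g holomorphic_on ball z e" "\<And>x. x \<in> ball z e \<Longrightarrow> g x \<noteq> 0"
      "\<And>x. x \<in> ball z e \<Longrightarrow> G x = Some (w + (x - z) * g x)"
      by (rule locally_injective_factor[OF germ li(1)[OF z] z]) (rule that)
    define k where "k = (\<lambda>x. w + (x - z) * g x - w0)"
    have "k holomorphic_on ball z e" unfolding k_def by (intro holomorphic_intros g)
    moreover have "k z \<noteq> 0" using ww by (simp add: k_def)
    ultimately obtain d where d: "0 < d" "d \<le> e" "\<And>x. x \<in> ball z d \<Longrightarrow> k x \<noteq> 0"
      using holomorphic_nonzero_ball g(1) by blast
    have sub: "ball z d \<subseteq> ball z e" using d by auto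
    show ?thesis
    proof (rule zorder_eqI[of "ball z d" z "\<lambda>x. - g x / (k x * (w - w0))"])
      show "(\<lambda>x. - g x / (k x * (w - w0))) holomorphic_on ball z d"
        using sub d ww \<open>k holomorphic_on ball z e\<close> g(2)
        by (auto intro!: holomorphic_intros intro: holomorphic_on_subset)
      show "- g z / (k z * (w - w0)) \<noteq> 0" using g(1,3) d ww by auto
      fix x assume x: "x \<in> ball z d" "x \<noteq> z"
      have "f x = 1 / k x - 1 / (w - w0)" using g(4)[of x] x sub by (auto simp: f_def \<kappa>_def pole_at_simps c_def k_def)
      also have "\<dots> = ((w - w0) - k x) / (k x * (w - w0))" using d(3)[OF x(1)] ww by (simp add: diff_frac_eq)
      also have "(w - w0) - k x = - g x * (x - z)" by (simp add: k_def algebra_simps)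
      finally show "f x = - g x / (k x * (w - w0)) * (x - z) powi 1" by simp
    qed (use d in auto)
  qed
  have zord_p: "zorder f z = -1 \<and> is_pole f z" if z: "G z = Some w0" for z
  proof -
    obtain e g where g: "e > 0" "g holomorphic_on ball z e" "\<And>x. x \<in> ball z e \<Longrightarrow> g x \<noteq> 0"
      "\<And>x. x \<in> ball z e \<Longrightarrow> G x = Some (w0 + (x - z) * g x)"
      by (rule locally_injective_factor[OF germ li(2)[OF z] z]) (rule that)
    define k where "k = (\<lambda>x. (1 - c * (x - z) * g x) / g x)"
    have k: "k holomorphic_on ball z e" unfolding k_def by (intro holomorphic_intros g) (use g in auto)
    have kz: "k z \<noteq> 0" using g(1,3) by (simp add: k_def)
    have fk: "f x = k x * (x - z) powi (-1)" if x: "x \<in> ball z e" "x \<noteq> z" for x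
    proof -
      have "f x = 1 / ((x - z) * g x) - c" using g(4)[OF x(1)] by (simp add: f_def \<kappa>_def pole_at_simps)
      also have "\<dots> = k x / (x - z)" using g(3)[OF x(1)] x(2) by (simp add: k_def field_simps)
      finally show ?thesis by (simp add: power_int_minus divide_inverse)
    qed
    have 1: "zorder f z = -1" by (rule zorder_eqI[of "ball z e" z k]) (use g k kz fk in auto)
    have "is_pole (\<lambda>x. k x / (x - z)) z"
      using is_pole_basic[OF k open_ball _ kz, of 1] g(1) by simp
    moreover have "\<forall>\<^sub>F x in at z. k x / (x - z) = f x"
    proof -
      have "\<forall>\<^sub>F x in at z. x \<in> ball z e - {z}" using g(1) by (intro eventually_at_in_open) auto
      then show ?thesis by eventually_elim (use fk in \<open>auto simp: power_int_minus divide_inverse\<close>)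
    qed
    ultimately have "is_pole f z" by (rule is_pole_transform) simp
    then show ?thesis using 1 by simp
  qed
  have pz: "{x \<in> UNIV. f x = 0 \<or> x \<in> poles} = {z. G z = Some w} \<union> {z. G z = Some w0}"
    using zero by (auto simp: poles_def)
  have holf: "f holomorphic_on {z. G z \<noteq> Some w0}" unfolding f_def by (intro holomorphic_intros hol\<kappa>)
  have sub: "sphere a R \<subseteq> {z. G z \<noteq> Some w0}" using avoid by blast
  have an: "\<kappa> analytic_on {z. G z \<noteq> Some w0}" using hol\<kappa> opn by (simp add: analytic_on_open)
  have v\<kappa>: "valid_path (\<kappa> \<circ> \<gamma>)"
    by (rule valid_path_compose_holomorphic[OF _ hol\<kappa> opn]) (use sub pi\<gamma> in \<open>auto simp: \<gamma>_def\<close>)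
  have notin: "c \<notin> path_image (\<kappa> \<circ> \<gamma>)"
  proof
    assume "c \<in> path_image (\<kappa> \<circ> \<gamma>)"
    then obtain x where x: "x \<in> sphere a R" "\<kappa> x = c" unfolding path_image_compose pi\<gamma> by blast
    then have "f x = 0" by (simp add: f_def)
    then show False using zero avoid x(1) by blast
  qed
  have "winding_number (\<kappa> \<circ> \<gamma>) c = 1 / (2 * pi * \<i>) * contour_integral (\<kappa> \<circ> \<gamma>) (\<lambda>x. 1 / (x - c))"
    by (rule winding_number_valid_path[OF v\<kappa> notin])
  also have "contour_integral (\<kappa> \<circ> \<gamma>) (\<lambda>x. 1 / (x - c)) = contour_integral \<gamma> (\<lambda>x. deriv \<kappa> x * (1 / (\<kappa> x - c)))"
    by (rule contour_integral_comp_analyticW[OF an]) (use sub pi\<gamma> in \<open>auto simp: \<gamma>_def\<close>)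
  also have "\<dots> = contour_integral \<gamma> (\<lambda>x. deriv f x * 1 / f x)"
  proof (rule contour_integral_cong[OF refl])
    fix x assume "x \<in> path_image \<gamma>"
    then have "x \<in> {z. G z \<noteq> Some w0}" using sub pi\<gamma> by auto
    then have "\<kappa> field_differentiable at x" using hol\<kappa> opn holomorphic_on_imp_differentiable_at by blast
    then have "deriv f x = deriv \<kappa> x" unfolding f_def by simp
    then show "deriv \<kappa> x * (1 / (\<kappa> x - c)) = deriv f x * 1 / f x" by (simp add: f_def)
  qed
  also have "\<dots> = 2 * pi * \<i> * (\<Sum>p\<in>{x \<in> UNIV. f x = 0 \<or> x \<in> poles}. winding_number \<gamma> p * 1 * zorder f p)"
  proof (rule argument_principle)
    show "f holomorphic_on UNIV - poles" using holf by (simp add: poles_def Collect_neg_eq Compl_eq_Diff_UNIV)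
    show "path_image \<gamma> \<subseteq> UNIV - {x \<in> UNIV. f x = 0 \<or> x \<in> poles}" unfolding pz pi\<gamma> using avoid by blast
    show "finite {x \<in> UNIV. f x = 0 \<or> x \<in> poles}" unfolding pz using fin by blast
    show "\<forall>p\<in>UNIV \<inter> poles. is_pole f p" using zord_p by (simp add: poles_def)
  qed (auto simp: \<gamma>_def)
  also have "(\<Sum>p\<in>{x \<in> UNIV. f x = 0 \<or> x \<in> poles}. winding_number \<gamma> p * 1 * zorder f p)
    = (\<Sum>p | G p = Some w. winding_number \<gamma> p * zorder f p) + (\<Sum>p | G p = Some w0. winding_number \<gamma> p * zorder f p)"
    unfolding pz using fin ww by (subst sum.union_disjoint) auto
  also have "(\<Sum>p | G p = Some w. winding_number \<gamma> p * zorder f p) = (\<Sum>p | G p = Some w. if p \<in> ball a R then 1 else 0)"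
  proof (rule sum.cong[OF refl])
    fix p assume p: "p \<in> {p. G p = Some w}"
    show "winding_number \<gamma> p * zorder f p = (if p \<in> ball a R then 1 else 0)"
    proof (cases "p \<in> ball a R")
      case True
      then show ?thesis using zord_w p by (simp add: \<gamma>_def winding_number_circlepath dist_norm norm_minus_commute)
    next
      case False
      then have "p \<notin> cball a R" using avoid[of p] p by (auto simp: less_le)
      then have "winding_number \<gamma> p = 0"
        using R by (intro winding_number_zero_outside[of _ "cball a R"]) (auto simp: \<gamma>_def)
      then show ?thesis using False by simp
    qed
  qed
  also have "\<dots> = of_nat (card {z \<in> ball a R. G z = Some w})"
    using fin(1) by (simp add: sum.If_cases Int_def conj_commute)
  also have "(\<Sum>p | G p = Some w0. winding_number \<gamma> p * zorder f p) = (\<Sum>p | G p = Some w0. if p \<in> ball a R then -1 else 0)"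
  proof (rule sum.cong[OF refl])
    fix p assume p: "p \<in> {p. G p = Some w0}"
    show "winding_number \<gamma> p * zorder f p = (if p \<in> ball a R then -1 else 0)"
    proof (cases "p \<in> ball a R")
      case True
      then show ?thesis using zord_p p by (simp add: \<gamma>_def winding_number_circlepath dist_norm norm_minus_commute)
    next
      case False
      then have "p \<notin> cball a R" using avoid[of p] p by (auto simp: less_le)
      then have "winding_number \<gamma> p = 0"
        using R by (intro winding_number_zero_outside[of _ "cball a R"]) (auto simp: \<gamma>_def)
      then show ?thesis using False by simp
    qed
  qed
  also have "\<dots> = - of_nat (card {z \<in> ball a R. G z = Some w0})"
    using fin(2) by (simp add: sum.If_cases Int_def conj_commute)
  finally have "winding_number (\<kappa> \<circ> \<gamma>) c =
    of_nat (card {z \<in> ball a R. G z = Some w}) - of_nat (card {z \<in> ball a R. G z = Some w0})" by (simp add: o_def)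
  then show ?thesis unfolding \<kappa>_def \<gamma>_def c_def by (rule sym)
qed

lemma connected_delete_point:
  fixes K :: "complex set"
  assumes "open K" "connected K"
  shows "connected (K - {x})"
  using connected_open_diff_countable[of K "{x}"] assms by simp

text \<open>\<open>Bd\<close> collects the values whose fibres may be infinite or critical. The base
  value \<open>w0\<close>, off the image of the circle, is the one to be sent to infinity.\<close>

locale injective_on_circle =
  fixes G :: "complex \<Rightarrow> riemann_sphere" and a :: complex and R :: real and Bd :: "complex set" and w0 :: complex
  assumes germ: "\<And>z. hol_germ G z" and R: "R > 0" and inj: "inj_on G (sphere a R)"
    and fin: "\<And>w. w \<notin> Bd \<Longrightarrow> finite {z. G z = Some w}"
    and li: "\<And>w z. w \<notin> Bd \<Longrightarrow> G z = Some w \<Longrightarrow> locally_injective G z"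
    and w0: "w0 \<notin> Bd" "Some w0 \<notin> G ` sphere a R"
begin

definition \<Gamma> :: "complex set" where
  "\<Gamma> = {w. Some w \<in> G ` sphere a R}"

text \<open>Moving \<open>w0\<close> to infinity makes this a bounded Jordan curve even if the image
  of the circle passes through infinity.\<close>

definition curve :: "real \<Rightarrow> complex" where
  "curve = pole_at w0 G \<circ> circlepath a R"

text \<open>The side of \<open>\<Gamma>\<close> away from \<open>w0\<close>; sending \<open>w0\<close> to infinity turns it into the inside of a Jordan curve.\<close>

definition E :: "complex set" where
  "E = {w. w \<noteq> w0 \<and> 1 / (w - w0) \<in> inside (path_image curve)}"

lemma on_circle: "z \<in> sphere a R \<Longrightarrow> w \<notin> \<Gamma> \<Longrightarrow> G z \<noteq> Some w" "z \<in> sphere a R \<Longrightarrow> G z \<noteq> Some w0"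
  unfolding \<Gamma>_def using w0(2) by (metis (mono_tags) imageI mem_Collect_eq)+

lemma path_image_curve: "path_image curve = pole_at w0 G ` sphere a R"
  using R by (simp add: curve_def path_image_compose)

lemma pole_at_continuous: "continuous_on (sphere a R) (pole_at w0 G)"
  by (rule holomorphic_on_imp_continuous_on
      [OF holomorphic_on_subset[OF pole_at_holomorphic[OF germ finite_imp_closed[OF fin[OF w0(1)]]]]])
    (use w0(2) in \<open>auto simp: image_iff\<close>)

lemma pole_at_inj: "inj_on (pole_at w0 G) (sphere a R)"
proof (rule inj_onI)
  fix x y assume xy: "x \<in> sphere a R" "y \<in> sphere a R" "pole_at w0 G x = pole_at w0 G y"
  have "G x \<noteq> Some w0" "G y \<noteq> Some w0" using xy on_circle(2) by blast+
  then have "G x = G y" using xy(3)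
    by (cases "G x"; cases "G y") (auto simp: pole_at_def field_simps)
  then show "x = y" using inj xy by (auto dest: inj_onD)
qed

lemma simple_curve: "simple_path curve" "pathfinish curve = pathstart curve"
proof -
  show "simple_path curve"
    unfolding curve_def
    by (rule simple_path_continuous_image) (use R pole_at_continuous pole_at_inj in \<open>auto simp: simple_path_circlepath\<close>)
  show "pathfinish curve = pathstart curve"
    by (simp add: curve_def pathfinish_compose pathstart_compose)
qed

lemma bounded_curve: "bounded (path_image curve)" and closed_curve: "closed (path_image curve)"
  using simple_curve by (auto simp: bounded_simple_path_image closed_simple_path_image)

lemma on_curve_iff:
  assumes "w \<noteq> w0"
  shows "1 / (w - w0) \<in> path_image curve \<longleftrightarrow> w \<in> \<Gamma>"
proof -
  have "1 / (w - w0) = pole_at w0 G z \<longleftrightarrow> G z = Some w" if "z \<in> sphere a R" for z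
  proof -
    have "G z \<noteq> Some w0" using that on_circle(2) by blast
    then show ?thesis using assms by (cases "G z") (auto simp: pole_at_def field_simps)
  qed
  then show ?thesis unfolding path_image_curve \<Gamma>_def image_iff mem_Collect_eq by metis
qed

lemma w0_notin: "w0 \<notin> E" "w0 \<notin> \<Gamma>"
  using w0 by (auto simp: E_def \<Gamma>_def)

lemma E_disjoint: "E \<inter> \<Gamma> = {}"
  unfolding E_def using on_curve_iff inside_no_overlap[of "path_image curve"] by blast

lemma open_E: "open E"
proof -
  have "open ((- {w0}) \<inter> (\<lambda>w. 1 / (w - w0)) -` inside (path_image curve))"
    using open_inside[OF closed_curve]
    by (intro continuous_open_preimage) (auto intro!: continuous_intros)
  moreover have "E = (- {w0}) \<inter> (\<lambda>w. 1 / (w - w0)) -` inside (path_image curve)" by (auto simp: E_def)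
  ultimately show ?thesis by simp
qed

text \<open>The complement is \<open>w0\<close> together with the preimage of the outside. It is
  open at \<open>w0\<close> because the curve and its inside are bounded, whereas points near
  \<open>w0\<close> have large images.\<close>

lemma closed_E_Un: "closed (E \<union> \<Gamma>)"
proof -
  have eq: "- (E \<union> \<Gamma>) = {w0} \<union> ((- {w0}) \<inter> (\<lambda>w. 1 / (w - w0)) -` outside (path_image curve))" (is "_ = {w0} \<union> ?V")
  proof (rule set_eqI)
    fix w show "w \<in> - (E \<union> \<Gamma>) \<longleftrightarrow> w \<in> {w0} \<union> ?V"
    proof (cases "w = w0")
      case False
      then have "1 / (w - w0) \<in> outside (path_image curve) \<longleftrightarrow> \<not> (1 / (w - w0) \<in> inside (path_image curve) \<or> w \<in> \<Gamma>)"
        using on_curve_iff inside_Un_outside[of "path_image curve"] inside_Int_outside[of "path_image curve"]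
          outside_no_overlap[of "path_image curve"] by blast
      then show ?thesis using False by (auto simp: E_def)
    qed (use w0_notin in auto)
  qed
  have "open ?V"
    using open_outside[OF closed_curve]
    by (intro continuous_open_preimage) (auto intro!: continuous_intros)
  obtain M where M: "M > 0" "- outside (path_image curve) \<subseteq> ball 0 M"
    using cobounded_outside[OF bounded_curve] bounded_subset_ballD by blast
  have "ball w0 (1 / M) \<subseteq> {w0} \<union> ?V"
  proof
    fix w assume w: "w \<in> ball w0 (1 / M)"
    show "w \<in> {w0} \<union> ?V"
    proof (cases "w = w0")
      case False
      then have "M < cmod (1 / (w - w0))" using w M(1)
        by (simp add: dist_norm norm_minus_commute norm_divide field_simps)
      then have "1 / (w - w0) \<notin> ball 0 M" by simp
      then show ?thesis using M(2) False by blast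
    qed simp
  qed
  then have "{w0} \<union> ?V = ball w0 (1 / M) \<union> ?V" using M(1) by auto
  then have "open (- (E \<union> \<Gamma>))" unfolding eq using \<open>open ?V\<close> by (metis open_Un open_ball)
  then show ?thesis by (simp add: closed_open)
qed

lemma connected_side:
  assumes "connected L" "L \<inter> \<Gamma> = {}" "w0 \<notin> L"
  shows "L \<subseteq> E \<or> L \<inter> E = {}"
proof -
  define L' where "L' = (\<lambda>w. 1 / (w - w0)) ` L"
  have con: "connected L'" unfolding L'_def
    using assms by (intro connected_continuous_image continuous_intros) auto
  have "x \<notin> path_image curve" if x: "x \<in> L'" for x
  proof -
    obtain w where "w \<in> L" "x = 1 / (w - w0)" using x unfolding L'_def by blast
    moreover have "w \<noteq> w0" "w \<notin> \<Gamma>" using \<open>w \<in> L\<close> assms by auto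
    ultimately show ?thesis using on_curve_iff by simp
  qed
  then have sub: "L' \<subseteq> inside (path_image curve) \<union> outside (path_image curve)"
    unfolding inside_Un_outside by blast
  have dis: "inside (path_image curve) \<inter> outside (path_image curve) \<inter> L' = {}"
    unfolding inside_Int_outside by (rule Int_empty_left)
  have "inside (path_image curve) \<inter> L' = {} \<or> outside (path_image curve) \<inter> L' = {}"
    by (rule connectedD[OF con open_inside[OF closed_curve] open_outside[OF closed_curve] dis sub])
  then show ?thesis
  proof
    assume "inside (path_image curve) \<inter> L' = {}"
    then have "L \<inter> E = {}" unfolding E_def L'_def by blast
    then show ?thesis ..
  next
    assume "outside (path_image curve) \<inter> L' = {}"
    then have "L' \<subseteq> inside (path_image curve)"
      using sub by blast
    then have "L \<subseteq> E" using assms(3) unfolding E_def L'_def by blast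
    then show ?thesis ..
  qed
qed

text \<open>Points of K close to \<open>w0\<close> have large images, which lie outside the curve;
  deleting \<open>w0\<close> leaves K connected, so the rest follows them.\<close>

lemma base_side_disjoint:
  assumes K: "open K" "connected K" "w0 \<in> K" "K \<inter> \<Gamma> = {}"
  shows "K \<inter> E = {}"
proof -
  have "K - {w0} \<subseteq> E \<or> (K - {w0}) \<inter> E = {}"
    using K by (intro connected_side connected_delete_point) auto
  moreover have "\<not> K - {w0} \<subseteq> E"
  proof
    assume sub: "K - {w0} \<subseteq> E"
    obtain e where e: "e > 0" "ball w0 e \<subseteq> K" using K openE by blast
    obtain M where M: "M > 0" "inside (path_image curve) \<subseteq> ball 0 M"
      using bounded_inside[OF bounded_curve] bounded_subset_ballD by blast
    define s where "s = min e (1 / M) / 2"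
    have s: "s > 0" "s < e" "s < 1 / M" using e(1) M(1) by (auto simp: s_def min_def field_simps)
    then have "w0 + of_real s \<in> K - {w0}" using e(2) by (auto simp: dist_norm)
    then have "1 / of_real s \<in> inside (path_image curve)" using sub by (auto simp: E_def)
    then have "cmod (1 / of_real s) < M" using M(2) by auto
    then show False using s M(1) by (simp add: norm_divide field_simps)
  qed
  ultimately show ?thesis using w0_notin by blast
qed

text \<open>Identifies the side when the two complementary domains are known, as for an invariant
  circle.\<close>

lemma E_eq_side:
  assumes K: "open K" "connected K" "w0 \<in> K" "K \<inter> \<Gamma> = {}"
    and L: "connected L" "L \<inter> \<Gamma> = {}" "K \<inter> L = {}" "K \<union> L \<union> \<Gamma> = UNIV"
  shows "E = L"
proof -
  have "K \<inter> E = {}" by (rule base_side_disjoint[OF K])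
  then have EL: "E \<subseteq> L" using L(4) E_disjoint by blast
  have J: "inside (path_image curve) \<noteq> {}" "open (inside (path_image curve))"
    using Jordan_inside_outside[OF simple_curve] by auto
  then obtain u where u: "u \<in> inside (path_image curve)" "u \<noteq> 0"
    by (metis all_not_in_conv not_open_singleton singletonI subsetI subset_singletonD)
  then have "w0 + 1 / u \<in> E" by (simp add: E_def)
  then have "L \<inter> E \<noteq> {}" using EL by blast
  moreover have "w0 \<notin> L" using K L by blast
  ultimately have "L \<subseteq> E" using connected_side[OF L(1,2)] by blast
  with EL show ?thesis by blast
qed

definition count :: "complex set \<Rightarrow> complex \<Rightarrow> nat" where
  "count S w = card {z \<in> S. G z = Some w}"

text \<open>The winding number of a Jordan curve is one fixed sign on its inside and 0 on its
  outside.\<close>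

lemma count_ball:
  obtains \<epsilon> :: int where "\<epsilon> = 1 \<or> \<epsilon> = -1"
    "\<And>w. w \<notin> Bd \<Longrightarrow> w \<notin> \<Gamma> \<Longrightarrow> int (count (ball a R) w) = int (count (ball a R) w0) + (if w \<in> E then \<epsilon> else 0)"
proof -
  have diff: "of_nat (count (ball a R) w) - of_nat (count (ball a R) w0) = winding_number curve (1 / (w - w0))"
    if "w \<notin> Bd" "w \<notin> \<Gamma>" "w \<noteq> w0" for w
    unfolding count_def curve_def
  proof (rule count_difference_winding_number[OF germ fin fin li li \<open>w \<noteq> w0\<close> R])
    show "G z \<noteq> Some w \<and> G z \<noteq> Some w0" if "z \<in> sphere a R" for z
      using on_circle that \<open>w \<notin> \<Gamma>\<close> by blast
  qed (use that w0 in auto)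
  have out: "winding_number curve (1 / (w - w0)) = 0" if "w \<notin> \<Gamma>" "w \<noteq> w0" "w \<notin> E" for w
  proof (rule winding_number_zero_in_outside)
    show "path curve" using simple_curve by (simp add: simple_path_imp_path)
    have "1 / (w - w0) \<notin> path_image curve" "1 / (w - w0) \<notin> inside (path_image curve)"
      using that on_curve_iff by (auto simp: E_def)
    then show "1 / (w - w0) \<in> outside (path_image curve)"
      using inside_Un_outside[of "path_image curve"] by blast
  qed (use simple_curve in auto)
  have "\<exists>\<epsilon>::int. (\<epsilon> = 1 \<or> \<epsilon> = -1) \<and> (\<forall>u\<in>inside (path_image curve). winding_number curve u = of_int \<epsilon>)"
    by (rule simple_closed_path_winding_number_inside[OF simple_curve(1)]) (auto intro: exI[of _ "1::int"] exI[of _ "-1::int"])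
  then obtain \<epsilon> :: int where \<epsilon>: "\<epsilon> = 1 \<or> \<epsilon> = -1" "\<And>u. u \<in> inside (path_image curve) \<Longrightarrow> winding_number curve u = of_int \<epsilon>"
    by blast
  have "int (count (ball a R) w) = int (count (ball a R) w0) + (if w \<in> E then \<epsilon> else 0)"
    if w: "w \<notin> Bd" "w \<notin> \<Gamma>" for w
  proof (cases "w = w0")
    case True
    then show ?thesis using w0_notin by simp
  next
    case False
    have "complex_of_int (int (count (ball a R) w) - int (count (ball a R) w0)) = of_int (if w \<in> E then \<epsilon> else 0)"
      using diff[OF w False] out[OF w(2) False] \<epsilon>(2) by (auto simp: E_def)
    then show ?thesis by (simp only: of_int_eq_iff)
  qed
  with \<epsilon>(1) show ?thesis using that by blast
qed

end

section \<open>Rational maps\<close>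

lemma hol_germ_quotient:
  assumes "open S" "z \<in> S" "p holomorphic_on S" "q holomorphic_on S" "p z \<noteq> 0 \<or> q z \<noteq> 0"
    and F: "\<And>w. w \<in> S \<Longrightarrow> p w \<noteq> 0 \<or> q w \<noteq> 0 \<Longrightarrow> F w = (if q w = 0 then None else Some (p w / q w))"
  shows "hol_germ F z"
proof -
  have cont: "continuous_on S p" "continuous_on S q"
    using assms holomorphic_on_imp_continuous_on by auto
  show ?thesis
  proof (cases "q z = 0")
    case False
    define T where "T = S \<inter> q -` (- {0})"
    have "open T" unfolding T_def using assms cont by (intro continuous_open_preimage) auto
    moreover have "(\<lambda>w. p w / q w) holomorphic_on T"
      using assms by (auto simp: T_def intro!: holomorphic_intros intro: holomorphic_on_subset)
    moreover have "F w = Some (p w / q w)" if "w \<in> T" for w using that F by (auto simp: T_def)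
    ultimately show ?thesis using False assms(2) by (intro hol_germ_SomeI[of T "\<lambda>w. p w / q w"]) (auto simp: T_def)
  next
    case True
    then have "p z \<noteq> 0" using assms by simp
    define T where "T = S \<inter> p -` (- {0})"
    have "open T" unfolding T_def using assms cont by (intro continuous_open_preimage) auto
    moreover have "(\<lambda>w. q w / p w) holomorphic_on T"
      using assms by (auto simp: T_def intro!: holomorphic_intros intro: holomorphic_on_subset)
    moreover have "F w = chart_infty (q w / p w)" if "w \<in> T" for w
      using that F by (auto simp: T_def chart_infty_def field_simps)
    ultimately show ?thesis using \<open>p z \<noteq> 0\<close> assms(2) by (intro hol_germ_chartI[of T "\<lambda>w. q w / p w"]) (auto simp: T_def)
  qed
qed

lemma coprime_poly_no_common_root:
  fixes P Q :: "complex poly"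
  assumes "coprime P Q"
  shows "poly P z \<noteq> 0 \<or> poly Q z \<noteq> 0"
proof (rule ccontr)
  assume "\<not> ?thesis"
  then have "[:- z, 1:] dvd P" "[:- z, 1:] dvd Q" by (auto simp: poly_eq_0_iff_dvd)
  then have "[:- z, 1:] dvd 1" using assms by (meson coprime_common_divisor)
  then show False by (simp add: is_unit_iff_degree)
qed

lemma rational_map_hol_at:
  assumes "rational_map d f"
  shows "hol_at f x"
proof -
  obtain P Q :: "complex poly" where PQ: "Q \<noteq> 0" "coprime P Q" "d = max (degree P) (degree Q)"
    "\<And>z. f (Some z) = (if poly Q z = 0 then None else Some (poly P z / poly Q z))"
    "f None = (if degree P > degree Q then None else Some (coeff P (degree Q) / lead_coeff Q))"
    using assms unfolding rational_map_def by blast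
  show ?thesis
  proof (cases x)
    case (Some z)
    have "hol_germ (\<lambda>w. f (Some w)) z"
      by (rule hol_germ_quotient[of UNIV z "poly P" "poly Q"])
        (use coprime_poly_no_common_root[OF PQ(2)] PQ(4) in \<open>auto intro!: holomorphic_intros\<close>)
    then show ?thesis by (simp add: Some)
  next
    case None
    \<comment> \<open>Away from 0, p and q are w ^ d P(1 / w) and w ^ d Q(1 / w). The extra powers
      bring the reversed polynomials to the common degree d.\<close>
    define p where "p = (\<lambda>w. w ^ (d - degree P) * poly (reflect_poly P) w)"
    define q where "q = (\<lambda>w. w ^ (d - degree Q) * poly (reflect_poly Q) w)"
    have pw: "p w = w ^ d * poly P (inverse w)" "q w = w ^ d * poly Q (inverse w)" if "w \<noteq> 0" for w
      using that PQ(3) by (simp_all add: p_def q_def poly_reflect_poly_nz flip: power_add mult.assoc)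
    have p0: "p 0 = (if degree P = d then lead_coeff P else 0)"
      using PQ(3) by (auto simp: p_def power_0_left)
    have q0: "q 0 = (if degree Q = d then lead_coeff Q else 0)"
      using PQ(3) by (auto simp: q_def power_0_left)
    have "hol_germ (\<lambda>w. f (chart_infty w)) 0"
    proof (rule hol_germ_quotient[of UNIV 0 p q])
      show "p 0 \<noteq> 0 \<or> q 0 \<noteq> 0"
        using PQ(1,3) p0 q0 by (cases "degree Q = d") (auto simp: max_def split: if_splits)
      fix w assume w: "p w \<noteq> 0 \<or> q w \<noteq> 0"
      show "f (chart_infty w) = (if q w = 0 then None else Some (p w / q w))"
      proof (cases "w = 0")
        case True
        show ?thesis
        proof (cases "degree P > degree Q")
          case True
          then show ?thesis using \<open>w = 0\<close> PQ(3,5) q0 by simp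
        next
          case False
          then have "degree Q = d" using PQ(3) by simp
          then have "q 0 \<noteq> 0" "q 0 = lead_coeff Q" using q0 PQ(1) by auto
          moreover have "p 0 = coeff P (degree Q)" using p0 False \<open>degree Q = d\<close> by (auto simp: coeff_eq_0)
          ultimately show ?thesis using \<open>w = 0\<close> False PQ(5) by simp
        qed
      next
        case False
        then show ?thesis using PQ(4) pw by (simp add: chart_infty_def)
      qed
    qed (auto simp: p_def q_def intro!: holomorphic_intros)
    then show ?thesis by (simp add: None)
  qed
qed

lemma card_roots_rsquarefree:
  fixes p :: "complex poly"
  assumes "rsquarefree p"
  shows "card {z. poly p z = 0} = degree p"
proof -
  have "p \<noteq> 0" using assms by (simp add: rsquarefree_def)
  then have fin: "finite {z. poly p z = 0}" by (rule poly_roots_finite)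
  have "degree p = degree (smult (lead_coeff p) (\<Prod>z|poly p z = 0. [:-z, 1:]))"
    using complex_poly_decompose_rsquarefree[OF assms] by simp
  also have "\<dots> = degree (\<Prod>z|poly p z = 0. [:-z, 1:])" using \<open>p \<noteq> 0\<close> by simp
  also have "\<dots> = (\<Sum>z|poly p z = 0. degree [:-z, 1:])" by (rule degree_prod_sum_eq) auto
  also have "\<dots> = card {z. poly p z = 0}" by simp
  finally show ?thesis by simp
qed

text \<open>The preimages of w in the plane are the roots of P - w Q. Excluding critical values
  makes them simple; excluding the quotient of the coefficients at the degree of Q prevents leading
  terms from cancelling and keeps infinity out of the fibre.\<close>

lemma rational_map_generic:
  assumes rat: "rational_map d f" and d: "d \<ge> 1"
  obtains bad where "finite bad"
    "\<And>w. w \<notin> bad \<Longrightarrow> card {z. f (Some z) = Some w} = d \<and> f None \<noteq> Some w"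
    "\<And>w z. w \<notin> bad \<Longrightarrow> f (Some z) = Some w \<Longrightarrow> locally_injective (\<lambda>z. f (Some z)) z"
proof -
  obtain P Q :: "complex poly" where PQ: "Q \<noteq> 0" "coprime P Q" "d = max (degree P) (degree Q)"
    "\<And>z. f (Some z) = (if poly Q z = 0 then None else Some (poly P z / poly Q z))"
    "f None = (if degree P > degree Q then None else Some (coeff P (degree Q) / lead_coeff Q))"
    using rat unfolding rational_map_def by blast
  \<comment> \<open>The numerator of the derivative of P / Q. P' Q = P Q' fails at a root of Q,
    where Q has higher order than Q' and P does not vanish; if Q has no root, both polynomials would
    be constant.\<close>
  define V where "V = pderiv P * Q - P * pderiv Q"
  have "V \<noteq> 0"
  proof
    assume "V = 0"
    then have eq: "pderiv P * Q = P * pderiv Q" by (simp add: V_def)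
    have "degree Q = 0"
    proof (rule ccontr)
      assume nc: "degree Q \<noteq> 0"
      then have "\<not> constant (poly Q)" by (simp add: constant_degree)
      then obtain z where z: "poly Q z = 0" using fundamental_theorem_of_algebra by blast
      have "poly P z \<noteq> 0" using coprime_poly_no_common_root[OF PQ(2), of z] z by simp
      then have "P \<noteq> 0" by auto
      have Q': "pderiv Q \<noteq> 0" using nc by (simp add: pderiv_eq_0_iff)
      then have "P * pderiv Q \<noteq> 0" using \<open>P \<noteq> 0\<close> by simp
      then have "pderiv P * Q \<noteq> 0" using eq by simp
      then have "order z (pderiv P * Q) = order z (pderiv P) + order z Q" by (rule order_mult)
      moreover have "order z (P * pderiv Q) = order z P + order z (pderiv Q)"
        using \<open>P * pderiv Q \<noteq> 0\<close> by (rule order_mult)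
      moreover have "order z P = 0" using \<open>poly P z \<noteq> 0\<close> by (simp add: order_root)
      moreover have "order z Q = Suc (order z (pderiv Q))" using Q' z PQ(1) by (intro order_pderiv)
      ultimately show False using eq by simp
    qed
    then have "pderiv Q = 0" by (simp add: pderiv_eq_0_iff)
    then have "pderiv P = 0" using eq PQ(1) by simp
    then have "degree P = 0" by (simp add: pderiv_eq_0_iff)
    then show False using \<open>degree Q = 0\<close> PQ(3) d by simp
  qed
  define bad where "bad = insert (coeff P (degree Q) / lead_coeff Q) ((\<lambda>z. poly P z / poly Q z) ` {z. poly V z = 0})"
  have "finite bad" using poly_roots_finite[OF \<open>V \<noteq> 0\<close>] by (simp add: bad_def)
  define p where "p = (\<lambda>w. P - smult w Q)"
  have fib: "f (Some z) = Some w \<longleftrightarrow> poly (p w) z = 0" for z w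
    using coprime_poly_no_common_root[OF PQ(2), of z] PQ(4)[of z] by (auto simp: p_def field_simps)
  have regular: "\<not> (poly (p w) z = 0 \<and> poly (pderiv (p w)) z = 0)" if "w \<notin> bad" for w z
  proof
    assume A: "poly (p w) z = 0 \<and> poly (pderiv (p w)) z = 0"
    then have 1: "poly P z = w * poly Q z" "poly (pderiv P) z = w * poly (pderiv Q) z"
      by (auto simp: p_def pderiv_diff pderiv_smult)
    then have "poly Q z \<noteq> 0" using coprime_poly_no_common_root[OF PQ(2), of z] by auto
    then have "w = poly P z / poly Q z" using 1 by simp
    moreover have "poly V z = 0" unfolding V_def using 1 by simp
    ultimately show False using that by (auto simp: bad_def)
  qed
  have deg: "degree (p w) = d" if w: "w \<notin> bad" for w
  proof -
    have ne: "w \<noteq> coeff P (degree Q) / lead_coeff Q" using w by (auto simp: bad_def)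
    consider "degree P > degree Q" | "degree P \<le> degree Q" by linarith
    then show ?thesis
    proof cases
      case 1
      then have "degree (p w) = degree P"
        unfolding p_def by (metis degree_smult_le diff_conv_add_uminus degree_add_eq_left degree_minus order.strict_trans1)
      then show ?thesis using PQ(3) 1 by simp
    next
      case 2
      then have "coeff (p w) (degree Q) \<noteq> 0" using ne PQ(1) by (simp add: p_def field_simps)
      then have "degree Q \<le> degree (p w)" by (rule le_degree)
      moreover have "degree (p w) \<le> degree Q"
        unfolding p_def using 2 by (intro degree_diff_le) auto
      ultimately show ?thesis using PQ(3) 2 by simp
    qed
  qed
  show ?thesis
  proof (rule that[OF \<open>finite bad\<close>])
    fix w assume w: "w \<notin> bad"
    have "rsquarefree (p w)" unfolding rsquarefree_roots using regular[OF w] by blast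
    then have "card {z. f (Some z) = Some w} = d" unfolding fib using card_roots_rsquarefree deg[OF w] by simp
    moreover have "f None \<noteq> Some w" using w PQ(5) by (auto simp: bad_def)
    ultimately show "card {z. f (Some z) = Some w} = d \<and> f None \<noteq> Some w" ..
  next
    fix w z assume w: "w \<notin> bad" "f (Some z) = Some w"
    have Qz: "poly Q z \<noteq> 0" "w = poly P z / poly Q z" using w(2) PQ(4)[of z] by (auto split: if_splits)
    define T where "T = {z. poly Q z \<noteq> 0}"
    have "open T" unfolding T_def by (intro open_Collect_neq continuous_intros)
    define h where "h = (\<lambda>z. poly P z / poly Q z)"
    have hol: "h holomorphic_on T" unfolding h_def T_def by (intro holomorphic_intros) auto
    have "(h has_field_derivative (poly V z / (poly Q z)\<^sup>2)) (at z)"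
      unfolding h_def V_def using Qz by (auto intro!: derivative_eq_intros simp: power2_eq_square)
    then have "deriv h z = poly V z / (poly Q z)\<^sup>2" by (rule DERIV_imp_deriv)
    moreover have "poly V z \<noteq> 0" using w(1) Qz(2) by (auto simp: bad_def)
    ultimately have dh: "deriv h z \<noteq> 0" using Qz by simp
    obtain r where r: "r > 0" "ball z r \<subseteq> T" "inj_on h (ball z r)"
      by (rule has_complex_derivative_locally_injective[OF hol _ \<open>open T\<close> dh]) (use Qz in \<open>auto simp: T_def\<close>)
    have "inj_on (\<lambda>z. f (Some z)) (ball z r)"
    proof (rule inj_onI)
      fix x y assume xy: "x \<in> ball z r" "y \<in> ball z r" "f (Some x) = f (Some y)"
      then have "poly Q x \<noteq> 0" "poly Q y \<noteq> 0" using r(2) by (auto simp: T_def)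
      then have "h x = h y" using xy(3) PQ(4) by (simp add: h_def)
      then show "x = y" using r(3) xy by (auto dest: inj_onD)
    qed
    then show "locally_injective (\<lambda>z. f (Some z)) z" using r(1) by (auto simp: locally_injective_def)
  qed
qed

text \<open>Isolates what the counting needs of a rational map; generic fibres can then be counted
  entirely in the plane.\<close>

locale generic_degree =
  fixes f :: "riemann_sphere \<Rightarrow> riemann_sphere" and d :: nat and bad :: "complex set"
  assumes hol: "\<And>x. hol_at f x" and d: "d \<ge> 2" and bad: "finite bad"
    and card_fibre: "\<And>w. w \<notin> bad \<Longrightarrow> card {z. f (Some z) = Some w} = d"
    and None: "\<And>w. w \<notin> bad \<Longrightarrow> f None \<noteq> Some w"
    and li: "\<And>w z. w \<notin> bad \<Longrightarrow> f (Some z) = Some w \<Longrightarrow> locally_injective (\<lambda>z. f (Some z)) z"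
begin

text \<open>Forward images of \<open>bad\<close>. Off this set all preimages under
  \<open>f ^^ k\<close> with k < n avoid \<open>bad\<close>, so the fibres of \<open>f ^^ n\<close>
  consist of finite points at which the iterate is locally injective.\<close>

definition Bad :: "nat \<Rightarrow> complex set" where
  "Bad n = (\<Union>k<n. {v. \<exists>u\<in>bad. (f ^^ k) (Some u) = Some v})"

lemma finite_Bad: "finite (Bad n)"
proof -
  have "finite {v. \<exists>u\<in>bad. (f ^^ k) (Some u) = Some v}" for k
    by (rule finite_subset[of _ "(\<lambda>u. the ((f ^^ k) (Some u))) ` bad"]) (use bad in \<open>force+\<close>)
  then show ?thesis by (simp add: Bad_def)
qed

lemma Bad_mono: "m \<le> n \<Longrightarrow> Bad m \<subseteq> Bad n"
  unfolding Bad_def by (intro UN_mono) auto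

lemma bad_Bad: "n \<ge> 1 \<Longrightarrow> bad \<subseteq> Bad n"
  unfolding Bad_def by (intro subsetI UN_I[of 0]) auto

lemma Bad_preimage:
  assumes "w \<notin> Bad (n + m)" "(f ^^ m) (Some u) = Some w"
  shows "u \<notin> Bad n"
proof
  assume "u \<in> Bad n"
  then obtain k v where "k < n" "v \<in> bad" "(f ^^ k) (Some v) = Some u" by (auto simp: Bad_def)
  then have "(f ^^ (k + m)) (Some v) = Some w" using assms(2) by (simp add: funpow_add add.commute[of k m])
  then have "w \<in> Bad (n + m)" unfolding Bad_def using \<open>k < n\<close> \<open>v \<in> bad\<close> by (intro UN_I[of "k + m"]) auto
  with assms(1) show False by blast
qed

lemma hol_iterate: "hol_at (f ^^ n) x"
proof (induction n)
  case 0
  have "hol_germ (\<lambda>w. Some w) z" "hol_germ (\<lambda>w. chart_infty w) z" for z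
    by (rule hol_germ_SomeI[of UNIV "\<lambda>w. w"]; simp) (rule hol_germ_chartI[of UNIV "\<lambda>w. w"]; simp)
  then show ?case by (cases x) (simp_all add: hol_at_def)
next
  case (Suc n)
  then show ?case using hol_at_compose[OF Suc hol] by (simp add: o_def)
qed

lemma germ_iterate: "hol_germ (\<lambda>z. (f ^^ n) (Some z)) z"
  using hol_iterate[of n "Some z"] by simp

lemma preimage_finite_point: "w \<notin> Bad n \<Longrightarrow> (f ^^ n) x = Some w \<Longrightarrow> x \<noteq> None"
proof (induction n arbitrary: w)
  case (Suc n)
  have "w \<notin> bad" using Suc.prems(1) bad_Bad[of "Suc n"] by auto
  then have "(f ^^ n) x \<noteq> None" using None[of w] Suc.prems(2) by (metis funpow.simps(2) o_apply)
  then obtain u where u: "(f ^^ n) x = Some u" by blast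
  then have "(f ^^ 1) (Some u) = Some w" using Suc.prems(2) by simp
  then have "u \<notin> Bad n" using Bad_preimage[of w n 1 u] Suc.prems(1) by simp
  then show ?case using Suc.IH u by blast
qed auto

lemma fibre_compose:
  assumes "w \<notin> Bad m"
  shows "{z \<in> S. (f ^^ (m + n)) (Some z) = Some w} = (\<Union>u\<in>{u. (f ^^ m) (Some u) = Some w}. {z \<in> S. (f ^^ n) (Some z) = Some u})"
proof -
  have "(f ^^ (m + n)) (Some z) = Some w \<longleftrightarrow> (\<exists>u. (f ^^ m) (Some u) = Some w \<and> (f ^^ n) (Some z) = Some u)" for z
  proof
    assume A: "(f ^^ (m + n)) (Some z) = Some w"
    then have "(f ^^ m) ((f ^^ n) (Some z)) = Some w" by (simp add: funpow_add)
    then show "\<exists>u. (f ^^ m) (Some u) = Some w \<and> (f ^^ n) (Some z) = Some u"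
      using preimage_finite_point[OF assms] by (metis option.exhaust)
  qed (auto simp: funpow_add)
  then show ?thesis by auto
qed

lemma card_iterate_fibre: "w \<notin> Bad n \<Longrightarrow> card {z. (f ^^ n) (Some z) = Some w} = d ^ n"
  and finite_iterate_fibre: "w \<notin> Bad n \<Longrightarrow> finite {z. (f ^^ n) (Some z) = Some w}"
proof -
  have fin: "finite A" if "card A = d ^ n" for A :: "complex set" and n
    using that d by (metis card.infinite power_eq_0_iff not_numeral_le_zero)
  show *: "card {z. (f ^^ n) (Some z) = Some w} = d ^ n" if "w \<notin> Bad n" for w n
    using that
  proof (induction n arbitrary: w)
    case 0
    have "{z. (f ^^ 0) (Some z) = Some w} = {w}" by auto
    then show ?case by simp
  next
    case (Suc n)
    have "w \<notin> Bad 1" using Suc.prems Bad_mono[of 1 "Suc n"] by auto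
    have "w \<notin> bad" using Suc.prems bad_Bad[of "Suc n"] by auto
    have IH: "card {z. (f ^^ n) (Some z) = Some u} = d ^ n" if "(f ^^ 1) (Some u) = Some w" for u
      using Suc.IH Bad_preimage[of w n 1 u] that Suc.prems by simp
    have c1: "card {u. (f ^^ 1) (Some u) = Some w} = d" using card_fibre[OF \<open>w \<notin> bad\<close>] by simp
    have "{z. (f ^^ Suc n) (Some z) = Some w} = (\<Union>u\<in>{u. (f ^^ 1) (Some u) = Some w}. {z. (f ^^ n) (Some z) = Some u})"
      using fibre_compose[OF \<open>w \<notin> Bad 1\<close>, of UNIV n] by simp
    also have "card \<dots> = (\<Sum>u\<in>{u. (f ^^ 1) (Some u) = Some w}. card {z. (f ^^ n) (Some z) = Some u})"
    proof (rule card_UN_disjoint)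
      show "finite {u. (f ^^ 1) (Some u) = Some w}" using fin[of _ 1] c1 by simp
      show "\<forall>u\<in>{u. (f ^^ 1) (Some u) = Some w}. finite {z. (f ^^ n) (Some z) = Some u}"
        using fin IH by blast
    qed auto
    also have "\<dots> = d * d ^ n" using IH c1 by simp
    finally show ?case by simp
  qed
  show "finite {z. (f ^^ n) (Some z) = Some w}" if "w \<notin> Bad n" using fin[OF *[OF that]] .
qed

text \<open>Applied below with (m, n) equal to (p - 1, 1) and to (1, p - 1), the two ways of
  splitting \<open>f ^^ p\<close>.\<close>

lemma count_compose:
  assumes w: "w \<notin> Bad (n + m)"
  shows "card {z \<in> S. (f ^^ (m + n)) (Some z) = Some w}
    = (\<Sum>u | (f ^^ m) (Some u) = Some w. card {z \<in> S. (f ^^ n) (Some z) = Some u})"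
proof -
  have wm: "w \<notin> Bad m" using w Bad_mono[of m "n + m"] by auto
  have "finite {z \<in> S. (f ^^ n) (Some z) = Some u}" if "(f ^^ m) (Some u) = Some w" for u
    by (rule finite_subset[OF _ finite_iterate_fibre[OF Bad_preimage[OF w that]]]) auto
  then show ?thesis
    unfolding fibre_compose[OF wm] using finite_iterate_fibre[OF wm] by (intro card_UN_disjoint) auto
qed

lemma iterate_locally_injective:
  "w \<notin> Bad n \<Longrightarrow> (f ^^ n) (Some z) = Some w \<Longrightarrow> locally_injective (\<lambda>z. (f ^^ n) (Some z)) z"
proof (induction n arbitrary: w)
  case 0
  show ?case unfolding locally_injective_def by (intro exI[of _ 1]) (auto simp: inj_on_def)
next
  case (Suc n)
  have "w \<notin> bad" using Suc.prems bad_Bad[of "Suc n"] by auto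
  then have "(f ^^ n) (Some z) \<noteq> None" using None[of w] Suc.prems(2) by (metis funpow.simps(2) o_apply)
  then obtain u where u: "(f ^^ n) (Some z) = Some u" by blast
  then have fu: "f (Some u) = Some w" using Suc.prems(2) by simp
  then have "u \<notin> Bad n" using Bad_preimage[of w n 1 u] Suc.prems(1) by simp
  then obtain e1 where e1: "e1 > 0" "inj_on (\<lambda>z. (f ^^ n) (Some z)) (ball z e1)"
    using Suc.IH u unfolding locally_injective_def by blast
  obtain e2 where e2: "e2 > 0" "inj_on (\<lambda>z. f (Some z)) (ball u e2)"
    using li[OF \<open>w \<notin> bad\<close> fu] unfolding locally_injective_def by blast
  obtain e3 h where h: "e3 > 0" "h holomorphic_on ball z e3" "\<And>x. x \<in> ball z e3 \<Longrightarrow> (f ^^ n) (Some x) = Some (h x)" "h z = u"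
    using hol_germ_finiteE[OF germ_iterate u] by blast
  have "z \<in> ball z e3" using h(1) by simp
  then have "isCont h z"
    using holomorphic_on_imp_continuous_on[OF h(2)] continuous_on_eq_continuous_at[OF open_ball] by blast
  then obtain e4 where e4: "e4 > 0" "\<And>x. dist x z < e4 \<Longrightarrow> dist (h x) (h z) < e2"
    using e2(1) unfolding continuous_at_eps_delta by blast
  define e where "e = min (min e1 e3) e4"
  have "inj_on (\<lambda>z. (f ^^ Suc n) (Some z)) (ball z e)"
  proof (rule inj_onI)
    fix x y assume xy: "x \<in> ball z e" "y \<in> ball z e" "(f ^^ Suc n) (Some x) = (f ^^ Suc n) (Some y)"
    have fx: "(f ^^ n) (Some x) = Some (h x)" "(f ^^ n) (Some y) = Some (h y)" using xy h(3) by (auto simp: e_def)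
    have "h x \<in> ball u e2" "h y \<in> ball u e2" using xy e4(2) h(4) by (auto simp: e_def dist_commute)
    moreover have "f (Some (h x)) = f (Some (h y))" using xy(3) fx by simp
    ultimately have "h x = h y" using e2(2) by (auto dest: inj_onD)
    then show "x = y" using fx xy(1,2) inj_onD[OF e1(2), of x y] by (simp add: e_def)
  qed
  moreover have "e > 0" using e1 h e4 by (simp add: e_def)
  ultimately show ?case unfolding locally_injective_def by blast
qed

lemma injective_on_circle_iterate:
  assumes "R > 0" "inj_on (\<lambda>z. (f ^^ n) (Some z)) (sphere a R)" "w0 \<notin> Bad n" "Some w0 \<notin> (\<lambda>z. (f ^^ n) (Some z)) ` sphere a R"
  shows "injective_on_circle (\<lambda>z. (f ^^ n) (Some z)) a R (Bad n) w0"
  by unfold_locales (use assms germ_iterate finite_iterate_fibre iterate_locally_injective in auto)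

end

section \<open>Preimage counts on the two sides of the circle\<close>

lemma open_avoids_finite:
  fixes S :: "complex set"
  assumes "open S" "S \<noteq> {}" "countable A"
  obtains z where "z \<in> S" "z \<notin> A"
proof -
  obtain x e where "e > 0" "ball x e \<subseteq> S" using assms openE by (metis all_not_in_conv)
  then have "\<not> S \<subseteq> A" using uncountable_ball[of e x] assms(3) by (meson countable_subset)
  then show ?thesis using that by blast
qed

context injective_on_circle
begin

lemma card_split:
  assumes "w \<notin> Bd" "w \<notin> \<Gamma>"
  shows "card {z. G z = Some w} = count (ball a R) w + count (- cball a R) w"
proof -
  have "{z. G z = Some w} = {z \<in> ball a R. G z = Some w} \<union> {z \<in> - cball a R. G z = Some w}"
  proof (rule set_eqI)
    fix z show "z \<in> {z. G z = Some w} \<longleftrightarrow> z \<in> {z \<in> ball a R. G z = Some w} \<union> {z \<in> - cball a R. G z = Some w}"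
      using on_circle(1)[OF _ assms(2), of z] by (auto simp: not_le less_le)
  qed
  moreover have "finite {z \<in> S. G z = Some w}" for S by (rule finite_subset[OF _ fin[OF assms(1)]]) auto
  moreover have "{z \<in> ball a R. G z = Some w} \<inter> {z \<in> - cball a R. G z = Some w} = {}" by auto
  ultimately show ?thesis unfolding count_def by (simp only: card_Un_disjoint)
qed

text \<open>For the exterior the sign is reversed, because the two counts add up to the constant
  T.\<close>

lemma count_side:
  assumes X: "X = ball a R \<or> X = - cball a R" and T: "\<And>w. w \<notin> Bd \<Longrightarrow> card {z. G z = Some w} = T"
  obtains c \<epsilon> :: int where "\<epsilon> = 1 \<or> \<epsilon> = -1"
    "\<And>w. w \<notin> Bd \<Longrightarrow> w \<notin> \<Gamma> \<Longrightarrow> int (count X w) = c + (if w \<in> E then \<epsilon> else 0)"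
proof -
  obtain \<epsilon> :: int where \<epsilon>: "\<epsilon> = 1 \<or> \<epsilon> = -1"
    "\<And>w. w \<notin> Bd \<Longrightarrow> w \<notin> \<Gamma> \<Longrightarrow> int (count (ball a R) w) = int (count (ball a R) w0) + (if w \<in> E then \<epsilon> else 0)"
    using count_ball by blast
  show ?thesis
  proof (cases "X = ball a R")
    case True
    then show ?thesis using \<epsilon> that by blast
  next
    case False
    then have X: "X = - cball a R" using assms(1) by blast
    have "int (count X w) = (int T - int (count (ball a R) w0)) + (if w \<in> E then - \<epsilon> else 0)"
      if "w \<notin> Bd" "w \<notin> \<Gamma>" for w
      using card_split[OF that] T[OF that(1)] \<epsilon>(2)[OF that] X by auto
    then show ?thesis using \<epsilon>(1) that[of "- \<epsilon>" "int T - int (count (ball a R) w0)"] by auto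
  qed
qed

end

text \<open>With q = \<epsilon>' (d - 2 m0) one has N = c1 q. Since c1 >= 2, the bounds 0 <= N <= 2
  c1 + 1 leave only q = 0, 1 or 2, and q is odd.\<close>

lemma rational_count_arithmetic:
  fixes c1 m0 d \<epsilon> \<epsilon>' N D :: int
  assumes \<epsilon>: "\<epsilon> = 1 \<or> \<epsilon> = -1" "\<epsilon>' = 1 \<or> \<epsilon>' = -1" and D: "D = 2 * c1 + \<epsilon>" "D \<ge> 4" "odd d"
    and N: "\<epsilon>' * N = c1 * (d - 2 * m0)" "0 \<le> N" "N \<le> D"
  shows "d - 2 * m0 = \<epsilon>'"
proof -
  define q where "q = \<epsilon>' * (d - 2 * m0)"
  have "N = \<epsilon>' * (\<epsilon>' * N)" using \<epsilon>(2) by auto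
  then have Nq: "N = c1 * q" unfolding N(1) by (simp add: q_def)
  have c1: "c1 \<ge> 2" using D \<epsilon>(1) by auto
  have "q \<ge> 0"
  proof (rule ccontr)
    assume "\<not> q \<ge> 0"
    then have "c1 * q < 0" using c1 by (simp add: mult_less_0_iff)
    then show False using N(2) Nq by simp
  qed
  moreover have "q \<le> 2"
  proof (rule ccontr)
    assume "\<not> q \<le> 2"
    then have "c1 * 3 \<le> c1 * q" using c1 by (intro mult_left_mono) auto
    moreover have "\<epsilon> \<le> 1" using \<epsilon>(1) by auto
    ultimately show False using N(3) D(1) c1 unfolding Nq by linarith
  qed
  moreover have "odd q" using \<epsilon>(2) \<open>odd d\<close> by (auto simp: q_def)
  ultimately have "q = 1" by presburger
  then show ?thesis using \<epsilon>(2) by (auto simp: q_def)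
qed

context generic_degree
begin

text \<open>Composing the counts of \<open>f ^^ p = f \<circ> f ^^ (p - 1) = f ^^ (p - 1) \<circ> f\<close> expresses the number of preimages
  in \<open>E\<close> under \<open>F\<close> through the preimages in \<open>X\<close> under \<open>f\<close>. The reflection \<open>s\<close> makes the numbers for \<open>X\<close>
  and \<open>K\<close> almost equal, and parity then leaves only one value for the unknown count, which forces
  the points of \<open>K\<close> and \<open>E\<close> to have no preimage between the circle and \<open>\<Gamma>\<close>.\<close>

lemma invariant_region:
  fixes p :: nat and a :: complex and R :: real and X K :: "complex set" and s :: "complex \<Rightarrow> complex"
  defines "C \<equiv> sphere a R" and "F \<equiv> (\<lambda>z. (f ^^ p) (Some z))"
  defines "\<Gamma> \<equiv> {w. Some w \<in> (\<lambda>z. f (Some z)) ` C}"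
  assumes p: "p \<ge> 2" and R: "R > 0"
    and injf: "inj_on (\<lambda>z. f (Some z)) C" and injF: "inj_on F C" and inv: "F ` C = Some ` C"
    and X: "X = ball a R \<and> K = - cball a R \<or> X = - cball a R \<and> K = ball a R"
    and img: "\<And>c. c \<in> C \<Longrightarrow> f (Some c) \<notin> Some ` (K \<union> C)"
    and s: "\<And>z. z \<noteq> a \<Longrightarrow> s z \<noteq> a \<and> s (s z) = z \<and> (s z \<in> K \<longleftrightarrow> z \<in> X)"
    and sF: "\<And>z w. z \<noteq> a \<Longrightarrow> w \<noteq> a \<Longrightarrow> F z = Some w \<Longrightarrow> F (s z) = Some (s w)"
  obtains E Bd where "open E" "E \<inter> \<Gamma> = {}" "E \<subseteq> X" "closed (E \<union> \<Gamma>)" "finite Bd"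
    "\<And>w z. w \<in> K \<union> E \<Longrightarrow> w \<notin> Bd \<Longrightarrow> z \<in> X - (E \<union> \<Gamma>) \<Longrightarrow> F z \<noteq> Some w"
proof -
  have K: "open K" "connected K" "K \<noteq> {}" "K \<inter> X = {}" "K \<inter> C = {}" "X \<inter> C = {}" "K \<union> X \<union> C = UNIV" "open X" "connected X" "X \<noteq> {}"
  proof -
    have 1: "connected (- cball a R)" by (intro connected_complement_bounded_convex) auto
    have "a + 2 * of_real R \<notin> cball a R" using R by (simp add: dist_norm norm_mult)
    then have 2: "- cball a R \<noteq> {}" by blast
    have 3: "ball a R \<noteq> {}" "connected (ball a R)" "open (ball a R)" "open (- cball a R)" using R by auto
    have 4: "ball a R \<inter> sphere a R = {}" "- cball a R \<inter> sphere a R = {}" "ball a R \<inter> - cball a R = {}"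
      "ball a R \<union> - cball a R \<union> sphere a R = UNIV" by auto
    show "open K" "connected K" "K \<noteq> {}" "K \<inter> X = {}" "K \<inter> C = {}" "X \<inter> C = {}" "K \<union> X \<union> C = UNIV" "open X" "connected X" "X \<noteq> {}"
      using X 1 2 3 4 unfolding C_def by (elim disjE conjE; simp add: Int_commute Un_commute)+
  qed
  have "w \<notin> K \<union> C" if w: "w \<in> \<Gamma>" for w
  proof -
    have "Some w \<in> (\<lambda>z. f (Some z)) ` C" using w by (simp add: \<Gamma>_def)
    then obtain c where "c \<in> C" "f (Some c) = Some w" by (elim imageE) simp
    then show ?thesis using img[of c] by auto
  qed
  then have \<Gamma>K: "K \<inter> \<Gamma> = {}" "C \<inter> \<Gamma> = {}" by auto
  have CK: "C \<subseteq> closure K" "C \<subseteq> closure X"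
  proof -
    have "closure (ball a R) = cball a R" using R by simp
    moreover have "closure (- cball a R) = - ball a R" by (simp add: closure_complement)
    ultimately show "C \<subseteq> closure K" "C \<subseteq> closure X" using X by (auto simp: C_def)
  qed
  \<comment> \<open>A base value on the side without f(C) serves for both curves, \<Gamma> and
    C.\<close>
  obtain w0 where w0: "w0 \<in> K" "w0 \<notin> Bad (p + 1)"
    by (rule open_avoids_finite[OF K(1,3) countable_finite[OF finite_Bad]])
  have w0': "w0 \<notin> Bad 1" "w0 \<notin> Bad p" using w0(2) Bad_mono[of 1 "p + 1"] Bad_mono[of p "p + 1"] by auto
  have "injective_on_circle (\<lambda>z. (f ^^ 1) (Some z)) a R (Bad 1) w0"
  proof (rule injective_on_circle_iterate[OF R _ w0'(1)])
    show "inj_on (\<lambda>z. (f ^^ 1) (Some z)) (sphere a R)" using injf by (simp add: C_def)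
    show "Some w0 \<notin> (\<lambda>z. (f ^^ 1) (Some z)) ` sphere a R" using \<Gamma>K(1) w0(1) by (auto simp: \<Gamma>_def C_def)
  qed
  then interpret f1: injective_on_circle "\<lambda>z. f (Some z)" a R "Bad 1" w0 by simp
  interpret F1: injective_on_circle F a R "Bad p" w0
    unfolding F_def
  proof (rule injective_on_circle_iterate[OF R _ w0'(2)])
    show "inj_on (\<lambda>z. (f ^^ p) (Some z)) (sphere a R)" using injF by (simp add: C_def F_def)
    have "Some w0 \<notin> F ` C" unfolding inv using K(5) w0(1) by blast
    then show "Some w0 \<notin> (\<lambda>z. (f ^^ p) (Some z)) ` sphere a R" by (simp add: F_def C_def)
  qed
  have f\<Gamma>: "f1.\<Gamma> = \<Gamma>" by (simp add: f1.\<Gamma>_def \<Gamma>_def C_def)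
  have F\<Gamma>: "F1.\<Gamma> = C" using inv by (auto simp: F1.\<Gamma>_def C_def)
  \<comment> \<open>The image curve of F is the circle itself, so its side away from
    \<open>w0\<close> is X.\<close>
  have FE: "F1.E = X" by (rule F1.E_eq_side[OF K(1,2) w0(1)]) (use K F\<Gamma> in auto)
  define E where "E = f1.E"
  have E: "open E" "closed (E \<union> \<Gamma>)" "E \<inter> \<Gamma> = {}"
    using f1.open_E f1.closed_E_Un f1.E_disjoint by (auto simp: E_def f\<Gamma>)
  have EK: "K \<inter> E = {}" unfolding E_def by (rule f1.base_side_disjoint[OF K(1,2) w0(1)]) (simp add: f\<Gamma> \<Gamma>K)
  have EC: "C \<inter> E = {}"
  proof -
    have "E \<inter> closure K = {}" using EK E(1) by (simp add: open_Int_closure_eq_empty Int_commute)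
    then show ?thesis using CK by blast
  qed
  have EX: "E \<subseteq> X" using EK EC K(7) by blast
  \<comment> \<open>The region between C and \<Gamma>. It is not empty because points of X close to
    C lie off the closed set \<open>E \<union> \<Gamma>\<close>.\<close>
  define W where "W = X - (E \<union> \<Gamma>)"
  have "open W" unfolding W_def using K(8) E(2) by (rule open_Diff)
  have "W \<noteq> {}"
  proof -
    have "a + of_real R \<in> C" using R by (simp add: C_def dist_norm)
    then obtain c where c: "c \<in> C" by blast
    have "c \<in> - (E \<union> \<Gamma>)" using c EC \<Gamma>K(2) by blast
    moreover have "c \<in> closure X" using c CK(2) by blast
    moreover have "open (- (E \<union> \<Gamma>))" using E(2) by (rule open_Compl)
    then have "- (E \<union> \<Gamma>) \<inter> closure X = {} \<longleftrightarrow> - (E \<union> \<Gamma>) \<inter> X = {}" by (rule open_Int_closure_eq_empty)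
    ultimately have "- (E \<union> \<Gamma>) \<inter> X \<noteq> {}" by blast
    then show ?thesis by (auto simp: W_def)
  qed
  define nf where "nf = (\<lambda>S w. card {z \<in> S. f (Some z) = Some w})"
  define nF where "nF = (\<lambda>S w. card {z \<in> S. F z = Some w})"
  have cardF: "card {z. F z = Some w} = d ^ p" if "w \<notin> Bad p" for w
    using card_iterate_fibre[OF that] by (simp add: F_def)
  have finF: "finite {z \<in> S. F z = Some w}" if "w \<notin> Bad p" for w S
    by (rule finite_subset[OF _ finite_iterate_fibre[OF that]]) (auto simp: F_def)
  have cardf: "card {z. f (Some z) = Some w} = d" if "w \<notin> Bad 1" for w
    using card_iterate_fibre[OF that] by simp
  obtain c1 \<epsilon> :: int where \<epsilon>: "\<epsilon> = 1 \<or> \<epsilon> = -1"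
    and nFX: "\<And>w. w \<notin> Bad p \<Longrightarrow> w \<notin> C \<Longrightarrow> int (nF X w) = c1 + (if w \<in> X then \<epsilon> else 0)"
  proof -
    have X': "X = ball a R \<or> X = - cball a R" using X by blast
    show thesis
    proof (rule F1.count_side[OF X' cardF], assumption)
      fix c \<epsilon> :: int
      assume 1: "\<epsilon> = 1 \<or> \<epsilon> = -1"
        and 2: "\<And>w. w \<notin> Bad p \<Longrightarrow> w \<notin> F1.\<Gamma> \<Longrightarrow> int (F1.count X w) = c + (if w \<in> F1.E then \<epsilon> else 0)"
      show thesis by (rule that[OF 1]) (use 2 in \<open>simp add: F1.count_def nF_def F\<Gamma> FE\<close>)
    qed
  qed
  obtain m0 \<epsilon>' :: int where \<epsilon>': "\<epsilon>' = 1 \<or> \<epsilon>' = -1"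
    and nfX: "\<And>w. w \<notin> Bad 1 \<Longrightarrow> w \<notin> \<Gamma> \<Longrightarrow> int (nf X w) = m0 + (if w \<in> E then \<epsilon>' else 0)"
  proof -
    have X': "X = ball a R \<or> X = - cball a R" using X by blast
    show thesis
    proof (rule f1.count_side[OF X' cardf], assumption)
      fix c \<epsilon> :: int
      assume 1: "\<epsilon> = 1 \<or> \<epsilon> = -1"
        and 2: "\<And>w. w \<notin> Bad 1 \<Longrightarrow> w \<notin> f1.\<Gamma> \<Longrightarrow> int (f1.count X w) = c + (if w \<in> f1.E then \<epsilon> else 0)"
      show thesis by (rule that[OF 1]) (use 2 in \<open>simp add: f1.count_def nf_def f\<Gamma> E_def\<close>)
    qed
  qed
  \<comment> \<open>The reflection carries the F-fibre of w in X onto the F-fibre of s w in K. The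
    first has c1 + \<epsilon> points and the second c1 less than the degree. Choosing w outside A
    also keeps the centre a, whose reflection is infinity, out of both fibres.\<close>
  have D: "int (d ^ p) = 2 * c1 + \<epsilon>"
  proof -
    define A where "A = Bad p \<union> s ` (Bad p - {a}) \<union> {a} \<union> {w. F a = Some w} \<union> s ` ({w. F a = Some w} - {a})"
    have "finite {w. F a = Some w}" by (rule finite_subset[of _ "{the (F a)}"]) auto
    then have "finite A" using finite_Bad by (auto simp: A_def)
    then obtain w where w: "w \<in> X" "w \<notin> A" by (rule open_avoids_finite[OF K(8,10) countable_finite])
    have wa: "w \<noteq> a" using w by (simp add: A_def)
    then have sw: "s w \<noteq> a" "s (s w) = w" "s w \<in> K" using s w(1) by auto
    have swB: "s w \<notin> Bad p"
    proof
      assume "s w \<in> Bad p"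
      then have "s (s w) \<in> s ` (Bad p - {a})" using sw by blast
      then show False using sw w by (auto simp: A_def)
    qed
    have Fa: "F a \<noteq> Some w" "F a \<noteq> Some (s w)"
    proof -
      show "F a \<noteq> Some w" using w by (auto simp: A_def)
      show "F a \<noteq> Some (s w)"
      proof
        assume "F a = Some (s w)"
        then have "s (s w) \<in> s ` ({w. F a = Some w} - {a})" using sw by blast
        then show False using sw w by (auto simp: A_def)
      qed
    qed
    have "bij_betw s {z \<in> X. F z = Some w} {z \<in> K. F z = Some (s w)}"
    proof (rule bij_betwI[where g = s])
      show "s \<in> {z \<in> X. F z = Some w} \<rightarrow> {z \<in> K. F z = Some (s w)}"
      proof
        fix z assume z: "z \<in> {z \<in> X. F z = Some w}"
        then have "z \<noteq> a" using Fa by auto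
        then show "s z \<in> {z \<in> K. F z = Some (s w)}" using s sF z wa by auto
      qed
      show "s \<in> {z \<in> K. F z = Some (s w)} \<rightarrow> {z \<in> X. F z = Some w}"
      proof
        fix z assume z: "z \<in> {z \<in> K. F z = Some (s w)}"
        then have za: "z \<noteq> a" using Fa by auto
        then have "F (s z) = Some (s (s w))" using sF[of z "s w"] sw z by auto
        moreover have "s z \<in> X" using s[OF za] s[of "s z"] z by auto
        ultimately show "s z \<in> {z \<in> X. F z = Some w}" using sw by simp
      qed
      show "s (s z) = z" if "z \<in> {z \<in> X. F z = Some w}" for z
        using s[of z] that Fa by auto
      show "s (s z) = z" if "z \<in> {z \<in> K. F z = Some (s w)}" for z
        using s[of z] that Fa by auto
    qed
    then have eq: "nF X w = nF K (s w)" unfolding nF_def by (rule bij_betw_same_card)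
    have "d ^ p = nF X (s w) + nF K (s w)"
    proof -
      have "s w \<notin> F1.\<Gamma>" using sw(3) K(5) F\<Gamma> by blast
      then have "card {z. F z = Some (s w)} = F1.count (ball a R) (s w) + F1.count (- cball a R) (s w)"
        by (rule F1.card_split[OF swB])
      then show ?thesis using X cardF[OF swB] by (auto simp: F1.count_def nF_def)
    qed
    moreover have "int (nF X (s w)) = c1"
    proof -
      have "s w \<notin> C" "s w \<notin> X" using sw(3) K(4,5) by blast+
      then show ?thesis using nFX[OF swB] by simp
    qed
    moreover have "int (nF X w) = c1 + \<epsilon>"
    proof -
      have "w \<notin> Bad p" using w(2) by (simp add: A_def)
      moreover have "w \<notin> C" using w(1) K(6) by blast
      ultimately show ?thesis using nFX[of w] w(1) by simp
    qed
    ultimately show ?thesis using eq by simp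
  qed
  have pq: "p = Suc (p - 1)" using p by simp
  define e where "e = (\<lambda>w. card {u \<in> E. (f ^^ (p - 1)) (Some u) = Some w})"
  \<comment> \<open>F is split as \<open>f ^^ (p - 1)\<close> after f. Summing the numbers of
    f-preimages in X over the \<open>f ^^ (p - 1)\<close>-fibre of w, the jump \<epsilon>' occurs
    once for each point of this fibre in E.\<close>
  have ev: "\<epsilon>' * int (e w) = c1 + (if w \<in> X then \<epsilon> else 0) - m0 * int (d ^ (p - 1))"
    if w: "w \<notin> Bad p" "w \<notin> C" for w
  proof -
    have "1 + (p - 1) = p" using p by linarith
    then have w': "w \<notin> Bad (1 + (p - 1))" using w(1) by metis
    have finU: "finite {u. (f ^^ (p - 1)) (Some u) = Some w}"
      by (rule finite_iterate_fibre) (use w(1) Bad_mono[of "p - 1" p] in auto)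
    have cU: "card {u. (f ^^ (p - 1)) (Some u) = Some w} = d ^ (p - 1)"
      by (rule card_iterate_fibre) (use w(1) Bad_mono[of "p - 1" p] in auto)
    have "nF X w = (\<Sum>u | (f ^^ (p - 1)) (Some u) = Some w. nf X u)"
      using count_compose[OF w', of X] p by (simp add: nF_def nf_def F_def)
    then have "int (nF X w) = (\<Sum>u | (f ^^ (p - 1)) (Some u) = Some w. int (nf X u))" by simp
    also have "\<dots> = (\<Sum>u | (f ^^ (p - 1)) (Some u) = Some w. m0 + (if u \<in> E then \<epsilon>' else 0))"
    proof (rule sum.cong[OF refl])
      fix u assume u: "u \<in> {u. (f ^^ (p - 1)) (Some u) = Some w}"
      have "u \<notin> Bad 1" using Bad_preimage[OF w'] u by simp
      moreover have "u \<notin> \<Gamma>"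
      proof
        assume "u \<in> \<Gamma>"
        then have "Some u \<in> (\<lambda>z. f (Some z)) ` C" by (simp add: \<Gamma>_def)
        then obtain c where c: "c \<in> C" "f (Some c) = Some u" by (elim imageE) simp
        have "F c = (f ^^ (p - 1)) (f (Some c))" 
        proof -
          have "(f ^^ Suc (p - 1)) (Some c) = (f ^^ (p - 1)) (f (Some c))" by (simp only: funpow_Suc_right o_apply)
          then show ?thesis unfolding F_def pq[symmetric] .
        qed
        also have "\<dots> = Some w" using c(2) u by simp
        finally have "Some w \<in> F ` C" using c(1) by (metis imageI)
        then show False unfolding inv using w(2) by blast
      qed
      ultimately show "int (nf X u) = m0 + (if u \<in> E then \<epsilon>' else 0)" by (rule nfX)
    qed
    also have "\<dots> = m0 * int (d ^ (p - 1)) + \<epsilon>' * int (e w)"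
    proof -
      have "(\<Sum>u | (f ^^ (p - 1)) (Some u) = Some w. if u \<in> E then \<epsilon>' else 0) = \<epsilon>' * int (e w)"
        using finU by (simp add: sum.If_cases e_def Int_def conj_commute)
      then show ?thesis using cU by (simp add: sum.distrib)
    qed
    finally show ?thesis using nFX[OF w] by simp
  qed
  \<comment> \<open>F is now split as f after \<open>f ^^ (p - 1)\<close>, with the previous formula
    inserted. The products of m0 and \<epsilon> cancel because the degree is 2 c1 + \<epsilon>, and
    the factor d - 2 m0 remains.\<close>
  have NE: "\<epsilon>' * int (nF E w) = c1 * (int d - 2 * m0) + (if w \<in> E then \<epsilon> * \<epsilon>' else 0)"
    if w: "w \<notin> Bad (p + 1)" "w \<notin> C" "w \<notin> \<Gamma>" for w
  proof -
    have w1: "w \<notin> Bad 1" "w \<notin> Bad (p - 1 + 1)" using w(1) p Bad_mono[of 1 "p + 1"] Bad_mono[of p "p + 1"] by auto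
    have "card {u. (f ^^ 1) (Some u) = Some w} = d" using card_iterate_fibre[OF w1(1)] by simp
    then have cU: "card {u. f (Some u) = Some w} = d" by simp
    have finU: "finite {u. f (Some u) = Some w}" using finite_iterate_fibre[OF w1(1)] by simp
    have "nF E w = (\<Sum>v | f (Some v) = Some w. e v)"
      using count_compose[OF w1(2), of E] p by (simp add: nF_def e_def F_def)
    then have "\<epsilon>' * int (nF E w) = (\<Sum>v | f (Some v) = Some w. \<epsilon>' * int (e v))" by (simp add: sum_distrib_left)
    also have "\<dots> = (\<Sum>v | f (Some v) = Some w. (c1 - m0 * int (d ^ (p - 1))) + (if v \<in> X then \<epsilon> else 0))"
    proof (rule sum.cong[OF refl])
      fix v assume v: "v \<in> {v. f (Some v) = Some w}"
      then have "v \<notin> Bad p" using Bad_preimage[of w p 1 v] w(1) by simp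
      moreover have "v \<notin> C"
      proof
        assume "v \<in> C"
        moreover have "Some w = f (Some v)" using v by simp
        ultimately have "w \<in> \<Gamma>" unfolding \<Gamma>_def by (intro CollectI image_eqI)
        then show False using w(3) by blast
      qed
      ultimately show "\<epsilon>' * int (e v) = (c1 - m0 * int (d ^ (p - 1))) + (if v \<in> X then \<epsilon> else 0)" using ev by simp
    qed
    also have "\<dots> = int d * (c1 - m0 * int (d ^ (p - 1))) + \<epsilon> * int (nf X w)"
    proof -
      have "(\<Sum>v | f (Some v) = Some w. if v \<in> X then \<epsilon> else 0) = \<epsilon> * int (nf X w)"
        using finU by (simp add: sum.If_cases nf_def Int_def conj_commute)
      then show ?thesis using cU by (simp add: sum.distrib)
    qed
    also have "int d * (c1 - m0 * int (d ^ (p - 1))) = int d * c1 - m0 * int (d ^ p)"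
    proof -
      have "d ^ p = d * d ^ (p - 1)" using power_Suc[of d "p - 1"] unfolding pq[symmetric] .
      then show ?thesis by (simp add: algebra_simps)
    qed
    also have "int (nf X w) = m0 + (if w \<in> E then \<epsilon>' else 0)" using nfX[OF w1(1) w(3)] .
    finally show ?thesis unfolding D by (simp add: algebra_simps)
  qed
  \<comment> \<open>Evaluate at \<open>w0\<close>, which lies in K: the number of its preimages in E
    is between 0 and the degree. Moreover d is odd because its power 2 c1 + \<epsilon> is.\<close>
  have d2: "int d - 2 * m0 = \<epsilon>'"
  proof (rule rational_count_arithmetic[OF \<epsilon> \<epsilon>' D])
    have "(2::nat) ^ 2 \<le> d ^ 2" using d by (intro power_mono) auto
    also have "\<dots> \<le> d ^ p" using d p by (intro power_increasing) auto
    finally show "4 \<le> int (d ^ p)" unfolding of_nat_le_iff[symmetric, where 'a = int] by (simp del: of_nat_power)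
    have "odd (int (d ^ p))" unfolding D using \<epsilon> by auto
    then have "odd (d ^ p)" by (simp only: even_of_nat simp_thms)
    then show "odd (int d)" using p by (simp add: even_of_nat)
    have "w0 \<notin> E" using EK w0(1) by blast
    moreover have "w0 \<notin> C" "w0 \<notin> \<Gamma>" using K(5) \<Gamma>K(1) w0(1) by blast+
    ultimately show "\<epsilon>' * int (nF E w0) = c1 * (int d - 2 * m0)" using NE[OF w0(2)] by simp
    have "nF E w0 \<le> card {z. F z = Some w0}"
      unfolding nF_def by (rule card_mono) (use finF[OF w0'(2), of UNIV] in auto)
    then show "int (nF E w0) \<le> int (d ^ p)" using cardF[OF w0'(2)] by simp
  qed simp
  \<comment> \<open>Subtract the preimages in E from those in X. Points of \<Gamma> contribute
    nothing for w off \<Gamma>: F commutes with f and preserves C, hence sends \<Gamma> into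
    f(C).\<close>
  have NW: "int (nF W w) = \<epsilon> * ((if w \<in> X then 1 else 0) - (if w \<in> E then 1 else 0))"
    if w: "w \<notin> Bad (p + 1)" "w \<notin> C" "w \<notin> \<Gamma>" for w
  proof -
    have wp: "w \<notin> Bad p" using w(1) Bad_mono[of p "p + 1"] by auto
    have NE': "int (nF E w) = c1 + (if w \<in> E then \<epsilon> else 0)"
      using NE[OF w] d2 \<epsilon>' by (auto simp: algebra_simps split: if_splits)
    have "F z \<noteq> Some w" if H: "z \<in> \<Gamma>" for z
    proof
      assume Fz: "F z = Some w"
      have "Some z \<in> (\<lambda>z. f (Some z)) ` C" using H by (simp add: \<Gamma>_def)
      then obtain c where c: "c \<in> C" "f (Some c) = Some z" by (elim imageE) simp
      have "F c \<in> Some ` C" unfolding inv[symmetric] using c(1) by (rule imageI)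
      then obtain c' where c': "c' \<in> C" "F c = Some c'" by (elim imageE) simp
      have "F z = (f ^^ p) (f (Some c))" using c(2) by (simp add: F_def)
      also have "\<dots> = f (F c)" unfolding F_def by (rule funpow_swap1[symmetric])
      also have "\<dots> = f (Some c')" using c' by simp
      finally have "Some w = f (Some c')" using Fz by simp
      then have "w \<in> \<Gamma>" unfolding \<Gamma>_def using c'(1) by (intro CollectI image_eqI)
      then show False using w(3) by blast
    qed
    then have "{z \<in> X. F z = Some w} = {z \<in> E. F z = Some w} \<union> {z \<in> W. F z = Some w}"
      using EX by (auto simp: W_def)
    moreover have "{z \<in> E. F z = Some w} \<inter> {z \<in> W. F z = Some w} = {}" by (auto simp: W_def)
    ultimately have "nF X w = nF E w + nF W w" unfolding nF_def using finF[OF wp] by (simp add: card_Un_disjoint)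
    then show ?thesis using NE' nFX[OF wp w(2)] by (auto split: if_splits)
  qed
  \<comment> \<open>A generic point of W has \<epsilon> preimages in W, and a count is not
    negative.\<close>
  have "\<epsilon> = 1"
  proof -
    obtain w where w: "w \<in> W" "w \<notin> Bad (p + 1)"
      by (rule open_avoids_finite[OF \<open>open W\<close> \<open>W \<noteq> {}\<close> countable_finite[OF finite_Bad]])
    then have "w \<in> X" "w \<notin> E" "w \<notin> \<Gamma>" "w \<notin> C" using K(6) by (auto simp: W_def)
    then have "int (nF W w) = \<epsilon>" using NW[OF w(2)] by simp
    then show ?thesis using \<epsilon> by auto
  qed
  show ?thesis
  proof (rule that[OF E(1,3) EX E(2) finite_Bad])
    fix w z assume w: "w \<in> K \<union> E" "w \<notin> Bad (p + 1)" and z: "z \<in> X - (E \<union> \<Gamma>)"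
    have wp: "w \<notin> Bad p" using w(2) Bad_mono[of p "p + 1"] by auto
    have "w \<notin> C" "w \<notin> \<Gamma>" "w \<in> X \<longleftrightarrow> w \<in> E" using w(1) \<Gamma>K(1) E(3) EC K(4,5) EX by blast+
    then have "int (nF W w) = 0" using NW[OF w(2)] by simp
    then have "{z \<in> W. F z = Some w} = {}" using finF[OF wp, of W] by (simp add: nF_def)
    then show "F z \<noteq> Some w" using z by (auto simp: W_def)
  qed
qed

end

section \<open>The chordal metric and the Fatou set\<close>

definition stereographic :: "riemann_sphere \<Rightarrow> complex \<times> real" where
  "stereographic x = (case x of None \<Rightarrow> (0, 1)
     | Some z \<Rightarrow> (2 * z / of_real (1 + (cmod z)\<^sup>2), 1 - 2 / (1 + (cmod z)\<^sup>2)))"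

lemma stereographic_simps [simp]:
  "stereographic None = (0, 1)"
  "stereographic (Some z) = (2 * z / of_real (1 + (cmod z)\<^sup>2), 1 - 2 / (1 + (cmod z)\<^sup>2))"
  by (simp_all add: stereographic_def)

lemma stereographic_chart_infty:
  "stereographic (chart_infty z) = (2 * cnj z / of_real (1 + (cmod z)\<^sup>2), 1 - 2 * (cmod z)\<^sup>2 / (1 + (cmod z)\<^sup>2))"
proof (cases "z = 0")
  case False
  have pos: "1 + (cmod z)\<^sup>2 > 0" "(cmod z)\<^sup>2 > 0" using False by (auto intro: add_pos_nonneg)
  have eq: "1 + (cmod (inverse z))\<^sup>2 = (1 + (cmod z)\<^sup>2) / (cmod z)\<^sup>2"
    unfolding norm_inverse using False by (simp add: power_inverse field_simps)
  have zz: "of_real ((cmod z)\<^sup>2) = z * cnj z" by (simp only: complex_norm_square)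
  have "2 * inverse z / of_real ((1 + (cmod z)\<^sup>2) / (cmod z)\<^sup>2) = 2 * (inverse z * of_real ((cmod z)\<^sup>2)) / of_real (1 + (cmod z)\<^sup>2)"
    by simp
  also have "inverse z * of_real ((cmod z)\<^sup>2) = cnj z" unfolding zz using False by simp
  finally show ?thesis using False unfolding chart_infty_def by (simp only: if_False stereographic_simps eq) simp
qed simp

text \<open>The squared chord between the stereographic images of x + i y and u + i v, whose third
  coordinates are 1 - 2 / A and 1 - 2 / B.\<close>

lemma stereographic_identity:
  fixes x y u v :: real
  defines "A \<equiv> 1 + (x\<^sup>2 + y\<^sup>2)" and "B \<equiv> 1 + (u\<^sup>2 + v\<^sup>2)"
  shows "(2 * x / A - 2 * u / B)\<^sup>2 + (2 * y / A - 2 * v / B)\<^sup>2 + (2 / A - 2 / B)\<^sup>2 = 4 * ((x - u)\<^sup>2 + (y - v)\<^sup>2) / (A * B)"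
proof -
  have "A > 0" "B > 0" unfolding A_def B_def by (auto intro: add_pos_nonneg)
  then have nz: "A \<noteq> 0" "B \<noteq> 0" by auto
  have "(2 * x / A - 2 * u / B)\<^sup>2 + (2 * y / A - 2 * v / B)\<^sup>2 + (2 / A - 2 / B)\<^sup>2
    = 4 * (A / A\<^sup>2) + 4 * (B / B\<^sup>2) - 8 * ((x * u + y * v + 1) / (A * B))"
    \<comment> \<open>Rewriting under division by the square expands A and B in the numerators
      only.\<close>
    unfolding A_def[THEN meta_eq_to_obj_eq, THEN arg_cong, of "\<lambda>t. t / A\<^sup>2"] B_def[THEN meta_eq_to_obj_eq, THEN arg_cong, of "\<lambda>t. t / B\<^sup>2"]
    by (simp add: power2_diff power_divide power_mult_distrib add_divide_distrib distrib_left)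
  also have "\<dots> = 4 * (A + B - 2 * (x * u + y * v + 1)) / (A * B)"
    using nz by (simp add: field_simps power2_eq_square)
  also have "A + B - 2 * (x * u + y * v + 1) = (x - u)\<^sup>2 + (y - v)\<^sup>2"
    unfolding A_def B_def by (simp add: power2_diff)
  finally show ?thesis .
qed

text \<open>Makes uniform continuity in the chordal metric available from Euclidean space.\<close>

lemma chordal_dist_stereographic: "chordal_dist x y = dist (stereographic x) (stereographic y)"
proof -
  have None: "2 / sqrt (1 + (cmod z)\<^sup>2) = dist (stereographic (Some z)) (stereographic None)" for z
  proof -
    have pos: "1 + (cmod z)\<^sup>2 > 0" by (auto intro: add_pos_nonneg)
    define A where "A = 1 + (cmod z)\<^sup>2"
    have A: "A > 0" using pos by (simp add: A_def)
    have "(cmod (2 * z / of_real A))\<^sup>2 + (2 / A)\<^sup>2 = 4 * (A / A\<^sup>2)"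
      using A unfolding norm_divide norm_mult norm_of_real by (simp add: power_divide power_mult_distrib A_def add_divide_distrib)
    also have "\<dots> = 4 / A" using A by (simp add: power2_eq_square)
    finally have "sqrt ((cmod (2 * z / of_real A))\<^sup>2 + (2 / A)\<^sup>2) = 2 / sqrt A" by (simp add: real_sqrt_divide)
    moreover have "dist (stereographic (Some z)) (stereographic None) = sqrt ((cmod (2 * z / of_real A))\<^sup>2 + (2 / A)\<^sup>2)"
      by (simp add: dist_Pair_Pair A_def dist_real_def)
    ultimately show ?thesis by (simp add: A_def)
  qed
  have Some: "chordal_dist (Some z) (Some w) = dist (stereographic (Some z)) (stereographic (Some w))" for z w
  proof -
    define A where "A = 1 + ((Re z)\<^sup>2 + (Im z)\<^sup>2)"
    define B where "B = 1 + ((Re w)\<^sup>2 + (Im w)\<^sup>2)"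
    have AB: "1 + (cmod z)\<^sup>2 = A" "1 + (cmod w)\<^sup>2 = B" by (simp_all add: A_def B_def cmod_power2)
    have "(dist (2 * z / of_real A) (2 * w / of_real B))\<^sup>2 + (dist (1 - 2 / A) (1 - 2 / B))\<^sup>2
      = (2 * Re z / A - 2 * Re w / B)\<^sup>2 + (2 * Im z / A - 2 * Im w / B)\<^sup>2 + (2 / A - 2 / B)\<^sup>2"
      by (simp add: dist_norm cmod_power2 power2_commute)
    also have "\<dots> = 4 * ((Re z - Re w)\<^sup>2 + (Im z - Im w)\<^sup>2) / (A * B)"
      unfolding A_def B_def by (rule stereographic_identity)
    also have "\<dots> = (2 * cmod (z - w))\<^sup>2 / (A * B)" by (simp add: power_mult_distrib cmod_power2)
    finally have "dist (stereographic (Some z)) (stereographic (Some w)) = sqrt ((2 * cmod (z - w))\<^sup>2 / (A * B))"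
      unfolding stereographic_simps AB dist_Pair_Pair by (rule arg_cong)
    then show ?thesis by (simp add: AB real_sqrt_divide real_sqrt_mult)
  qed
  show ?thesis
  proof (cases x; cases y)
    fix z w assume "x = Some z" "y = Some w" then show ?thesis using Some by simp
  next
    fix z assume "x = Some z" "y = None" then show ?thesis using None[of z] by simp
  next
    fix z assume "x = None" "y = Some z" then show ?thesis using None[of z] by (simp add: dist_commute)
  qed simp
qed

lemma hol_germ_stereographic_isCont:
  assumes "hol_germ G z"
  shows "isCont (\<lambda>w. stereographic (G w)) z"
proof -
  obtain e h where e: "e > 0" "h holomorphic_on ball z e"
    and h: "(\<forall>w\<in>ball z e. G w = Some (h w)) \<or> (\<forall>w\<in>ball z e. G w = chart_infty (h w))"
    using assms unfolding hol_germ_def by blast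
  have c: "continuous_on (ball z e) h" using e(2) by (rule holomorphic_on_imp_continuous_on)
  have pos: "1 + (cmod u)\<^sup>2 \<noteq> 0" for u using add_pos_nonneg[of 1 "(cmod u)\<^sup>2"] by simp
  then have pos': "1 + complex_of_real ((cmod u)\<^sup>2) \<noteq> 0" for u by (metis of_real_1 of_real_add of_real_eq_0_iff)
  have "continuous_on (ball z e) (\<lambda>w. stereographic (G w))"
    using h
  proof
    assume G: "\<forall>w\<in>ball z e. G w = Some (h w)"
    have "continuous_on (ball z e) (\<lambda>w. (2 * h w / of_real (1 + (cmod (h w))\<^sup>2), 1 - 2 / (1 + (cmod (h w))\<^sup>2)))"
      by (intro continuous_intros c) (use pos pos' in auto)
    then show ?thesis by (rule continuous_on_eq) (use G in auto)
  next
    assume G: "\<forall>w\<in>ball z e. G w = chart_infty (h w)"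
    have "continuous_on (ball z e) (\<lambda>w. (2 * cnj (h w) / of_real (1 + (cmod (h w))\<^sup>2), 1 - 2 * (cmod (h w))\<^sup>2 / (1 + (cmod (h w))\<^sup>2)))"
      by (intro continuous_intros c) (use pos pos' in auto)
    then show ?thesis by (rule continuous_on_eq) (use G in \<open>auto simp: stereographic_chart_infty\<close>)
  qed
  then show ?thesis using e(1) by (simp add: continuous_on_eq_continuous_at)
qed

lemma hol_germ_uniformly_continuous:
  assumes G: "\<And>z. hol_germ G z" and K: "compact K" and e: "e > 0"
  obtains \<delta> where "\<delta> > 0" "\<And>u v. u \<in> K \<Longrightarrow> v \<in> K \<Longrightarrow> dist u v < \<delta> \<Longrightarrow> chordal_dist (G u) (G v) < e"
proof -
  have "continuous_on K (\<lambda>w. stereographic (G w))"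
    by (intro continuous_at_imp_continuous_on ballI hol_germ_stereographic_isCont G)
  then have "uniformly_continuous_on K (\<lambda>w. stereographic (G w))" using K by (rule compact_uniformly_continuous)
  then obtain \<delta> where "\<delta> > 0"
    "\<forall>u\<in>K. \<forall>v\<in>K. dist v u < \<delta> \<longrightarrow> dist (stereographic (G v)) (stereographic (G u)) < e"
    unfolding uniformly_continuous_on_def using e by blast
  then show ?thesis by (intro that[of \<delta>]) (auto simp: chordal_dist_stereographic)
qed

text \<open>Under inversion, complements of compact sets correspond to neighbourhoods of 0, so the
  compactification has the topology of the two charts. This lets holomorphic germs yield continuity
  on the sphere.\<close>

lemma openin_sphere_top:
  "openin sphere_top V \<longleftrightarrow> open {z. Some z \<in> V} \<and> open {w. chart_infty w \<in> V}"
proof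
  assume V: "openin sphere_top V"
  have S: "open {z. Some z \<in> V}"
    using V continuous_map_Some[of euclidean] unfolding sphere_top_def
    by (auto simp: continuous_map_def)
  moreover have "open {w. chart_infty w \<in> V}"
  proof (rule openI)
    fix w assume w: "w \<in> {w. chart_infty w \<in> V}"
    show "\<exists>e>0. ball w e \<subseteq> {w. chart_infty w \<in> V}"
    proof (cases "w = 0")
      case True
      then have "None \<in> V" using w by simp
      then obtain C where C: "compact C" "V = insert None (Some ` (- C))"
        using V unfolding sphere_top_def openin_Alexandroff_compactification by (auto simp: Compl_eq_Diff_UNIV)
      obtain b where b: "b > 0" "\<And>x. x \<in> C \<Longrightarrow> cmod x \<le> b" using compact_imp_bounded[OF C(1)] by (auto simp: bounded_pos)
      have "chart_infty v \<in> V" if v: "v \<in> ball w (1 / b)" for v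
      proof (cases "v = 0")
        case False
        then have "cmod v < 1 / b" using v True by simp
        then have "b < 1 / cmod v" using False b(1) by (simp add: field_simps)
        then have "cmod (inverse v) > b" unfolding norm_inverse by (simp only: inverse_eq_divide)
        then have "inverse v \<notin> C" using b(2)[of "inverse v"] by linarith
        then show ?thesis using False C(2) by (auto simp: chart_infty_def)
      qed (use C(2) in auto)
      then show ?thesis using b(1) by (intro exI[of _ "1 / b"]) auto
    next
      case False
      have "continuous_on (- {0}) (inverse :: complex \<Rightarrow> complex)" by (intro continuous_intros) auto
      moreover have "open (- {0 :: complex})" by auto
      ultimately have "open (- {0 :: complex} \<inter> inverse -` {z. Some z \<in> V})" using S by (rule continuous_open_preimage)
      moreover have "w \<in> - {0} \<inter> inverse -` {z. Some z \<in> V}" using False w by (auto simp: chart_infty_def)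
      ultimately obtain e where "e > 0" "ball w e \<subseteq> - {0} \<inter> inverse -` {z. Some z \<in> V}" by (rule openE)
      then show ?thesis by (intro exI[of _ e]) (auto simp: chart_infty_def subset_iff)
    qed
  qed
  ultimately show "open {z. Some z \<in> V} \<and> open {w. chart_infty w \<in> V}" ..
next
  assume V: "open {z. Some z \<in> V} \<and> open {w. chart_infty w \<in> V}"
  show "openin sphere_top V"
  proof (cases "None \<in> V")
    case False
    then have "V = Some ` {z. Some z \<in> V}" by (auto simp: image_iff) (metis not_Some_eq)
    then show ?thesis using V unfolding sphere_top_def by (metis openin_Alexandroff_compactification_image_Some open_openin)
  next
    case True
    then have "(0::complex) \<in> {w. chart_infty w \<in> V}" by simp
    then obtain e where e: "e > 0" "ball (0::complex) e \<subseteq> {w. chart_infty w \<in> V}" using V by (meson openE)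
    define C where "C = - {z. Some z \<in> V}"
    have "C \<subseteq> cball 0 (1 / e)"
    proof
      fix z assume z: "z \<in> C"
      show "z \<in> cball 0 (1 / e)"
      proof (rule ccontr)
        assume "z \<notin> cball 0 (1 / e)"
        then have c: "cmod z > 1 / e" by simp
        then have "z \<noteq> 0" using e(1) by auto
        have "1 < cmod z * e" using c e(1) by (simp add: field_simps)
        then have "1 / cmod z < e" using \<open>z \<noteq> 0\<close> by (simp add: field_simps)
        then have "cmod (inverse z) < e" unfolding norm_inverse by (simp only: inverse_eq_divide)
        then have "chart_infty (inverse z) \<in> V" using e(2) by auto
        then show False using z \<open>z \<noteq> 0\<close> by (simp add: C_def chart_infty_def)
      qed
    qed
    then have "compact C" using V by (auto simp: C_def compact_eq_bounded_closed closed_Compl intro: bounded_subset[OF bounded_cball])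
    moreover have "V = insert None (Some ` (- C))"
      using True by (auto simp: C_def image_iff) (metis not_Some_eq)
    ultimately show ?thesis unfolding sphere_top_def openin_Alexandroff_compactification
      by (intro disjI2 exI[of _ C]) (auto simp: compact_imp_closed Compl_eq_Diff_UNIV)
  qed
qed

lemma topspace_sphere_top [simp]: "topspace sphere_top = UNIV"
  by (auto simp: sphere_top_def UNIV_option_conv)

lemma hol_germ_open_vimage:
  assumes G: "\<And>z. hol_germ G z" and V: "openin sphere_top V"
  shows "open {z. G z \<in> V}"
proof (rule openI)
  fix z assume z: "z \<in> {z. G z \<in> V}"
  have *: "\<exists>e>0. ball z e \<subseteq> {z. G z \<in> V}"
    if e: "e > 0" "h holomorphic_on ball z e" and G: "\<forall>w\<in>ball z e. G w = c (h w)" and c: "open {u. c u \<in> V}" for e h c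
  proof -
    have "open (ball z e \<inter> h -` {u. c u \<in> V})"
      using holomorphic_on_imp_continuous_on[OF e(2)] open_ball c by (rule continuous_open_preimage)
    moreover have "z \<in> ball z e \<inter> h -` {u. c u \<in> V}" using z G e(1) by auto
    ultimately obtain d where d: "d > 0" "ball z d \<subseteq> ball z e \<inter> h -` {u. c u \<in> V}" by (rule openE)
    have "G u \<in> V" if "u \<in> ball z d" for u
    proof -
      have "u \<in> ball z e \<inter> h -` {u. c u \<in> V}" using d(2) that by blast
      then show ?thesis using G by auto
    qed
    then show ?thesis using d(1) by blast
  qed
  obtain e h where "e > 0" "h holomorphic_on ball z e"
    "(\<forall>w\<in>ball z e. G w = Some (h w)) \<or> (\<forall>w\<in>ball z e. G w = chart_infty (h w))"
    using G[of z] unfolding hol_germ_def by blast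
  then show "\<exists>e>0. ball z e \<subseteq> {z. G z \<in> V}"
    using *[of e h Some] *[of e h chart_infty] V unfolding openin_sphere_top by blast
qed

lemma hol_germ_chart_infty:
  assumes "\<And>x. hol_at f x"
  shows "hol_germ (\<lambda>w. f (chart_infty w)) z"
proof (rule hol_germ_hol_at[where F = chart_infty])
  show "hol_germ chart_infty z" by (rule hol_germ_chartI[of UNIV "\<lambda>w. w"]) auto
qed (rule assms)

lemma hol_at_continuous_map:
  assumes "\<And>x. hol_at f x"
  shows "continuous_map sphere_top sphere_top f"
proof -
  have "openin sphere_top {x. f x \<in> V}" if V: "openin sphere_top V" for V
    unfolding openin_sphere_top
  proof
    show "open {z. Some z \<in> {x. f x \<in> V}}"
      using hol_germ_open_vimage[of "\<lambda>z. f (Some z)", OF _ V] assms[of "Some _"] by simp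
    show "open {z. chart_infty z \<in> {x. f x \<in> V}}"
      using hol_germ_open_vimage[of "\<lambda>z. f (chart_infty z)", OF _ V] hol_germ_chart_infty[OF assms] by simp
  qed
  then show ?thesis by (simp add: continuous_map_def)
qed

lemma compactin_sphere_top_imp_compact:
  assumes K: "compactin sphere_top K" and KS: "K \<subseteq> range Some"
  shows "compact {z. Some z \<in> K}"
  unfolding compact_eq_Heine_Borel
proof (intro allI impI, elim conjE)
  fix \<C> :: "complex set set"
  assume C: "\<forall>t\<in>\<C>. open t" "{z. Some z \<in> K} \<subseteq> \<Union>\<C>"
  have "K \<subseteq> \<Union>((`) Some ` \<C>)" using KS C(2) by fastforce
  moreover have "openin sphere_top U" if U: "U \<in> (`) Some ` \<C>" for U
    using U C(1) by (auto simp: sphere_top_def)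
  ultimately obtain \<F> where F: "finite \<F>" "\<F> \<subseteq> (`) Some ` \<C>" "K \<subseteq> \<Union>\<F>"
    using compactinD[OF K, of "(`) Some ` \<C>"] by blast
  obtain \<D> where D: "\<D> \<subseteq> \<C>" "finite \<D>" "\<F> = (`) Some ` \<D>" using finite_subset_image[OF F(1,2)] by blast
  have "{z. Some z \<in> K} \<subseteq> \<Union>\<D>"
  proof
    fix z assume "z \<in> {z. Some z \<in> K}"
    then have "Some z \<in> \<Union>\<F>" using F(3) by blast
    then show "z \<in> \<Union>\<D>" unfolding D(3) by auto
  qed
  then show "\<exists>\<D>\<subseteq>\<C>. finite \<D> \<and> {z. Some z \<in> K} \<subseteq> \<Union>\<D>" using D by blast
qed

text \<open>If infinitely many members of the sequence are the identity, they form the convergent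
  subsequence. Otherwise, after finitely many terms, each is an iterate composed with f, and
  normality near f x applies.\<close>

lemma fatou_set_vimage:
  assumes f: "continuous_map sphere_top sphere_top f" and x: "f x \<in> fatou_set UNIV f"
  shows "x \<in> fatou_set UNIV f"
proof -
  obtain U where U: "openin sphere_top U" "f x \<in> U" "normal_family_on U (range (\<lambda>n. f ^^ n))"
    using x unfolding fatou_set_def by blast
  define V where "V = {y. f y \<in> U}"
  have V: "openin sphere_top V" using openin_continuous_map_preimage[OF f U(1)] by (simp add: V_def)
  have "normal_family_on V (range (\<lambda>n. f ^^ n))"
    unfolding normal_family_on_def
  proof (intro allI impI)
    fix s :: "nat \<Rightarrow> riemann_sphere \<Rightarrow> riemann_sphere"
    assume "range s \<subseteq> range (\<lambda>n. f ^^ n)"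
    then have "\<forall>j. \<exists>m. s j = f ^^ m" by blast
    then obtain n where n: "\<And>j. s j = f ^^ n j" by metis
    show "\<exists>r g. strict_mono (r :: nat \<Rightarrow> nat) \<and> (\<forall>K. compactin sphere_top K \<and> K \<subseteq> V \<longrightarrow>
            (\<forall>e>0. \<forall>\<^sub>F m in sequentially. \<forall>z\<in>K. chordal_dist (s (r m) z) (g z) < e))"
    proof (cases "infinite {j. n j = 0}")
      case True
      then obtain r :: "nat \<Rightarrow> nat" where r: "strict_mono r" "\<And>m. r m \<in> {j. n j = 0}"
        using infinite_enumerate[of "{j. n j = 0}"] by blast
      have "s (r m) z = z" for m z using r(2)[of m] by (simp add: n)
      then show ?thesis using r(1) by (intro exI[of _ r] exI[of _ "\<lambda>z. z"]) (simp add: chordal_dist_stereographic)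
    next
      case False
      then have "finite {j. n j = 0}" by blast
      then obtain J where "\<forall>j\<in>{j. n j = 0}. j < J" unfolding finite_nat_set_iff_bounded ..
      then have J: "n (J + j) \<noteq> 0" for j by (metis mem_Collect_eq not_add_less1)
      define t where "t = (\<lambda>j. f ^^ (n (J + j) - 1))"
      have st: "s (J + j) z = t j (f z)" for j z
      proof -
        have "n (J + j) = Suc (n (J + j) - 1)" using J[of j] by simp
        then have "f ^^ n (J + j) = f ^^ Suc (n (J + j) - 1)" by (rule arg_cong)
        then show ?thesis unfolding n t_def by (simp only: funpow_Suc_right o_apply)
      qed
      have "range t \<subseteq> range (\<lambda>n. f ^^ n)" by (auto simp: t_def)
      then obtain r :: "nat \<Rightarrow> nat" and g where r: "strict_mono r"
        and lim: "\<And>K e. compactin sphere_top K \<Longrightarrow> K \<subseteq> U \<Longrightarrow> e > 0 \<Longrightarrow>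
          \<forall>\<^sub>F m in sequentially. \<forall>z\<in>K. chordal_dist (t (r m) z) (g z) < e"
        using U(3) unfolding normal_family_on_def by meson
      show ?thesis
      proof (intro exI[of _ "\<lambda>m. J + r m"] exI[of _ "\<lambda>z. g (f z)"] conjI allI impI)
        show "strict_mono (\<lambda>m. J + r m)" using r by (simp add: strict_mono_def)
        fix K and e :: real assume K: "compactin sphere_top K \<and> K \<subseteq> V" and e: "e > 0"
        have "compactin sphere_top (f ` K)" using K f image_compactin by blast
        moreover have "f ` K \<subseteq> U" using K by (auto simp: V_def)
        ultimately have "\<forall>\<^sub>F m in sequentially. \<forall>z\<in>f ` K. chordal_dist (t (r m) z) (g z) < e" using e by (rule lim)
        then show "\<forall>\<^sub>F m in sequentially. \<forall>z\<in>K. chordal_dist (s (J + r m) z) (g (f z)) < e"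
          by (simp add: st)
      qed
    qed
  qed
  then show ?thesis using V U(2) unfolding fatou_set_def iterate_domain_def V_def by blast
qed

text \<open>On U the iterate \<open>f ^^ (k * n)\<close> is conjugate to a rotation, hence
  injective, and it factors through \<open>f ^^ n\<close>.\<close>

lemma herman_ring_inj_on:
  assumes "herman_ring D f p U"
  shows "inj_on (f ^^ n) U"
proof -
  obtain \<phi> :: "riemann_sphere \<Rightarrow> complex" and V k \<theta> where \<phi>: "conformal_iso \<phi> U V" and k: "k > 0" "(f ^^ k) ` U \<subseteq> U"
    and rot: "\<And>z. z \<in> U \<Longrightarrow> \<phi> ((f ^^ k) z) = cis (2 * pi * \<theta>) * \<phi> z"
    using assms unfolding herman_ring_def by blast
  have inj: "inj_on \<phi> U" using \<phi> by (auto simp: conformal_iso_def bij_betw_def)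
  have orbit: "(f ^^ (k * m)) z \<in> U \<and> \<phi> ((f ^^ (k * m)) z) = cis (2 * pi * \<theta>) ^ m * \<phi> z" if z: "z \<in> U" for m z
  proof (induction m)
    case (Suc m)
    have "(f ^^ (k * Suc m)) z = (f ^^ k) ((f ^^ (k * m)) z)" by (simp add: funpow_add)
    then show ?case using Suc rot[of "(f ^^ (k * m)) z"] k(2) by auto
  qed (use z in auto)
  show ?thesis
  proof
    fix x y assume xy: "x \<in> U" "y \<in> U" "(f ^^ n) x = (f ^^ n) y"
    have "n \<le> k * n" using k(1) by simp
    then have kn: "k * n = (k * n - n) + n" by simp
    have "(f ^^ (k * n)) x = (f ^^ (k * n)) y"
      by (subst kn, subst (2) kn) (simp only: funpow_add o_apply xy(3))
    then have "cis (2 * pi * \<theta>) ^ n * \<phi> x = cis (2 * pi * \<theta>) ^ n * \<phi> y"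
      using orbit[OF xy(1), of n] orbit[OF xy(2), of n] by metis
    then have "\<phi> x = \<phi> y" by simp
    then show "x = y" using inj xy(1,2) by (auto dest: inj_onD)
  qed
qed

text \<open>After normalisation to the unit circle the reflection principle applies on the punctured
  plane. The centre is excluded as argument and as value because its reflection is infinity.\<close>

lemma circle_reflection_symmetry:
  assumes R: "R > 0" and F: "\<And>z. hol_germ F z" and inv: "F ` sphere a R \<subseteq> Some ` sphere a R"
    and z: "z \<noteq> a" "w \<noteq> a" "F z = Some w"
  shows "F (a + of_real (R\<^sup>2) / cnj (z - a)) = Some (a + of_real (R\<^sup>2) / cnj (w - a))"
proof -
  define F1 where "F1 = (\<lambda>u. affine (- a / of_real R) (1 / of_real R) (F (a + of_real R * u)))"
  have "hol_germ (\<lambda>u. F (a + of_real R * u)) u" for u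
    by (rule hol_germ_compose[of F "\<lambda>u. a + of_real R * u" u UNIV]) (auto intro!: F holomorphic_intros)
  then have germ: "hol_germ F1 u" for u
    unfolding F1_def by (rule hol_germ_hol_at) (use R in \<open>auto intro!: hol_at_affine\<close>)
  have circ: "u \<in> - {0} \<and> (\<exists>v. F1 u = Some v \<and> cmod v = 1)" if u: "cmod u = 1" for u
  proof -
    have "a + of_real R * u \<in> sphere a R" using u R by (simp add: dist_norm norm_mult)
    then have "F (a + of_real R * u) \<in> Some ` sphere a R" using inv by blast
    then obtain v where v: "v \<in> sphere a R" "F (a + of_real R * u) = Some v" by (elim imageE) simp
    have eq: "- a / of_real R + 1 / of_real R * v = (v - a) / of_real R" by (simp add: diff_divide_distrib)
    have "F1 u = Some ((v - a) / of_real R)" unfolding F1_def v(2) affine_simps eq ..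
    moreover have "cmod ((v - a) / of_real R) = 1" using v(1) R by (simp add: norm_divide dist_norm norm_minus_commute)
    ultimately show ?thesis using u by auto
  qed
  define u where "u = (z - a) / of_real R"
  have u0: "u \<noteq> 0" using z(1) R by (simp add: u_def)
  have "connected (- {0::complex})" by (rule connected_punctured_universe) simp
  moreover have "open (- {0::complex})" "(0::complex) \<notin> - {0}" by auto
  moreover have "inverse (cnj u) \<in> - {0}" using u0 by simp
  ultimately have "F1 (inverse (cnj u)) = reflect (F1 (inverse (cnj (inverse (cnj u)))))"
    using hol_germ_reflection_principle[of "- {0}" F1 "inverse (cnj u)"] germ circ by blast
  also have "inverse (cnj (inverse (cnj u))) = u" by simp
  also have "F1 u = Some ((w - a) / of_real R)"
  proof -
    have "a + of_real R * u = z" using R by (simp add: u_def)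
    then have "F1 u = Some (- a / of_real R + 1 / of_real R * w)" unfolding F1_def by (simp only: z(3) affine_simps)
    then show ?thesis by (simp add: diff_divide_distrib)
  qed
  also have "reflect (Some ((w - a) / of_real R)) = Some (of_real R / cnj (w - a))"
    using z(2) R by (subst reflect_simps) auto
  finally have "affine a (of_real R) (F1 (inverse (cnj u))) = Some (a + of_real R * (of_real R / cnj (w - a)))" by simp
  moreover have "affine a (of_real R) (F1 (inverse (cnj u))) = F (a + of_real R * inverse (cnj u))"
    using affine_inverse(1)[of "of_real R" a] R by (simp add: F1_def)
  moreover have "of_real R * inverse (cnj u) = of_real (R\<^sup>2) / cnj (z - a)"
    by (simp add: u_def power2_eq_square inverse_eq_divide)
  ultimately show ?thesis by (simp add: power2_eq_square)
qed

section \<open>Orbits of the region between the two curves\<close>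

lemma last_exit:
  fixes \<gamma> :: "real \<Rightarrow> 'a :: topological_space"
  assumes \<gamma>: "continuous_on UNIV \<gamma>" and E: "open E" "closed (E \<union> \<Gamma>)" and ends: "\<gamma> 0 \<in> E \<union> \<Gamma>" "\<gamma> 1 \<notin> E \<union> \<Gamma>"
  obtains t where "0 \<le> t" "t < 1" "\<gamma> t \<in> \<Gamma>" "\<And>u. t < u \<Longrightarrow> u \<le> 1 \<Longrightarrow> \<gamma> u \<notin> E \<union> \<Gamma>"
proof -
  define S where "S = {0..1} \<inter> \<gamma> -` (E \<union> \<Gamma>)"
  have "closed (\<gamma> -` (E \<union> \<Gamma>))" by (rule closed_vimage[OF E(2) \<gamma>])
  then have "compact S" unfolding S_def by (intro compact_Int_closed compact_Icc)
  moreover have "0 \<in> S" using ends by (simp add: S_def)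
  ultimately obtain t where t: "t \<in> S" "\<And>u. u \<in> S \<Longrightarrow> u \<le> t" using compact_attains_sup[of S] by blast
  have t1: "0 \<le> t" "t < 1" using t(1) ends(2) by (auto simp: S_def less_le)
  have "\<gamma> t \<notin> E"
  proof
    assume "\<gamma> t \<in> E"
    have "open (\<gamma> -` E)" by (rule open_vimage[OF E(1) \<gamma>])
    then obtain e where e: "e > 0" "ball t e \<subseteq> \<gamma> -` E" using \<open>\<gamma> t \<in> E\<close> by (metis openE vimageI)
    define u where "u = min 1 (t + e / 2)"
    have "u \<in> ball t e" using e t1 by (auto simp: u_def dist_real_def min_def)
    then have "u \<in> S" using e t1 by (auto simp: S_def u_def)
    then have "u \<le> t" by (rule t(2))
    then show False using e t1 by (auto simp: u_def min_def split: if_splits)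
  qed
  then have "\<gamma> t \<in> \<Gamma>" using t(1) by (auto simp: S_def)
  moreover have "\<gamma> u \<notin> E \<union> \<Gamma>" if u: "t < u" "u \<le> 1" for u
    using t(2)[of u] u t1 by (auto simp: S_def)
  ultimately show ?thesis using that t1 by blast
qed

context generic_degree
begin

lemma countable_iterate_fibre: "countable {z. (f ^^ n) (Some z) = x}"
proof (rule countable_no_limit_points)
  fix y
  show "\<not> y islimpt {z. (f ^^ n) (Some z) = x}"
  proof
    assume y: "y islimpt {z. (f ^^ n) (Some z) = x}"
    have const: "(f ^^ n) (Some z) = x" for z
      by (rule hol_germ_identity[of UNIV "\<lambda>z. (f ^^ n) (Some z)" "\<lambda>_. x" y])
        (use y in \<open>auto intro: germ_iterate hol_germ_const\<close>)
    have "countable (insert (the x) (Bad n))" using finite_Bad[of n] by (simp add: countable_finite)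
    then obtain w where w: "w \<notin> insert (the x) (Bad n)" by (rule open_avoids_finite[OF open_UNIV UNIV_not_empty])
    have "card {z. (f ^^ n) (Some z) = Some w} \<noteq> 0" using card_iterate_fibre[of w n] w d by simp
    then have "{z. (f ^^ n) (Some z) = Some w} \<noteq> {}" by (metis card.empty)
    then obtain z where "(f ^^ n) (Some z) = Some w" by blast
    then show False using const[of z] w by auto
  qed
qed

text \<open>One application of \<open>f ^^ p\<close> leads from W into A only through the finitely
  many values in \<open>Bd\<close>, and from outside both sets never. If an orbit entered the open
  set Q, so would the orbits of an open set of starting points; all but countably many of these
  never meet \<open>Bd\<close> or infinity and therefore stay out of A.\<close>

lemma orbit_avoids:
  assumes W: "open W" "W \<inter> A = {}" and Bd: "finite Bd"
    and step: "\<And>z w. z \<in> W \<Longrightarrow> w \<in> A \<Longrightarrow> w \<notin> Bd \<Longrightarrow> (f ^^ p) (Some z) \<noteq> Some w"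
    and rest: "\<And>z w. z \<notin> W \<union> A \<Longrightarrow> (f ^^ p) (Some z) = Some w \<Longrightarrow> w \<notin> A"
    and Q: "openin sphere_top Q" "Q \<subseteq> insert None (Some ` A)" and z0: "z0 \<in> W"
  shows "(f ^^ (p * k)) (Some z0) \<notin> Q"
proof
  assume "(f ^^ (p * k)) (Some z0) \<in> Q"
  then have "z0 \<in> W \<inter> {z. (f ^^ (p * k)) (Some z) \<in> Q}" using z0 by simp
  moreover have "open (W \<inter> {z. (f ^^ (p * k)) (Some z) \<in> Q})"
    using W(1) hol_germ_open_vimage[OF germ_iterate Q(1)] by (rule open_Int)
  moreover have "countable (\<Union>n. \<Union>x\<in>insert None (Some ` Bd). {z. (f ^^ n) (Some z) = x})"
    by (intro countable_UN[OF countableI_type] countable_UN[OF countable_finite] countable_iterate_fibre) (use Bd in simp)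
  ultimately obtain z where z: "z \<in> W \<inter> {z. (f ^^ (p * k)) (Some z) \<in> Q}"
    and generic: "z \<notin> (\<Union>n. \<Union>x\<in>insert None (Some ` Bd). {z. (f ^^ n) (Some z) = x})"
    using open_avoids_finite by (metis empty_iff)
  have "\<exists>w. (f ^^ (p * i)) (Some z) = Some w \<and> w \<notin> A" for i
  proof (induction i)
    case 0
    then show ?case using z W(2) by auto
  next
    case (Suc i)
    then obtain w where w: "(f ^^ (p * i)) (Some z) = Some w" "w \<notin> A" by blast
    have next_it: "(f ^^ (p * Suc i)) (Some z) = (f ^^ p) (Some w)" by (simp add: funpow_add w(1))
    have "(f ^^ (p * Suc i)) (Some z) \<notin> insert None (Some ` Bd)" using generic by blast
    then obtain v where v: "(f ^^ (p * Suc i)) (Some z) = Some v" "v \<notin> Bd" by (cases "(f ^^ (p * Suc i)) (Some z)") auto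
    have "(f ^^ p) (Some w) = Some v" using v(1) next_it by simp
    then have "v \<notin> A" using step[of w v] rest[of w v] w(2) v(2) by blast
    then show ?case using v(1) by blast
  qed
  then obtain w where "(f ^^ (p * k)) (Some z) = Some w" "w \<notin> A" by blast
  then show False using z Q(2) by auto
qed

text \<open>In the coordinate T the iterates \<open>f ^^ (p * k)\<close> are bounded on W, so
  Montel's theorem applies to them. Any sequence of iterates has infinitely many exponents in one
  residue class i modulo p; composing with \<open>f ^^ i\<close> after the left inverse T' keeps
  uniform convergence, by uniform continuity on a closed disc.\<close>

lemma bounded_iterates_fatou:
  assumes p: "p > 0" and W: "open W" and T: "\<And>x. hol_at T x" "\<And>x. hol_at T' x" "\<And>x. T' (T x) = x"
    and B: "\<And>z k. z \<in> W \<Longrightarrow> \<exists>u. T ((f ^^ (p * k)) (Some z)) = Some u \<and> cmod u \<le> B"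
  shows "Some ` W \<subseteq> fatou_set UNIV f"
proof -
  define h where "h = (\<lambda>k z. the (T ((f ^^ (p * k)) (Some z))))"
  have h: "T ((f ^^ (p * k)) (Some z)) = Some (h k z)" "cmod (h k z) \<le> B" if z: "z \<in> W" for k z
    using B[OF z, of k] by (auto simp: h_def)
  have "h k holomorphic_on W" for k
    unfolding h_def
  proof (rule hol_germ_holomorphic[OF W], intro conjI)
    fix z assume "z \<in> W"
    show "hol_germ (\<lambda>z. T ((f ^^ (p * k)) (Some z))) z" by (rule hol_germ_hol_at[OF germ_iterate T(1)])
    show "T ((f ^^ (p * k)) (Some z)) \<noteq> None" using h(1)[OF \<open>z \<in> W\<close>] by simp
  qed
  then have holo: "g holomorphic_on W" if "g \<in> range h" for g using that by auto
  have bdd: "\<exists>B. \<forall>g\<in>range h. \<forall>z\<in>K. cmod (g z) \<le> B" if K: "K \<subseteq> W" for K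
    using K h(2) by (intro exI[of _ B]) auto
  have "normal_family_on (Some ` W) (range (\<lambda>n. f ^^ n))"
    unfolding normal_family_on_def
  proof (intro allI impI)
    fix s :: "nat \<Rightarrow> riemann_sphere \<Rightarrow> riemann_sphere"
    assume "range s \<subseteq> range (\<lambda>n. f ^^ n)"
    then have "\<forall>j. \<exists>m. s j = f ^^ m" by blast
    then obtain n where n: "\<And>j. s j = f ^^ n j" by metis
    have "finite ((\<lambda>j. n j mod p) ` UNIV)" by (rule finite_subset[of _ "{..<p}"]) (use p in auto)
    then obtain i where "infinite {j. n j mod p = i}" using pigeonhole_infinite[of UNIV "\<lambda>j. n j mod p"] by auto
    then obtain r1 :: "nat \<Rightarrow> nat" where r1: "strict_mono r1" "\<And>m. n (r1 m) mod p = i"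
      using infinite_enumerate[of "{j. n j mod p = i}"] by blast
    define k where "k = (\<lambda>m. n (r1 m) div p)"
    have nk: "n (r1 m) = i + p * k m" for m unfolding k_def r1(2)[of m, symmetric] by simp
    have rng: "range (\<lambda>m. h (k m)) \<subseteq> range h" by auto
    obtain g r2 where r2: "strict_mono (r2 :: nat \<Rightarrow> nat)"
      and ptw: "\<And>x. x \<in> W \<Longrightarrow> (\<lambda>m. h (k (r2 m)) x) \<longlonglongrightarrow> g x"
      and unif: "\<And>K. compact K \<Longrightarrow> K \<subseteq> W \<Longrightarrow> uniform_limit K ((\<lambda>m. h (k m)) \<circ> r2) g sequentially"
      by (rule Montel[OF W holo bdd rng]) blast+
    have gB: "cmod (g x) \<le> B" if x: "x \<in> W" for x
      by (rule Lim_norm_ubound[OF _ ptw[OF x]]) (use h(2)[OF x] in auto)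
    define G where "G = (\<lambda>u. (f ^^ i) (T' (Some u)))"
    have "hol_germ (\<lambda>u. T' (Some u)) u" for u using T(2)[of "Some u"] by simp
    then have G: "hol_germ G u" for u unfolding G_def by (rule hol_germ_hol_at[OF _ hol_iterate])
    have sG: "s (r1 m) (Some z) = G (h (k m) z)" if z: "z \<in> W" for m z
    proof -
      have "s (r1 m) (Some z) = (f ^^ i) ((f ^^ (p * k m)) (Some z))" unfolding n nk by (simp only: funpow_add o_apply)
      then show ?thesis unfolding G_def h(1)[OF z, symmetric] T(3) .
    qed
    show "\<exists>r g. strict_mono (r :: nat \<Rightarrow> nat) \<and> (\<forall>K. compactin sphere_top K \<and> K \<subseteq> Some ` W \<longrightarrow>
            (\<forall>e>0. \<forall>\<^sub>F m in sequentially. \<forall>z\<in>K. chordal_dist (s (r m) z) (g z) < e))"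
    proof (intro exI[of _ "\<lambda>m. r1 (r2 m)"] exI[of _ "\<lambda>x. G (g (the x))"] conjI allI impI)
      show "strict_mono (\<lambda>m. r1 (r2 m))" using r1(1) r2 by (auto simp: strict_mono_def)
      fix K and e :: real assume K: "compactin sphere_top K \<and> K \<subseteq> Some ` W" and e: "e > 0"
      define K' where "K' = {z. Some z \<in> K}"
      have K': "compact K'" "K' \<subseteq> W"
        unfolding K'_def by (rule compactin_sphere_top_imp_compact) (use K in auto)
      obtain \<delta> where \<delta>: "\<delta> > 0"
        "\<And>u v. u \<in> cball 0 B \<Longrightarrow> v \<in> cball 0 B \<Longrightarrow> dist u v < \<delta> \<Longrightarrow> chordal_dist (G u) (G v) < e"
        by (rule hol_germ_uniformly_continuous[OF G compact_cball[of 0 B] e]) blast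
      have "\<forall>\<^sub>F m in sequentially. \<forall>z\<in>K'. dist (((\<lambda>m. h (k m)) \<circ> r2) m z) (g z) < \<delta>"
        by (rule uniform_limitD[OF unif[OF K'] \<delta>(1)])
      then show "\<forall>\<^sub>F m in sequentially. \<forall>x\<in>K. chordal_dist (s (r1 (r2 m)) x) (G (g (the x))) < e"
      proof (rule eventually_mono)
        fix m assume m: "\<forall>z\<in>K'. dist (((\<lambda>m. h (k m)) \<circ> r2) m z) (g z) < \<delta>"
        show "\<forall>x\<in>K. chordal_dist (s (r1 (r2 m)) x) (G (g (the x))) < e"
        proof
          fix x assume x: "x \<in> K"
          then obtain z where z: "z \<in> W" "x = Some z" using K by blast
          then have "z \<in> K'" using x by (simp add: K'_def)
          then have "dist (h (k (r2 m)) z) (g z) < \<delta>" using m by simp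
          then have "chordal_dist (G (h (k (r2 m)) z)) (G (g z)) < e"
            by (intro \<delta>(2)) (use h(2)[OF z(1)] gB[OF z(1)] in auto)
          then show "chordal_dist (s (r1 (r2 m)) x) (G (g (the x))) < e" using sG[OF z(1)] z(2) by simp
        qed
      qed
    qed
  qed
  moreover have "openin sphere_top (Some ` W)" using W by (simp add: sphere_top_def)
  ultimately show ?thesis unfolding fatou_set_def iterate_domain_def by blast
qed

end

section \<open>Excluding invariant circles in a rational Herman ring\<close>

lemma openin_sphere_top_exterior: "openin sphere_top (- Some ` cball a R)"
proof -
  have "x \<in> - Some ` cball a R \<longleftrightarrow> x \<in> insert None (Some ` (- cball a R))" for x by (cases x) auto
  then have "- Some ` cball a R = insert None (Some ` (- cball a R))" by blast
  then show ?thesis unfolding sphere_top_def openin_Alexandroff_compactification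
    by (intro disjI2 exI[of _ "cball a R"]) (auto simp: Compl_eq_Diff_UNIV)
qed

lemma openin_sphere_top_ball: "openin sphere_top (Some ` ball a R)"
  by (simp add: sphere_top_def)

context generic_degree
begin

text \<open>W is not known to be connected. Therefore a segment from f(C) to C is cut at its last
  point in \<open>E \<union> \<Gamma>\<close>; the remainder starts on \<Gamma>, runs through W and
  ends on C, so it joins f(A) to A within the Fatou set.\<close>

lemma no_invariant_circle_in_herman_ring:
  assumes A: "herman_ring UNIV f p A" and p: "p \<ge> 2" and R: "R > 0"
    and C: "Some ` sphere a R \<subseteq> A" and inv: "(f ^^ p) ` Some ` sphere a R = Some ` sphere a R"
  shows False
proof -
  define Fatou where "Fatou = fatou_set UNIV f"
  have comp: "A \<in> connected_components_of (subtopology sphere_top Fatou)"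
    using A unfolding herman_ring_def fatou_component_def Fatou_def by blast
  have per: "(f ^^ p) ` A \<subseteq> A" "\<And>q. 0 < q \<Longrightarrow> q < p \<Longrightarrow> \<not> (f ^^ q) ` A \<subseteq> A"
    using A unfolding herman_ring_def exact_period_def by blast+
  have AF: "A \<subseteq> Fatou" and conA: "connectedin sphere_top A"
    using connectedin_connected_components_of[OF comp] by (auto simp: connectedin_subtopology)
  have maximal: "S \<subseteq> A" if "connectedin sphere_top S" "S \<subseteq> Fatou" "S \<inter> A \<noteq> {}" for S
    by (rule connected_components_of_maximal[OF comp])
      (use that in \<open>auto simp: connectedin_subtopology disjnt_def Int_commute\<close>)
  \<comment> \<open>\<open>f ^^ (p - 1)\<close> maps f(A) back into A, and the Fatou set is backward
    invariant.\<close>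
  have fA: "f ` A \<subseteq> Fatou"
  proof
    fix y assume "y \<in> f ` A"
    then obtain x where x: "x \<in> A" "y = f x" by blast
    have pull: "(f ^^ m) y \<in> Fatou \<Longrightarrow> y \<in> Fatou" for m
    proof (induction m)
      case (Suc m)
      then show ?case using fatou_set_vimage[OF hol_at_continuous_map[OF hol], of "(f ^^ m) y"] by (simp add: Fatou_def)
    qed simp
    have "(f ^^ Suc (p - 1)) x \<in> A" using per(1) p x(1) by auto
    then have "(f ^^ (p - 1)) y \<in> Fatou" unfolding funpow_Suc_right x(2) using AF by auto
    then show "y \<in> Fatou" by (rule pull)
  qed
  have confA: "connectedin sphere_top (f ` A)"
    by (rule connectedin_continuous_map_image[OF hol_at_continuous_map[OF hol] conA])
  \<comment> \<open>If f(A) met A, maximality of the component would give f(A) inside A, against the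
    exact period p >= 2.\<close>
  have disj: "f ` A \<inter> A = {}"
  proof (rule ccontr)
    assume "f ` A \<inter> A \<noteq> {}"
    then have "(f ^^ 1) ` A \<subseteq> A" using maximal[OF confA fA] by simp
    moreover have "\<not> (f ^^ 1) ` A \<subseteq> A" by (rule per(2)) (use p in simp_all)
    ultimately show False by blast
  qed
  define \<Gamma> where "\<Gamma> = {w. Some w \<in> (\<lambda>z. f (Some z)) ` sphere a R}"
  have \<Gamma>A: "Some w \<in> f ` A" if "w \<in> \<Gamma>" for w using that C by (auto simp: \<Gamma>_def)
  have inj: "inj_on (\<lambda>z. (f ^^ n) (Some z)) (sphere a R)" for n
  proof (rule inj_onI)
    fix x y assume "x \<in> sphere a R" "y \<in> sphere a R" "(f ^^ n) (Some x) = (f ^^ n) (Some y)"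
    then show "x = y" using inj_onD[OF herman_ring_inj_on[OF A], of n "Some x" "Some y"] C by blast
  qed
  have aR: "a + of_real R \<in> sphere a R" "a - of_real R \<in> sphere a R" using R by (simp_all add: dist_norm)
  \<comment> \<open>f(C) is connected and misses C, so it lies on one side; K is the other. In the
    separation argument the exterior includes infinity, since f may have a pole on C.\<close>
  obtain X K where XK: "X = ball a R \<and> K = - cball a R \<or> X = - cball a R \<and> K = ball a R"
    and img: "\<And>c. c \<in> sphere a R \<Longrightarrow> f (Some c) \<notin> Some ` (K \<union> sphere a R)"
  proof -
    define S where "S = (\<lambda>z. f (Some z)) ` sphere a R"
    have "connectedin sphere_top (Some ` sphere a R)"
      unfolding sphere_top_def by (rule connectedin_continuous_map_image[OF continuous_map_Some]) (simp add: connected_sphere)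
    then have "connectedin sphere_top (f ` Some ` sphere a R)"
      by (rule connectedin_continuous_map_image[OF hol_at_continuous_map[OF hol]])
    then have con: "connectedin sphere_top S" by (simp add: S_def image_image)
    have out: "S \<inter> Some ` sphere a R = {}" using disj C by (auto simp: S_def)
    have cov: "S \<subseteq> Some ` ball a R \<union> (- Some ` cball a R)"
    proof
      fix x assume x: "x \<in> S"
      show "x \<in> Some ` ball a R \<union> (- Some ` cball a R)"
      proof (rule ccontr)
        assume n: "x \<notin> Some ` ball a R \<union> (- Some ` cball a R)"
        then obtain w where w: "x = Some w" "w \<in> cball a R" by blast
        then have "w \<in> sphere a R" using n by (auto simp: less_le)
        then show False using w(1) x out by blast
      qed
    qed
    have "Some ` ball a R \<inter> S = {} \<or> (- Some ` cball a R) \<inter> S = {}"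
    proof (rule ccontr)
      assume n: "\<not> (Some ` ball a R \<inter> S = {} \<or> (- Some ` cball a R) \<inter> S = {})"
      have "Some ` ball a R \<inter> (- Some ` cball a R) \<inter> S = {}" by auto
      then show False using con n cov openin_sphere_top_ball[of a R] openin_sphere_top_exterior[of a R]
        unfolding connectedin by blast
    qed
    then show ?thesis
    proof
      assume S: "Some ` ball a R \<inter> S = {}"
      have "f (Some c) \<notin> Some ` (ball a R \<union> sphere a R)" if "c \<in> sphere a R" for c
      proof -
        have "f (Some c) \<in> S" using that by (simp add: S_def)
        then show ?thesis using S out unfolding image_Un by blast
      qed
      then show ?thesis using that[of "- cball a R" "ball a R"] by blast
    next
      assume S: "(- Some ` cball a R) \<inter> S = {}"
      have "f (Some c) \<notin> Some ` (- cball a R \<union> sphere a R)" if "c \<in> sphere a R" for c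
      proof -
        have "f (Some c) \<in> S" using that by (simp add: S_def)
        then have "f (Some c) \<in> Some ` cball a R" "f (Some c) \<notin> Some ` sphere a R" using S out by blast+
        moreover from this obtain v where "f (Some c) = Some v" "v \<in> cball a R" by (elim imageE)
        ultimately show ?thesis by auto
      qed
      then show ?thesis using that[of "ball a R" "- cball a R"] by blast
    qed
  qed
  define s where "s = (\<lambda>z. a + of_real (R\<^sup>2) / cnj (z - a))"
  have s: "s z \<noteq> a \<and> s (s z) = z \<and> (s z \<in> K \<longleftrightarrow> z \<in> X)" if z: "z \<noteq> a" for z
  proof -
    have pos: "cmod (z - a) > 0" using z by simp
    have n: "cmod (s z - a) = R\<^sup>2 / cmod (z - a)" unfolding s_def add_diff_cancel_left' norm_divide norm_of_real complex_mod_cnj by simp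
    then have "cmod (s z - a) > 0" using pos R by simp
    then have "s z \<noteq> a" by auto
    moreover have "s (s z) = z" using z R by (simp add: s_def)
    moreover have "cmod (s z - a) < R \<longleftrightarrow> R < cmod (z - a)" "cmod (s z - a) > R \<longleftrightarrow> R > cmod (z - a)"
      unfolding n using pos R by (simp_all add: field_simps power2_eq_square)
    then have "s z \<in> K \<longleftrightarrow> z \<in> X" using XK by (auto simp: dist_norm norm_minus_commute[of a] not_le)
    ultimately show ?thesis by blast
  qed
  have invF: "(\<lambda>z. (f ^^ p) (Some z)) ` sphere a R = Some ` sphere a R" using inv by (simp add: image_image)
  have sF: "(f ^^ p) (Some (s z)) = Some (s w)" if "z \<noteq> a" "w \<noteq> a" "(f ^^ p) (Some z) = Some w" for z w
    unfolding s_def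
    by (rule circle_reflection_symmetry[OF R germ_iterate _ that]) (use invF in simp)
  have inj1: "inj_on (\<lambda>z. f (Some z)) (sphere a R)" using inj[of 1] by simp
  obtain E Bd where E: "open E" "E \<inter> \<Gamma> = {}" "E \<subseteq> X" "closed (E \<union> \<Gamma>)" and Bd: "finite Bd"
    and step: "\<And>w z. w \<in> K \<union> E \<Longrightarrow> w \<notin> Bd \<Longrightarrow> z \<in> X - (E \<union> \<Gamma>) \<Longrightarrow> (f ^^ p) (Some z) \<noteq> Some w"
  proof (rule invariant_region[OF p R inj1 inj invF XK img s sF, folded \<Gamma>_def])
    fix E Bd
    assume "open E" "E \<inter> \<Gamma> = {}" "E \<subseteq> X" "closed (E \<union> \<Gamma>)" "finite Bd"
      "\<And>w z. w \<in> K \<union> E \<Longrightarrow> w \<notin> Bd \<Longrightarrow> z \<in> X - (E \<union> \<Gamma>) \<Longrightarrow> (f ^^ p) (Some z) \<noteq> Some w"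
    then show thesis by (rule that)
  qed
  define W where "W = X - (E \<union> \<Gamma>)"
  have part: "K \<inter> X = {}" "K \<inter> sphere a R = {}" "X \<inter> sphere a R = {}" "K \<union> X \<union> sphere a R = UNIV" "open X"
    using XK by auto
  have \<Gamma>K: "\<Gamma> \<inter> (K \<union> sphere a R) = {}"
  proof -
    have "w \<notin> K \<union> sphere a R" if w: "w \<in> \<Gamma>" for w
    proof -
      have "Some w \<in> (\<lambda>z. f (Some z)) ` sphere a R" using w by (simp add: \<Gamma>_def)
      then obtain c where "c \<in> sphere a R" "f (Some c) = Some w" by (elim imageE) simp
      then show ?thesis using img[of c] by auto
    qed
    then show ?thesis by blast
  qed
  have W: "open W" "W \<inter> (K \<union> E) = {}"
    unfolding W_def using open_Diff[OF part(5) E(4)] part(1) by auto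
  have rest: "w \<notin> K \<union> E" if zw: "z \<notin> W \<union> (K \<union> E)" "(f ^^ p) (Some z) = Some w" for z w
  proof -
    have "z \<in> sphere a R \<or> z \<in> \<Gamma>" using zw(1) part(4) by (auto simp: W_def)
    then show ?thesis
    proof
      assume "z \<in> sphere a R"
      then have "Some w \<in> Some ` sphere a R" using zw(2) unfolding invF[symmetric] by (intro image_eqI[of _ _ z]) auto
      then have "w \<in> sphere a R" by blast
      then show ?thesis using part(2,3) E(3) by blast
    next
      assume "z \<in> \<Gamma>"
      then have "Some z \<in> (\<lambda>z. f (Some z)) ` sphere a R" by (simp add: \<Gamma>_def)
      then obtain c where c: "c \<in> sphere a R" "f (Some c) = Some z" by (elim imageE) simp
      have "(f ^^ p) (Some c) \<in> Some ` sphere a R" unfolding invF[symmetric] using c(1) by (rule imageI)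
      then obtain c' where c': "c' \<in> sphere a R" "(f ^^ p) (Some c) = Some c'" by (elim imageE) simp
      have "Some w = (f ^^ p) (f (Some c))" using zw(2) c(2) by simp
      also have "\<dots> = f ((f ^^ p) (Some c))" by (rule funpow_swap1[symmetric])
      also have "\<dots> = f (Some c')" using c'(2) by simp
      finally have "w \<in> \<Gamma>" unfolding \<Gamma>_def using c'(1) by (intro CollectI image_eqI)
      then show ?thesis using \<Gamma>K E(2) by blast
    qed
  qed
  have step': "(f ^^ p) (Some z) \<noteq> Some w" if "z \<in> W" "w \<in> K \<union> E" "w \<notin> Bd" for z w
    by (rule step) (use that in \<open>auto simp: W_def\<close>)
  have avoid: "(f ^^ (p * k)) (Some z) \<notin> Q"
    if "openin sphere_top Q" "Q \<subseteq> insert None (Some ` (K \<union> E))" "z \<in> W" for Q z k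
    by (rule orbit_avoids[OF W Bd step' rest that])
  have p0: "p > 0" using p by simp
  \<comment> \<open>By \<open>avoid\<close> the orbits from W under the p-th iterate never enter K,
    nor infinity when K is the exterior. They are bounded as they stand if K is the exterior, and in
    the coordinate 1 / (z - a) if K is the disc.\<close>
  have WF: "Some ` W \<subseteq> Fatou"
    unfolding Fatou_def using XK
  proof (elim disjE conjE)
    assume X: "X = ball a R" "K = - cball a R"
    show "Some ` W \<subseteq> fatou_set UNIV f"
    proof (rule bounded_iterates_fatou[OF p0 W(1), of "\<lambda>x. x" "\<lambda>x. x" "cmod a + R"])
      show "hol_at (\<lambda>x. x) x" "hol_at (\<lambda>x. x) x" for x
        by (cases x; auto intro: hol_germ_SomeI[of UNIV "\<lambda>z. z"] hol_germ_chartI[of UNIV "\<lambda>z. z"])+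
      fix z k assume z: "z \<in> W"
      have "x \<in> insert None (Some ` (K \<union> E))" if "x \<in> - Some ` cball a R" for x using that X by (cases x) auto
      then have "- Some ` cball a R \<subseteq> insert None (Some ` (K \<union> E))" by blast
      then have "(f ^^ (p * k)) (Some z) \<in> Some ` cball a R" using avoid[OF openin_sphere_top_exterior _ z, of a R k] by blast
      then obtain u where u: "u \<in> cball a R" "(f ^^ (p * k)) (Some z) = Some u" by (elim imageE) simp
      have "cmod u \<le> cmod a + cmod (u - a)" by (rule norm_triangle_sub)
      then show "\<exists>u. (f ^^ (p * k)) (Some z) = Some u \<and> cmod u \<le> cmod a + R"
        using u by (auto simp: dist_norm norm_minus_commute)
    qed simp
  next
    assume X: "X = - cball a R" "K = ball a R"
    show "Some ` W \<subseteq> fatou_set UNIV f"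
    proof (rule bounded_iterates_fatou[OF p0 W(1), of "\<lambda>x. sphere_inv (affine (- a) 1 x)" "\<lambda>x. affine a 1 (sphere_inv x)" "1 / R"])
      show "hol_at (\<lambda>x. sphere_inv (affine (- a) 1 x)) x" "hol_at (\<lambda>x. affine a 1 (sphere_inv x)) x" for x
        by (rule hol_at_compose; simp add: hol_at_affine hol_at_sphere_inv)+
      show "affine a 1 (sphere_inv (sphere_inv (affine (- a) 1 x))) = x" for x
        using affine_inverse(1)[of 1 a x] by simp
      fix z k assume z: "z \<in> W"
      have n: "(f ^^ (p * k)) (Some z) \<notin> Some ` ball a R" using avoid[OF openin_sphere_top_ball _ z, of a R k] X by blast
      show "\<exists>u. sphere_inv (affine (- a) 1 ((f ^^ (p * k)) (Some z))) = Some u \<and> cmod u \<le> 1 / R"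
      proof (cases "(f ^^ (p * k)) (Some z)")
        case None
        then show ?thesis using R by simp
      next
        case (Some v)
        then have "R \<le> cmod (v - a)" using n by (auto simp: dist_norm norm_minus_commute image_iff not_less)
        moreover from this have "v \<noteq> a" using R by auto
        moreover have "cmod (inverse (v - a)) = 1 / cmod (v - a)" unfolding norm_inverse by (simp only: inverse_eq_divide)
        ultimately have "cmod (inverse (v - a)) \<le> 1 / R" using R by (simp only: frac_le)
        then show ?thesis using Some \<open>v \<noteq> a\<close> by (intro exI[of _ "inverse (v - a)"]) (simp add: chart_infty_def)
      qed
    qed
  qed
  \<comment> \<open>f(C) may contain infinity, but by injectivity f is not infinite at both of two
    antipodal points, so \<Gamma> is not empty.\<close>
  obtain w where w: "w \<in> \<Gamma>"
  proof -
    have "f (Some (a + of_real R)) \<noteq> f (Some (a - of_real R))"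
    proof
      assume "f (Some (a + of_real R)) = f (Some (a - of_real R))"
      then have "a + of_real R = a - of_real R" using inj1 aR by (auto dest: inj_onD)
      then show False using R by (simp add: eq_diff_eq add.assoc)
    qed
    then obtain c v where "c \<in> sphere a R" "f (Some c) = Some v" using aR by (metis not_None_eq)
    then show ?thesis by (intro that[of v]) (auto simp: \<Gamma>_def image_iff intro!: bexI[of _ c])
  qed
  have wX: "w \<in> X" using w \<Gamma>K part(4) by blast
  obtain c where c: "c \<in> sphere a R" and seg: "\<And>u. 0 \<le> u \<Longrightarrow> u < 1 \<Longrightarrow> linepath w c u \<in> X"
    using XK
  proof (elim disjE conjE)
    assume X: "X = ball a R" "K = - cball a R"
    show ?thesis
    proof (rule that[OF aR(1)])
      fix u :: real assume u: "0 \<le> u" "u < 1"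
      have "linepath w (a + of_real R) u - a = of_real (1 - u) * (w - a) + of_real (u * R)"
        by (simp add: linepath_def scaleR_conv_of_real algebra_simps)
      also have "cmod \<dots> \<le> (1 - u) * cmod (w - a) + u * R"
        using norm_triangle_ineq[of "of_real (1 - u) * (w - a)" "of_real (u * R)"] u R by (simp add: norm_mult del: of_real_diff of_real_mult)
      also have "\<dots> < (1 - u) * R + u * R"
        using u wX X by (simp add: dist_norm norm_minus_commute)
      finally show "linepath w (a + of_real R) u \<in> X" using X by (simp add: dist_norm norm_minus_commute algebra_simps)
    qed
  next
    assume X: "X = - cball a R" "K = ball a R"
    define \<rho> where "\<rho> = cmod (w - a)"
    have \<rho>: "\<rho> > R" using wX X by (simp add: \<rho>_def dist_norm norm_minus_commute)
    \<comment> \<open>The radial projection of w onto the circle; the segment towards it stays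
      outside the closed disc until it ends.\<close>
    define c where "c = a + of_real (R / \<rho>) * (w - a)"
    have "c \<in> sphere a R" using \<rho> R by (simp add: c_def dist_norm norm_mult \<rho>_def[symmetric] del: of_real_divide)
    moreover have "linepath w c u \<in> X" if u: "0 \<le> u" "u < 1" for u
    proof -
      have "linepath w c u - a = of_real ((1 - u) + u * (R / \<rho>)) * (w - a)"
        by (simp add: linepath_def scaleR_conv_of_real c_def algebra_simps)
      moreover have nn: "(1 - u) + u * (R / \<rho>) \<ge> 0" using u \<rho> R by simp
      ultimately have "cmod (linepath w c u - a) = ((1 - u) + u * (R / \<rho>)) * \<rho>"
        by (simp only: norm_mult norm_of_real abs_of_nonneg \<rho>_def[symmetric])
      also have "\<dots> = (1 - u) * \<rho> + u * R" using \<rho> R by (simp add: field_simps)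
      also have "\<dots> > (1 - u) * R + u * R" using u \<rho> by simp
      finally show ?thesis using X by (simp add: dist_norm norm_minus_commute algebra_simps)
    qed
    ultimately show ?thesis by (rule that)
  qed
  have "linepath w c 0 \<in> E \<union> \<Gamma>" "linepath w c 1 \<notin> E \<union> \<Gamma>"
    using w c \<Gamma>K part(3) E(3) by (auto simp: linepath_def)
  then obtain t where t: "0 \<le> t" "t < 1" "linepath w c t \<in> \<Gamma>" "\<And>u. t < u \<Longrightarrow> u \<le> 1 \<Longrightarrow> linepath w c u \<notin> E \<union> \<Gamma>"
    by (rule last_exit[OF continuous_on_linepath E(1,4)]) blast
  define P where "P = Some ` linepath w c ` {t..1}"
  have "connected (linepath w c ` {t..1})"
    by (intro connected_continuous_image continuous_on_linepath connected_Icc)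
  then have "connectedin sphere_top P"
    unfolding P_def sphere_top_def by (intro connectedin_continuous_map_image[OF continuous_map_Some]) simp
  moreover have "P \<subseteq> Fatou"
  proof
    fix x assume "x \<in> P"
    then obtain u where u: "x = Some (linepath w c u)" "t \<le> u" "u \<le> 1" by (auto simp: P_def)
    consider "u = t" | "t < u" "u < 1" | "u = 1" using u by linarith
    then show "x \<in> Fatou"
    proof cases
      case 1
      then show ?thesis using \<Gamma>A[OF t(3)] fA u(1) by blast
    next
      case 2
      then have "linepath w c u \<in> W" using t(1) t(4)[of u] seg[of u] by (simp add: W_def)
      then show ?thesis using WF u(1) by blast
    next
      case 3
      then have "x = Some c" using u(1) by (simp add: linepath_def)
      then show ?thesis using c C AF by blast
    qed
  qed
  moreover have "linepath w c 1 \<in> linepath w c ` {t..1}" using t(2) by (intro imageI) simp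
  then have "Some c \<in> P" unfolding P_def by (simp add: linepath_def)
  then have "P \<inter> A \<noteq> {}" using c C by blast
  ultimately have "P \<subseteq> A" by (rule maximal)
  moreover have "Some (linepath w c t) \<in> P" using t by (auto simp: P_def)
  ultimately show False using \<Gamma>A[OF t(3)] disj by blast
qed

end

theorem theorem2p1:
  fixes f :: "riemann_sphere \<Rightarrow> riemann_sphere" and p :: nat and A\<^sub>1 :: "riemann_sphere set"
  assumes "((\<exists>d\<ge>2. rational_map d f) \<and> p \<ge> 2 \<and> herman_ring UNIV f p A\<^sub>1) \<or>
           (transcendental_meromorphic f \<and> p \<ge> 1 \<and> herman_ring (range Some) f p A\<^sub>1)"
  shows "\<not> (\<exists>C. euclidean_circle C \<and> C \<subseteq> A\<^sub>1 \<and> (f ^^ p) ` C = C)"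
proof
  assume "\<exists>C. euclidean_circle C \<and> C \<subseteq> A\<^sub>1 \<and> (f ^^ p) ` C = C"
  then obtain a R where R: "R > 0" and C: "Some ` sphere a R \<subseteq> A\<^sub>1"
    and inv: "(f ^^ p) ` Some ` sphere a R = Some ` sphere a R"
    unfolding euclidean_circle_def by blast
  show False
    using assms
  proof (elim disjE conjE exE)
    fix d assume d: "2 \<le> d" and rat: "rational_map d f" and p: "p \<ge> 2" and A: "herman_ring UNIV f p A\<^sub>1"
    have d1: "d \<ge> 1" using d by simp
    obtain bad where bad: "finite bad"
      "\<And>w. w \<notin> bad \<Longrightarrow> card {z. f (Some z) = Some w} = d \<and> f None \<noteq> Some w"
      "\<And>w z. w \<notin> bad \<Longrightarrow> f (Some z) = Some w \<Longrightarrow> locally_injective (\<lambda>z. f (Some z)) z"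
      by (rule rational_map_generic[OF rat d1]) blast
    interpret generic_degree f d bad
      by unfold_locales (use bad d rational_map_hol_at[OF rat] in auto)
    show False by (rule no_invariant_circle_in_herman_ring[OF A p R C inv])
  next
    assume f: "transcendental_meromorphic f" and p: "p \<ge> 1" and A: "herman_ring (range Some) f p A\<^sub>1"
    have "A\<^sub>1 \<subseteq> fatou_set (range Some) f"
      using A connected_components_of_subset unfolding herman_ring_def fatou_component_def
      by (fastforce simp: connected_components_of_subset)
    \<comment> \<open>A Fatou point lies in the domain of every iterate; membership for the exponent
      \<open>Suc k\<close> is what makes the k-th value finite.\<close>
    have "(f ^^ k) (Some z) \<noteq> None" if "z \<in> sphere a R" for z k
    proof -
      have "Some z \<in> fatou_set (range Some) f" using that C \<open>A\<^sub>1 \<subseteq> fatou_set (range Some) f\<close> by blast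
      then have "Some z \<in> iterate_domain (range Some) f (Suc k)" unfolding fatou_set_def by blast
      then have "(f ^^ k) (Some z) \<in> range Some" unfolding iterate_domain_def by blast
      then show ?thesis by auto
    qed
    then show False
      by (intro transcendental_meromorphic_no_invariant_circle[OF f p R, of a]) (use inv in auto)
  qed
qed

end
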